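(* The constant term of $E_\beta(g,\nu,1)$ along the minimal parabolic $P_0$ is (as meromorphic functions of $\nu\in\mathbb C$) $$C_\beta^0(g,\nu,1)=C^0_{\beta,\mathrm{id}}(g,\nu,1)+C^0_{\beta,s_\alpha}(g,\nu,1)+C^0_{\beta,s_\alpha s_\beta}(g,\nu,1)+C^0_{\beta,s_\alpha s_\beta s_\alpha}(g,\nu,1),$$ where $$\begin{aligned} C^0_{\beta,\mathrm{id}}(g,\nu,1)&=y_1^{\nu+2},\\ C^0_{\beta,s_\alpha}(g,\nu,1)&=\frac{\Lambda(\nu+1)}{\Lambda(\nu+2)}y_1y_2^{\nu+1},\\ C^0_{\beta,s_\alpha s_\beta}(g,\nu,1)&=\frac{\Lambda(\nu)}{\Lambda(\nu+1)}\frac{\Lambda(\nu+1)}{\Lambda(\nu+2)}y_1y_2^{-\nu+1},\\ C^0_{\beta,s_\alpha s_\beta s_\alpha}(g,\nu,1)&=\frac{\Lambda(\nu-1)}{\Lambda(\nu)}\frac{\Lambda(\nu)}{\Lambda(\nu+1)}\frac{\Lambda(\nu+1)}{\Lambda(\nu+2)}y_1^{-\nu+2}. \end{aligned}$$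
   Context: Let $J=\begin{pmatrix}0&I_2\\-I_2&0\end{pmatrix}$, $G=\mathrm{Sp}(4,\mathbb R)=\{g\in\mathrm{GL}(4,\mathbb R): g^\top Jg=J\}$, $\Gamma=\mathrm{Sp}(4,\mathbb Z)$, $K=\left\{\begin{pmatrix}A&B\\-B&A\end{pmatrix}: A+iB\in U(2)\right\}$. Let $N_0$ be the group of matrices $\eta=\begin{pmatrix}1&n_1&n_2&n_3\\0&1&n_4&n_5\\0&0&1&0\\0&0&-n_1&1\end{pmatrix}$ with $n_3=n_1n_5+n_4$, the unipotent radical of the standard minimal parabolic $P_0$, with $d\eta=dn_1\,dn_2\,dn_4\,dn_5$. Every $g\in G/K$ has a unique (Iwasawa) representative $\eta\,\mathrm{diag}(y_1,y_2,y_1^{-1},y_2^{-1})$, $\eta\in N_0(\mathbb R)$, $y_1,y_2>0$; $y_1,y_2$ in the claim are these coordinates. Let $P_\beta=\begin{pmatrix}*&*&*&*\\0&*&*&*\\0&0&*&0\\0&*&*&*\end{pmatrix}\cap G$ be the Jacobi parabolic, $I_\beta(g,\nu)=y_1^{\nu+2}$ and $E_\beta(g,\nu,1)=\sum_{\gamma\in(P_\beta\cap\Gamma)\backslash\Gamma}I_\beta(\gamma g,\nu)$, continued meromorphically in $\nu\in\mathbb C$. The constant term is $C_\beta^0(g,\nu,1)=\int_{N_0(\mathbb Z)\backslash N_0(\mathbb R)}E_\beta(\eta g,\nu,1)\,d\eta$. The subscripts (Weyl group elements) are labels for the terms. $\Lambda(s)=\pi^{-s/2}\Gamma(s/2)\zeta(s)$.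 *)

theory Defs
  imports "HOL-Complex_Analysis.Complex_Analysis"
begin

no_notation fps_nth (infixl \<open>$\<close> 75)

type_synonym mat4 = "real^4^4"

lemma vector_4 [simp]:
  "(vector [a,b,c,d] :: 'a::zero^4) $ 1 = a"
  "(vector [a,b,c,d] :: 'a::zero^4) $ 2 = b"
  "(vector [a,b,c,d] :: 'a::zero^4) $ 3 = c"
  "(vector [a,b,c,d] :: 'a::zero^4) $ 4 = d"
  unfolding vector_def by simp_all


section \<open>The group \<open>Sp(4,\<real>)\<close> and its subgroups\<close>

definition block :: "real^2^2 \<Rightarrow> real^2^2 \<Rightarrow> real^2^2 \<Rightarrow> real^2^2 \<Rightarrow> mat4" where
  "block A B C D = vector
     [vector [A$1$1, A$1$2, B$1$1, B$1$2],
      vector [A$2$1, A$2$2, B$2$1, B$2$2],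
      vector [C$1$1, C$1$2, D$1$1, D$1$2],
      vector [C$2$1, C$2$2, D$2$1, D$2$2]]"

definition J4 :: mat4 where
  "J4 = block 0 (mat 1) (- mat 1) 0"

definition Sp4R :: "mat4 set" where
  "Sp4R = {g. invertible g \<and> transpose g ** J4 ** g = J4}"

definition Sp4Z :: "mat4 set" where
  "Sp4Z = {g \<in> Sp4R. \<forall>i j. g$i$j \<in> \<int>}"

definition U2 :: "(complex^2^2) set" where
  "U2 = {u. (\<chi> i j. cnj (u$j$i)) ** u = mat 1}"

definition K4 :: "mat4 set" where
  "K4 = {block A B (- B) A | A B. (\<chi> i j. Complex (A$i$j) (B$i$j)) \<in> U2}"

definition P_beta :: "mat4 set" where
  "P_beta = {g \<in> Sp4R. g$2$1 = 0 \<and> g$3$1 = 0 \<and> g$4$1 = 0 \<and>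
                       g$3$2 = 0 \<and> g$3$4 = 0}"

definition diag4 :: "real \<Rightarrow> real \<Rightarrow> mat4" where
  "diag4 y1 y2 = vector
     [vector [y1, 0, 0, 0],
      vector [0, y2, 0, 0],
      vector [0, 0, inverse y1, 0],
      vector [0, 0, 0, inverse y2]]"

text \<open>The coordinates of \<open>N\<^sub>0\<close> are \<open>(n\<^sub>1, n\<^sub>2, n\<^sub>4, n\<^sub>5)\<close>; the entry \<open>n\<^sub>3\<close> is determined by them.\<close>

fun eta :: "real \<times> real \<times> real \<times> real \<Rightarrow> mat4" where
  "eta (n1, n2, n4, n5) = vector
     [vector [1, n1, n2, n1 * n5 + n4],
      vector [0, 1, n4, n5],
      vector [0, 0, 1, 0],
      vector [0, 0, - n1, 1]]"

definition N0R :: "mat4 set" where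
  "N0R = range eta"

definition N0Z :: "mat4 set" where
  "N0Z = {h \<in> N0R. \<forall>i j. h$i$j \<in> \<int>}"


section \<open>Iwasawa coordinates\<close>

definition iwasawa_y :: "mat4 \<Rightarrow> real \<times> real" where
  "iwasawa_y g = (THE (y1, y2). 0 < y1 \<and> 0 < y2 \<and>
      (\<exists>h\<in>N0R. \<exists>k\<in>K4. g = h ** diag4 y1 y2 ** k))"

definition iwasawa_y1 :: "mat4 \<Rightarrow> real" where "iwasawa_y1 g = fst (iwasawa_y g)"
definition iwasawa_y2 :: "mat4 \<Rightarrow> real" where "iwasawa_y2 g = snd (iwasawa_y g)"


section \<open>Meromorphic continuation\<close>

text \<open>
  The meromorphic function on the whole plane that agrees with \<open>f\<close> on the half-plane \<open>Re z > c\<close>.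
  ``Nicely meromorphic'' means that removable singularities are removed and that the value at every
  pole is 0, so by the identity theorem there is at most one such function.
\<close>
definition mero_cont :: "real \<Rightarrow> (complex \<Rightarrow> complex) \<Rightarrow> complex \<Rightarrow> complex" where
  "mero_cont c f = (THE F. F nicely_meromorphic_on UNIV \<and> (\<forall>z. Re z > c \<longrightarrow> F z = f z))"

definition zeta :: "complex \<Rightarrow> complex" where
  "zeta = mero_cont 1 (\<lambda>s. \<Sum>n. 1 / of_nat (Suc n) powr s)"

definition Lambda :: "complex \<Rightarrow> complex" where
  "Lambda s = of_real pi powr (- s / 2) * Gamma (s / 2) * zeta s"


section \<open>The Eisenstein series and its constant term\<close>

definition I_beta :: "mat4 \<Rightarrow> complex \<Rightarrow> complex" where
  "I_beta g \<nu> = of_real (iwasawa_y1 g) powr (\<nu> + 2)"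

text \<open>\<open>(P\<^sub>\<beta> \<inter> \<Gamma>)\<setminus>\<Gamma>\<close>, the set of orbits \<open>(P\<^sub>\<beta> \<inter> \<Gamma>) \<gamma>\<close>.\<close>
definition cosets_beta :: "mat4 set set" where
  "cosets_beta = Sp4Z // {(\<gamma>, \<gamma>'). \<gamma> \<in> Sp4Z \<and> \<gamma>' \<in> Sp4Z \<and> (\<exists>p \<in> P_beta \<inter> Sp4Z. \<gamma>' = p ** \<gamma>)}"

text \<open>
  The summand does not depend on the representative, since \<open>y\<^sub>1\<close> is invariant under left
  multiplication by \<open>P\<^sub>\<beta> \<inter> \<Gamma>\<close>. The series converges absolutely exactly for \<open>Re \<nu> > 2\<close>.
\<close>
definition E_beta_series :: "mat4 \<Rightarrow> complex \<Rightarrow> complex" where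
  "E_beta_series g \<nu> = (\<Sum>\<^sub>\<infinity>c\<in>cosets_beta. I_beta ((SOME \<gamma>. \<gamma> \<in> c) ** g) \<nu>)"

definition E_beta :: "mat4 \<Rightarrow> complex \<Rightarrow> complex" where
  "E_beta g = mero_cont 2 (E_beta_series g)"

definition unit_box :: "(real \<times> real \<times> real \<times> real) set" where
  "unit_box = {0..<1} \<times> {0..<1} \<times> {0..<1} \<times> {0..<1}"

lemma eta_mult:
  "eta (m1,m2,m4,m5) ** eta (n1,n2,n4,n5) =
   eta (m1 + n1, n2 + m1 * n4 + m2 - n1 * (m1 * m5 + m4), n4 + m4 - n1 * m5, n5 + m5)"
  by (simp add: vec_eq_iff forall_4 matrix_matrix_mult_def sum_4 algebra_simps)

lemma eta_eq_iff: "eta m = eta n \<longleftrightarrow> m = n"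
  by (cases m; cases n) (auto simp: vec_eq_iff forall_4)

lemma N0R_E:
  assumes "h \<in> N0R"
  obtains n1 n2 n4 n5 where "h = eta (n1,n2,n4,n5)"
proof -
  obtain n where "h = eta n" using assms unfolding N0R_def by blast
  then show ?thesis by (cases n) (use that in blast)
qed

lemma eta_in_N0Z_iff:
  "eta (n1,n2,n4,n5) \<in> N0Z \<longleftrightarrow> n1 \<in> \<int> \<and> n2 \<in> \<int> \<and> n4 \<in> \<int> \<and> n5 \<in> \<int>"
proof -
  have "eta (n1,n2,n4,n5) \<in> N0R" unfolding N0R_def by (rule rangeI)
  then show ?thesis by (auto simp: N0Z_def forall_4)
qed

text \<open>The unit box is a strict fundamental domain for \<open>N\<^sub>0(\<int>)\<setminus>N\<^sub>0(\<real>)\<close>.\<close>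
lemma unit_box_fundamental_domain:
  assumes "h \<in> N0R"
  shows "\<exists>!n. n \<in> unit_box \<and> (\<exists>\<delta>\<in>N0Z. h = \<delta> ** eta n)"
proof -
  have Z: "\<exists>!x. x \<in> {0..<1} \<and> r - x \<in> \<int>" for r :: real
  proof (rule ex1I[of _ "frac r"])
    show "frac r \<in> {0..<1} \<and> r - frac r \<in> \<int>"
      using frac_lt_1[of r] frac_ge_0[of r] by (simp add: frac_def)
    show "x = frac r" if "x \<in> {0..<1} \<and> r - x \<in> \<int>" for x
      using that frac_unique_iff[of r x] by auto
  qed
  obtain a b c d where h: "h = eta (a,b,c,d)"
    using assms by (rule N0R_E)
  have iff: "(\<exists>\<delta>\<in>N0Z. h = \<delta> ** eta (n1,n2,n4,n5)) \<longleftrightarrow>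
      a - n1 \<in> \<int> \<and> d - n5 \<in> \<int> \<and> c + n1 * (d - n5) - n4 \<in> \<int> \<and>
      b - (a - n1) * n4 + n1 * ((a - n1) * (d - n5) + (c + n1 * (d - n5) - n4)) - n2 \<in> \<int>"
    (is "?L \<longleftrightarrow> ?R") for n1 n2 n4 n5
  proof
    assume ?L
    then obtain \<delta> where d: "\<delta> \<in> N0Z" "h = \<delta> ** eta (n1,n2,n4,n5)" by blast
    then have "\<delta> \<in> N0R" by (simp add: N0Z_def)
    then obtain m1 m2 m4 m5 where \<delta>: "\<delta> = eta (m1,m2,m4,m5)" by (rule N0R_E)
    note m = d(1)[unfolded \<delta>] and e = d(2)[unfolded \<delta>]
    have *: "a = m1 + n1" "b = n2 + m1 * n4 + m2 - n1 * (m1 * m5 + m4)"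
      "c = n4 + m4 - n1 * m5" "d = n5 + m5"
      using e unfolding h eta_mult eta_eq_iff by auto
    show ?R using m unfolding eta_in_N0Z_iff * by (simp add: algebra_simps)
  next
    assume R: ?R
    define \<delta> where "\<delta> = eta (a - n1, b - (a - n1) * n4
        + n1 * ((a - n1) * (d - n5) + (c + n1 * (d - n5) - n4)) - n2, c + n1 * (d - n5) - n4, d - n5)"
    have "\<delta> \<in> N0Z" using R unfolding \<delta>_def eta_in_N0Z_iff by blast
    moreover have "h = \<delta> ** eta (n1,n2,n4,n5)"
      unfolding h \<delta>_def eta_mult eta_eq_iff by (simp add: algebra_simps)
    ultimately show ?L by blast
  qed
  obtain n1 where n1: "n1 \<in> {0..<1} \<and> a - n1 \<in> \<int>" "\<And>x. x \<in> {0..<1} \<and> a - x \<in> \<int> \<Longrightarrow> x = n1"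
    using Z[of a] by blast
  obtain n5 where n5: "n5 \<in> {0..<1} \<and> d - n5 \<in> \<int>" "\<And>x. x \<in> {0..<1} \<and> d - x \<in> \<int> \<Longrightarrow> x = n5"
    using Z[of d] by blast
  define c' where "c' = c + n1 * (d - n5)"
  obtain n4 where n4: "n4 \<in> {0..<1} \<and> c' - n4 \<in> \<int>" "\<And>x. x \<in> {0..<1} \<and> c' - x \<in> \<int> \<Longrightarrow> x = n4"
    using Z[of c'] by blast
  define b' where "b' = b - (a - n1) * n4 + n1 * ((a - n1) * (d - n5) + (c + n1 * (d - n5) - n4))"
  obtain n2 where n2: "n2 \<in> {0..<1} \<and> b' - n2 \<in> \<int>" "\<And>x. x \<in> {0..<1} \<and> b' - x \<in> \<int> \<Longrightarrow> x = n2"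
    using Z[of b'] by blast
  show ?thesis
  proof (rule ex1I[of _ "(n1,n2,n4,n5)"])
    show "(n1,n2,n4,n5) \<in> unit_box \<and> (\<exists>\<delta>\<in>N0Z. h = \<delta> ** eta (n1,n2,n4,n5))"
      unfolding iff using n1(1) n2(1) n4(1) n5(1) by (simp add: unit_box_def b'_def c'_def)
  next
    fix n assume n: "n \<in> unit_box \<and> (\<exists>\<delta>\<in>N0Z. h = \<delta> ** eta n)"
    obtain x1 x2 x4 x5 where x: "n = (x1,x2,x4,x5)" by (cases n)
    have box: "x1 \<in> {0..<1}" "x2 \<in> {0..<1}" "x4 \<in> {0..<1}" "x5 \<in> {0..<1}"
      using n unfolding x unit_box_def by auto
    note R = n[unfolded x iff, THEN conjunct2]
    have 1: "x1 = n1" using R box n1(2) by blast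
    have 5: "x5 = n5" using R box n5(2) by blast
    have 4: "x4 = n4" using R box n4(2) unfolding 1 5 c'_def by blast
    have 2: "x2 = n2" using R box n2(2) unfolding 1 4 5 b'_def by blast
    show "n = (n1,n2,n4,n5)" unfolding x 1 2 4 5 ..
  qed
qed

text \<open>
  Integration over \<open>N\<^sub>0(\<int>)\<setminus>N\<^sub>0(\<real>)\<close> with respect to \<open>dn\<^sub>1 dn\<^sub>2 dn\<^sub>4 dn\<^sub>5\<close>, carried out on the
  fundamental domain; the integrand is left \<open>N\<^sub>0(\<int>)\<close>-invariant.
\<close>
definition C0_beta :: "mat4 \<Rightarrow> complex \<Rightarrow> complex" where
  "C0_beta g \<nu> = (LINT n:unit_box|lborel. E_beta (eta n ** g) \<nu>)"

end

theory Submission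
  imports Defs "HOL-Probability.Probability"
begin

text \<open>
  The third row of \<open>\<gamma> \<in> \<Gamma>\<close> is a primitive integral vector \<open>v\<close>; up to sign it determines the coset of \<open>\<gamma>\<close>
  modulo \<open>P\<^sub>\<beta> \<inter> \<Gamma>\<close>, and every primitive vector occurs (\<open>bij_betw_coset_vec\<close>). Since \<open>y\<^sub>1(g)\<close> is the inverse norm
  of the third row of \<open>g\<close>, the Eisenstein series is an Epstein zeta function: with \<open>s = \<nu> + 2\<close>,
  \<open>2 \<zeta>(s) E\<^sub>\<beta>(g, \<nu>)\<close> is the sum of \<open>\<bar>v g\<bar>^(-s)\<close> over all nonzero \<open>v \<in> \<int>\<^sup>4\<close>. Completed by the factor
  \<open>\<pi>^(-s/2) \<Gamma>(s/2)\<close>, this is the Mellin transform at \<open>s/2\<close> of \<open>\<theta>\<^sub>g(t) - 1\<close>, where \<open>\<theta>\<^sub>g(t) = \<Sum>\<^sub>v exp (- \<pi> t \<bar>v g\<bar>\<^sup>2)\<close>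
  (\<open>mellin_lattice_theta\<close>).

  Continuation. It suffices that \<open>\<theta>\<^sub>g(t) - 1\<close> decays rapidly at infinity and \<open>\<theta>\<^sub>g(t) - t^(-2)\<close> vanishes to infinite order at 0;
  then the Mellin transform continues with poles at \<open>s = 0\<close> and \<open>s = 4\<close> only (\<open>mellin_meromorphic\<close>). In
  Iwasawa coordinates the sum over \<open>v\<close> is a nested sum of four shifted one-dimensional Gaussian sums, and
  such a sum is, up to a scalar, a value of the heat kernel of the circle, which converges rapidly to the uniform density
  by a contraction argument (\<open>circle_heat_rapid\<close>). The bounds obtained are uniform in \<open>\<eta>\<close>
  (\<open>lattice_theta_uniform\<close>), so the integral over \<open>\<eta>\<close> can be exchanged with the Mellin transform for every
  \<open>s\<close> (\<open>mellin_theta_avg\<close>). The same method in rank 1 continues the zeta function.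

  Constant term. What remains is the mean of \<open>\<theta>\<^sub>\<eta>\<^sub>g(t)\<close> over \<open>N\<^sub>0(\<int>)\<setminus>N\<^sub>0(\<real>)\<close>, an integral of positive terms
  (\<open>mean_theta\<close>). Sort the vectors \<open>v = (a, b, c, d)\<close> by the first nonzero entry in the order \<open>a, b, d, c\<close>;
  these four classes are the Bruhat cells. If it is \<open>a\<close>, the means over three of the coordinates of \<open>\<eta>\<close> turn the sums over
  \<open>b, d, c\<close> into Gaussian integrals over the line (\<open>nn_integral_unfold_int\<close>), and a sum over \<open>a \<noteq> 0\<close> is left;
  similarly in the other cells. So the mean of \<open>\<theta>\<^sub>\<eta>\<^sub>g - 1\<close> is a sum of four terms of the form
  const \<open>t^(-j/2) (\<vartheta>(y^(\<plusminus>2) t) - 1)\<close> with Jacobi's \<open>\<vartheta>\<close> and \<open>j = 0, 1, 2, 3\<close>, whose Mellin transforms are multiples of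
  \<open>\<Lambda>(s - j)\<close>. Dividing by \<open>2 \<Lambda>(s)\<close> gives the four terms for large \<open>Re \<nu>\<close>, and the identity theorem gives the
  equality of meromorphic functions.
\<close>

section \<open>The symplectic group and its Iwasawa coordinates\<close>

definition symp :: "real^4 \<Rightarrow> real^4 \<Rightarrow> real" where
  "symp x y = x$1 * y$3 + x$2 * y$4 - x$3 * y$1 - x$4 * y$2"

lemma J4_nth [simp]:
  "J4$1$1 = 0" "J4$1$2 = 0" "J4$1$3 = 1" "J4$1$4 = 0"
  "J4$2$1 = 0" "J4$2$2 = 0" "J4$2$3 = 0" "J4$2$4 = 1"
  "J4$3$1 = -1" "J4$3$2 = 0" "J4$3$3 = 0" "J4$3$4 = 0"
  "J4$4$1 = 0" "J4$4$2 = -1" "J4$4$3 = 0" "J4$4$4 = 0"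
  by (simp_all add: J4_def block_def mat_def)

lemmas mat4_entries = vec_eq_iff forall_4 matrix_matrix_mult_def sum_4 transpose_def mat_def

lemma J4_squared: "J4 ** J4 = - mat 1"
  by (simp add: mat4_entries)

text \<open>
  Closed form of the inverse, so that inverses of integral symplectic matrices are visibly integral.
\<close>
definition symp_inv :: "mat4 \<Rightarrow> mat4" where "symp_inv g = - (J4 ** transpose g ** J4)"

lemma matrix_mult_minus_left: "(- A) ** B = - (A ** B)" for A B :: mat4
  by (simp add: mat4_entries)

lemma matrix_mult_minus_right: "A ** (- B) = - (A ** B)" for A B :: mat4
  by (simp add: mat4_entries)

lemma Sp4R_iff: "g \<in> Sp4R \<longleftrightarrow> transpose g ** J4 ** g = J4"
proof -
  have "invertible g" if "transpose g ** J4 ** g = J4"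
  proof -
    have "symp_inv g ** g = - (J4 ** (transpose g ** J4 ** g))"
      by (simp add: symp_inv_def matrix_mult_minus_left matrix_mul_assoc)
    also have "\<dots> = mat 1" by (simp add: that J4_squared)
    finally show ?thesis by (meson invertible_left_inverse)
  qed
  then show ?thesis by (auto simp: Sp4R_def)
qed

lemma symp_inv_left: "g \<in> Sp4R \<Longrightarrow> symp_inv g ** g = mat 1"
proof -
  assume "g \<in> Sp4R"
  then have "transpose g ** J4 ** g = J4" by (simp add: Sp4R_iff)
  moreover have "symp_inv g ** g = - (J4 ** (transpose g ** J4 ** g))"
    by (simp add: symp_inv_def matrix_mult_minus_left matrix_mul_assoc)
  ultimately show ?thesis by (simp add: J4_squared)
qed

lemma symp_inv_right: "g \<in> Sp4R \<Longrightarrow> g ** symp_inv g = mat 1"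
  using symp_inv_left matrix_left_right_inverse by blast

lemma Sp4R_transpose: "g \<in> Sp4R \<Longrightarrow> g ** J4 ** transpose g = J4"
proof -
  assume "g \<in> Sp4R"
  then have "g ** symp_inv g ** J4 = J4" by (simp add: symp_inv_right)
  moreover have "g ** symp_inv g ** J4 = - (g ** J4 ** transpose g ** (J4 ** J4))"
    by (simp add: symp_inv_def matrix_mult_minus_right matrix_mult_minus_left matrix_mul_assoc)
  ultimately show ?thesis by (simp add: J4_squared matrix_mult_minus_right)
qed

text \<open>
  The rows of a symplectic matrix are a symplectic basis: membership in the group is mostly used through these relations.
\<close>
lemma Sp4R_symp: "g \<in> Sp4R \<Longrightarrow> symp (g$i) (g$j) = J4$i$j"
proof -
  assume "g \<in> Sp4R"
  then have "(g ** J4 ** transpose g)$i$j = J4$i$j" by (simp add: Sp4R_transpose)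
  then show ?thesis by (simp add: mat4_entries symp_def algebra_simps)
qed

lemma Sp4R_mult: "g \<in> Sp4R \<Longrightarrow> h \<in> Sp4R \<Longrightarrow> g ** h \<in> Sp4R"
proof -
  assume g: "g \<in> Sp4R" and h: "h \<in> Sp4R"
  have "transpose (g ** h) ** J4 ** (g ** h) = transpose h ** (transpose g ** J4 ** g) ** h"
    by (simp add: matrix_transpose_mul matrix_mul_assoc)
  then show ?thesis using g h by (simp add: Sp4R_iff)
qed

lemma symp_inv_Sp4R: "g \<in> Sp4R \<Longrightarrow> symp_inv g \<in> Sp4R"
proof -
  assume g: "g \<in> Sp4R"
  have "transpose (symp_inv g) = - (J4 ** g ** J4)"
    by (simp add: symp_inv_def mat4_entries)
  then have "transpose (symp_inv g) ** J4 ** symp_inv g = J4 ** g ** (J4 ** J4) ** J4 ** transpose g ** J4"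
    by (simp add: symp_inv_def matrix_mult_minus_left matrix_mult_minus_right matrix_mul_assoc)
  also have "\<dots> = - (J4 ** (g ** J4 ** transpose g) ** J4)"
    by (simp add: J4_squared matrix_mult_minus_left matrix_mult_minus_right matrix_mul_assoc)
  also have "\<dots> = - ((J4 ** J4) ** J4)" by (simp add: Sp4R_transpose g)
  also have "\<dots> = J4" by (simp add: J4_squared matrix_mult_minus_left)
  finally show ?thesis by (simp add: Sp4R_iff)
qed

lemma Sp4Z_mult: "g \<in> Sp4Z \<Longrightarrow> h \<in> Sp4Z \<Longrightarrow> g ** h \<in> Sp4Z"
  unfolding Sp4Z_def mem_Collect_eq
  by (intro conjI Sp4R_mult) (auto simp: matrix_matrix_mult_def intro!: Ints_sum Ints_mult)

lemma symp_inv_Sp4Z: "g \<in> Sp4Z \<Longrightarrow> symp_inv g \<in> Sp4Z"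
proof -
  assume g: "g \<in> Sp4Z"
  have J: "\<forall>i j. J4$i$j \<in> \<int>" by (simp add: forall_4)
  have "(J4 ** transpose g ** J4)$i$j \<in> \<int>" for i j
    using g J by (auto simp: Sp4Z_def matrix_matrix_mult_def transpose_def intro!: Ints_sum Ints_mult)
  then show ?thesis using g by (simp add: Sp4Z_def symp_inv_Sp4R) (simp add: symp_inv_def)
qed

text \<open>
  The real and imaginary parts of \<open>u\<^sup>* u = 1\<close> are the blocks of \<open>k\<^sup>T k = 1\<close>.
\<close>
lemma K4_orthogonal:
  assumes "k \<in> K4"
  shows "k ** transpose k = mat 1"
proof -
  obtain A B where k: "k = block A B (- B) A" and u: "(\<chi> i j. Complex (A$i$j) (B$i$j)) \<in> U2"
    using assms by (auto simp: K4_def)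
  define U :: "complex^2^2" where "U = (\<chi> i j. Complex (A$i$j) (B$i$j))"
  have U: "(\<Sum>l\<in>UNIV. cnj (U$l$i) * U$l$j) = (if i = j then 1 else 0)" for i j
  proof -
    have "((\<chi> i j. cnj (U$j$i)) ** U)$i$j = (mat 1 :: complex^2^2)$i$j" using u by (simp add: U2_def U_def)
    then show ?thesis by (simp add: matrix_matrix_mult_def mat_def)
  qed
  have re: "A$1$i * A$1$j + B$1$i * B$1$j + (A$2$i * A$2$j + B$2$i * B$2$j) = (if i = j then 1 else 0)" for i j
    using arg_cong[OF U[of i j], of Re] by (simp add: sum_2 U_def if_distrib[of Re] cong: if_cong)
  have im: "A$1$i * B$1$j - B$1$i * A$1$j + (A$2$i * B$2$j - B$2$i * A$2$j) = 0" for i j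
    using arg_cong[OF U[of i j], of Im] by (simp add: sum_2 U_def if_distrib[of Im] cong: if_cong)
  have "(transpose k ** k)$i$j = mat 1 $ i $ j" for i j
  proof -
    have *: "\<forall>i j. (transpose k ** k)$i$j = mat 1 $ i $ j"
      unfolding forall_4 k block_def matrix_matrix_mult_def transpose_def mat_def sum_4
      apply (simp only: vec_lambda_beta vector_4 vector_uminus_component)
      apply (intro conjI)
      using re[of 1 1] re[of 1 2] re[of 2 1] re[of 2 2] im[of 1 1] im[of 1 2] im[of 2 1] im[of 2 2]
      by (simp_all only: simp_thms if_True if_False num1_eq1 zero_neq_one one_neq_zero; simp; linarith)+
    then show ?thesis by blast
  qed
  then have "transpose k ** k = mat 1" by (simp add: vec_eq_iff)
  then show ?thesis using matrix_left_right_inverse by blast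
qed

lemma K4_Sp4R: "k \<in> K4 \<Longrightarrow> k \<in> Sp4R"
proof -
  assume k: "k \<in> K4"
  have c: "J4 ** k = k ** J4"
    using k by (auto simp: K4_def block_def mat4_entries)
  have "transpose k ** k = mat 1"
    using K4_orthogonal[OF k] matrix_left_right_inverse by blast
  then have "transpose k ** (k ** J4) = J4" by (simp add: matrix_mul_assoc)
  then show ?thesis by (simp add: Sp4R_iff c flip: matrix_mul_assoc)
qed

lemma eta_Sp4R: "eta n \<in> Sp4R"
  by (cases n) (simp add: Sp4R_iff mat4_entries algebra_simps)

text \<open>
  Rows 3 and 4 of \<open>g\<close> span a Lagrangian plane. An orthonormal basis \<open>u, v\<close> of it, found by
  Gram--Schmidt, together with its image under \<open>J\<close> forms the rows of some \<open>k \<in> K\<close>. In \<open>M = g k\<^sup>T\<close> the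
  lower left block vanishes because the plane is isotropic, and the lower right block is triangular
  with positive diagonal by construction; the symplectic relations between the rows of \<open>M\<close> then leave
  exactly the shape \<open>\<eta> diag(y)\<close>.
\<close>
lemma iwasawa_exists:
  assumes g: "g \<in> Sp4R"
  obtains n y1 y2 k where "y1 > 0" "y2 > 0" "k \<in> K4" "g = eta n ** diag4 y1 y2 ** k"
proof -
  define r where "r = g$3"
  define s where "s = g$4"
  have symp0: "symp r s = 0" and symp1: "symp (g$1) r = 1" "symp (g$2) s = 1" "symp (g$2) r = 0"
    using Sp4R_symp[OF g] by (simp_all add: r_def s_def)
  have r0: "r \<noteq> 0" using symp1 by (auto simp: symp_def)
  define w where "w = s - (r \<bullet> s / (r \<bullet> r)) *\<^sub>R r"
  have rw: "r \<bullet> w = 0" using r0 by (simp add: w_def inner_diff_right)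
  have w0: "w \<noteq> 0"
  proof
    assume "w = 0"
    then have s: "s = (r \<bullet> s / (r \<bullet> r)) *\<^sub>R r" by (simp add: w_def)
    have "symp (g$2) (c *\<^sub>R r) = c * symp (g$2) r" for c by (simp add: symp_def algebra_simps)
    then show False using symp1 s by (metis mult_zero_right zero_neq_one)
  qed
  define a where "a = norm r"
  define b where "b = norm w"
  have ab: "a > 0" "b > 0" "a * a = r \<bullet> r" "b * b = w \<bullet> w"
    using r0 w0 by (auto simp: a_def b_def dot_square_norm power2_eq_square)
  define u where "u = (1 / a) *\<^sub>R r"
  define v where "v = (1 / b) *\<^sub>R w"
  have orth: "u \<bullet> u = 1" "v \<bullet> v = 1" "u \<bullet> v = 0" "symp u v = 0"
  proof -
    show "u \<bullet> u = 1" "v \<bullet> v = 1" using ab r0 w0 by (simp_all add: u_def v_def flip: ab(3,4))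
    show "u \<bullet> v = 0" using rw by (simp add: u_def v_def)
    have "symp (x *\<^sub>R r) (y *\<^sub>R (s - z *\<^sub>R r)) = x * y * (symp r s - z * symp r r)" for x y z
      by (simp add: symp_def algebra_simps)
    moreover have "symp r r = 0" by (simp add: symp_def)
    ultimately show "symp u v = 0" using symp0 by (simp add: u_def v_def w_def)
  qed
  define A :: "real^2^2" where "A = vector [vector [u$3, u$4], vector [v$3, v$4]]"
  define B :: "real^2^2" where "B = vector [vector [- u$1, - u$2], vector [- v$1, - v$2]]"
  define k where "k = block A B (- B) A"
  have o: "u$1*u$1+u$2*u$2+u$3*u$3+u$4*u$4 = 1" "v$1 * v$1+v$2 * v$2+v$3 * v$3+v$4 * v$4 = 1"
    "u$1 * v$1+u$2 * v$2+u$3 * v$3+u$4 * v$4 = 0" "u$1 * v$3 + u$2 * v$4 - u$3 * v$1 - u$4 * v$2 = 0"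
    using orth by (simp_all add: inner_vec_def sum_4 symp_def)
  define U :: "complex^2^2" where "U = (\<chi> i j. Complex (A$i$j) (B$i$j))"
  have "U ** (\<chi> i j. cnj (U$j$i)) = mat 1"
    using o by (simp add: U_def A_def B_def vec_eq_iff forall_2 matrix_matrix_mult_def sum_2 mat_def complex_eq_iff)
      (auto simp: algebra_simps)
  then have "U \<in> U2" unfolding U2_def using matrix_left_right_inverse by blast
  then have k: "k \<in> K4" unfolding k_def K4_def U_def by blast
  have k_rows: "k = vector [vector [u$3, u$4, - u$1, - u$2], vector [v$3, v$4, - v$1, - v$2],
     vector [u$1, u$2, u$3, u$4], vector [v$1, v$2, v$3, v$4]]"
    by (simp add: k_def block_def A_def B_def)
  \<comment> \<open>The entries of \<open>M\<close> are symplectic pairings (columns 1, 2) and inner products (columns 3, 4) with \<open>u, v\<close>.\<close>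
  define M where "M = g ** transpose k"
  have gM: "g = M ** k"
  proof -
    have "transpose k ** k = mat 1"
      using K4_orthogonal[OF k] matrix_left_right_inverse by blast
    then show ?thesis by (simp add: M_def flip: matrix_mul_assoc)
  qed
  have M: "M \<in> Sp4R"
  proof -
    have "transpose k = symp_inv k"
    proof -
      have "symp_inv k = symp_inv k ** (k ** transpose k)" by (simp add: K4_orthogonal[OF k])
      also have "\<dots> = transpose k" by (simp add: matrix_mul_assoc symp_inv_left[OF K4_Sp4R[OF k]])
      finally show ?thesis ..
    qed
    then show ?thesis unfolding M_def by (simp add: Sp4R_mult[OF g symp_inv_Sp4R[OF K4_Sp4R[OF k]]])
  qed
  have M_entry: "M$i$1 = symp (g$i) u" "M$i$2 = symp (g$i) v" "M$i$3 = g$i \<bullet> u" "M$i$4 = g$i \<bullet> v" for i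
    by (simp_all add: M_def k_rows matrix_matrix_mult_def transpose_def sum_4 symp_def inner_vec_def algebra_simps)
  have sv: "s = b *\<^sub>R v + (r \<bullet> s / a) *\<^sub>R u" and ru: "r = a *\<^sub>R u"
    using ab by (simp_all add: u_def v_def w_def)
  have symp_lin: "symp (c *\<^sub>R x + d *\<^sub>R y) z = c * symp x z + d * symp y z" "symp (c *\<^sub>R x) z = c * symp x z" for c d x y z
    by (simp_all add: symp_def algebra_simps)
  have symp_uu: "symp u u = 0" "symp v v = 0" "symp v u = 0"
  proof -
    have "symp v u = - symp u v" by (simp add: symp_def algebra_simps)
    then show "symp v u = 0" using orth(4) by simp
  qed (simp_all add: symp_def)
  define m where "m = r \<bullet> s / a"
  have M34: "M$3$1 = 0" "M$3$2 = 0" "M$3$3 = a" "M$3$4 = 0" "M$4$1 = 0" "M$4$2 = 0" "M$4$3 = m" "M$4$4 = b"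
    unfolding M_entry r_def[symmetric] s_def[symmetric]
    by (subst ru sv; simp add: symp_lin symp_uu orth inner_add_left inner_commute[of v u] m_def)+
  have sM: "M$1$1 * a = 1" "M$2$1 = 0" "M$1$1 * m + M$1$2 * b = 0" "M$2$2 * b = 1"
    "M$1$1 * M$2$3 + M$1$2 * M$2$4 - M$1$3 * M$2$1 - M$1$4 * M$2$2 = 0"
    using Sp4R_symp[OF M, of 1 3] Sp4R_symp[OF M, of 2 3] Sp4R_symp[OF M, of 1 4] Sp4R_symp[OF M, of 2 4]
      Sp4R_symp[OF M, of 1 2] ab
    by (simp_all add: symp_def M34)
  define n where "n = (- m / a, M$1$3 / a, M$2$3 / a, M$2$4 / b)"
  have M11: "M$1$1 = 1 / a" and M22: "M$2$2 = 1 / b" using sM ab by (simp_all add: field_simps)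
  have M12: "M$1$2 = - m / (a * b)" using sM(3) ab unfolding M11 by (simp add: field_simps)
  have M14: "M$1$4 = b * (- m / a * (M$2$4 / b) + M$2$3 / a)"
    using sM(5) ab w0 unfolding M11 M22 M12 sM(2) by (simp add: field_simps)
  have "M = eta n ** diag4 (1 / a) (1 / b)"
    using ab by (simp add: n_def diag4_def mat4_entries M34 sM(2) M11 M22 M12 M14)
  then show thesis using that[of "1/a" "1/b" k n] k ab gM by simp
qed

text \<open>
  Since \<open>K\<close> is orthogonal, \<open>g g\<^sup>T\<close> depends only on \<open>\<eta>\<close> and \<open>y\<close>. Its entries at positions \<open>(3,3)\<close>,
  \<open>(3,4)\<close> and \<open>(4,4)\<close> determine \<open>y\<close>, which is the uniqueness in the next lemma.
\<close>
lemma iwasawa_gram: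
  assumes "k \<in> K4"
  shows "(eta n ** diag4 y1 y2 ** k) ** transpose (eta n ** diag4 y1 y2 ** k) =
     (eta n ** diag4 y1 y2) ** transpose (eta n ** diag4 y1 y2)"
proof -
  have "(eta n ** diag4 y1 y2 ** k) ** transpose (eta n ** diag4 y1 y2 ** k) =
     (eta n ** diag4 y1 y2) ** (k ** transpose k) ** transpose (eta n ** diag4 y1 y2)"
    by (simp add: matrix_transpose_mul matrix_mul_assoc)
  then show ?thesis by (simp add: K4_orthogonal assms)
qed

lemma iwasawa_y_eq:
  assumes "y1 > 0" "y2 > 0" "k \<in> K4"
  shows "iwasawa_y (eta n ** diag4 y1 y2 ** k) = (y1, y2)"
proof -
  let ?P = "\<lambda>(z1, z2). 0 < z1 \<and> 0 < z2 \<and> (\<exists>h\<in>N0R. \<exists>k'\<in>K4. eta n ** diag4 y1 y2 ** k = h ** diag4 z1 z2 ** k')"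
  have "(THE z. ?P z) = (y1, y2)"
  proof (rule the_equality)
    have "eta n \<in> N0R" by (simp add: N0R_def)
    then show "?P (y1, y2)" using assms by blast
  next
    fix z assume "?P z"
    then obtain z1 z2 n' k' where z: "z = (z1, z2)" "z1 > 0" "z2 > 0" "k' \<in> K4"
      "eta n ** diag4 y1 y2 ** k = eta n' ** diag4 z1 z2 ** k'"
      by (auto simp: N0R_def)
    have G: "(eta n ** diag4 y1 y2) ** transpose (eta n ** diag4 y1 y2) = (eta n' ** diag4 z1 z2) ** transpose (eta n' ** diag4 z1 z2)"
      using iwasawa_gram[OF assms(3), of n y1 y2] iwasawa_gram[OF z(4), of n' z1 z2] z(5) by simp
    obtain n1 n2 n4 n5 where n: "n = (n1,n2,n4,n5)" by (cases n)
    obtain m1 m2 m4 m5 where m: "n' = (m1,m2,m4,m5)" by (cases n')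
    have e: "inverse y1 * inverse y1 = inverse z1 * inverse z1"
      "n1 * inverse y1 * inverse y1 = m1 * inverse z1 * inverse z1"
      "n1 * inverse y1 * (n1 * inverse y1) + inverse y2 * inverse y2 = m1 * inverse z1 * (m1 * inverse z1) + inverse z2 * inverse z2"
      using arg_cong[OF G, of "\<lambda>A. A$3$3"] arg_cong[OF G, of "\<lambda>A. A$3$4"] arg_cong[OF G, of "\<lambda>A. A$4$4"]
      by (simp_all add: n m diag4_def matrix_matrix_mult_def transpose_def sum_4 algebra_simps)
    have "(inverse y1)\<^sup>2 = (inverse z1)\<^sup>2" using e(1) by (simp add: power2_eq_square)
    then have "inverse y1 = inverse z1" by (rule power2_eq_imp_eq) (use assms z in auto)
    then have 1: "y1 = z1" by simp
    then have "n1 = m1" using e(2) assms by simp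
    then have "inverse y2 * inverse y2 = inverse z2 * inverse z2" using e(3) 1 by simp
    then have "(inverse y2)\<^sup>2 = (inverse z2)\<^sup>2" by (simp add: power2_eq_square)
    then have "inverse y2 = inverse z2" by (rule power2_eq_imp_eq) (use assms z in auto)
    then have "y2 = z2" by simp
    then show "z = (y1, y2)" using 1 z by simp
  qed
  then show ?thesis unfolding iwasawa_y_def .
qed

text \<open>
  The third row of \<open>\<eta> diag(y)\<close> is \<open>y\<^sub>1^(-1)\<close> times the third unit vector, and \<open>K\<close> preserves the norm.
  This turns the summand of the Eisenstein series into a function of one row of \<open>\<gamma> g\<close>.
\<close>
lemma iwasawa_y1_eq:
  assumes "g \<in> Sp4R"
  shows "iwasawa_y1 g = 1 / norm (g$3)" "g$3 \<noteq> 0"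
proof -
  obtain n y1 y2 k where *: "y1 > 0" "y2 > 0" "k \<in> K4" "g = eta n ** diag4 y1 y2 ** k"
    using iwasawa_exists[OF assms] .
  have y: "iwasawa_y1 g = y1" using iwasawa_y_eq[OF *(1-3), of n] *(4) by (simp add: iwasawa_y1_def)
  have "(g ** transpose g)$3$3 = inverse y1 * inverse y1"
    using iwasawa_gram[OF *(3), of n y1 y2] *(4)
    by (cases n) (simp add: diag4_def matrix_matrix_mult_def transpose_def sum_4)
  then have "(norm (g$3))\<^sup>2 = (inverse y1)\<^sup>2"
    unfolding power2_norm_eq_inner by (simp add: matrix_matrix_mult_def transpose_def sum_4 inner_vec_def power2_eq_square)
  then have "norm (g$3) = inverse y1" using * by (simp add: power2_eq_iff_nonneg)
  then show "iwasawa_y1 g = 1 / norm (g$3)" "g$3 \<noteq> 0" using y * by (auto simp: divide_inverse)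
qed

section \<open>Cosets and primitive vectors\<close>

type_synonym int4 = "int \<times> int \<times> int \<times> int"

fun rvec :: "int4 \<Rightarrow> real^4" where
  "rvec (a, b, c, d) = vector [of_int a, of_int b, of_int c, of_int d]"

fun iscale :: "int \<Rightarrow> int4 \<Rightarrow> int4" where
  "iscale m (a, b, c, d) = (m * a, m * b, m * c, m * d)"

definition ivec :: "real^4 \<Rightarrow> int4" where
  "ivec x = (\<lfloor>x$1\<rfloor>, \<lfloor>x$2\<rfloor>, \<lfloor>x$3\<rfloor>, \<lfloor>x$4\<rfloor>)"

lemma rvec_inject: "rvec v = rvec w \<longleftrightarrow> v = w"
  by (cases v; cases w) (auto simp: vec_eq_iff forall_4)

lemma rvec_iscale: "rvec (iscale m v) = of_int m *\<^sub>R rvec v"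
  by (cases v) (auto simp: vec_eq_iff forall_4)

lemma rvec_ivec_row: "g \<in> Sp4Z \<Longrightarrow> rvec (ivec (g$i)) = g$i"
proof -
  assume "g \<in> Sp4Z"
  then have "real_of_int \<lfloor>g$i$j\<rfloor> = g$i$j" for j by (simp add: Sp4Z_def)
  then show ?thesis by (simp add: ivec_def vec_eq_iff forall_4)
qed

lemma row_mult: "(A ** g)$i = A$i v* g" for A g :: mat4
  by (simp add: vec_eq_iff matrix_matrix_mult_def vector_matrix_mult_def mult.commute)

text \<open>
  A row \<open>(a, c)\<close> is its gcd times the bottom row of a matrix of determinant 1; for \<open>a = c = 0\<close> the
  bottom row is taken from the identity matrix.
\<close>
lemma bezout_completion:
  fixes a c :: int
  obtains d p q x y where "a = d * p" "c = d * q" "x * q - y * p = 1" "d = gcd a c"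
proof (cases "gcd a c = 0")
  case True
  then show thesis using that[of 0 0 1 1 0] by simp
next
  case False
  define d where "d = gcd a c"
  obtain u v where uv: "u * a + v * c = d" using bezout_int unfolding d_def by blast
  obtain p q where a: "a = d * p" and c: "c = d * q" unfolding d_def by (meson dvdE gcd_dvd1 gcd_dvd2)
  have "d * (v * q - (- u) * p) = u * (d * p) + v * (d * q)" by (simp add: algebra_simps)
  also have "\<dots> = d * 1" using uv unfolding a[symmetric] c[symmetric] by simp
  finally have "v * q - (- u) * p = 1" using False mult_cancel_left[of d] by (auto simp: d_def)
  then show thesis using that[OF a c _ d_def] by blast
qed

text \<open>
  Two commuting copies of \<open>SL(2,\<int>)\<close>, in the coordinates \<open>(1,3)\<close> and \<open>(2,4)\<close>, produce the rows
  \<open>(a, c)\<close> and \<open>(b, e)\<close> divided by their gcds. These two gcds are coprime, so the copy of \<open>SL(2,\<int>)\<close> in the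
  Levi subgroup of the Siegel parabolic can combine the two rows with the right multiplicities.
\<close>
lemma primitive_row_completion:
  assumes "gcd (gcd a c) (gcd b e) = 1"
  obtains g where "g \<in> Sp4Z" "g$3 = rvec (a, b, c, e)"
proof -
  obtain d1 p q x y where 1: "a = d1 * p" "c = d1 * q" "x * q - y * p = 1" "d1 = gcd a c"
    by (rule bezout_completion)
  obtain d2 p' q' x' y' where 2: "b = d2 * p'" "e = d2 * q'" "x' * q' - y' * p' = 1" "d2 = gcd b e"
    by (rule bezout_completion)
  obtain u v where 3: "u * d1 + v * d2 = 1" using assms 1 2 bezout_int by metis
  have r1: "real_of_int x * real_of_int q - real_of_int y * real_of_int p = 1"
    using arg_cong[OF 1(3), of real_of_int] by simp
  have r2: "real_of_int x' * real_of_int q' - real_of_int y' * real_of_int p' = 1"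
    using arg_cong[OF 2(3), of real_of_int] by simp
  have r3: "real_of_int u * real_of_int d1 + real_of_int v * real_of_int d2 = 1"
    using arg_cong[OF 3, of real_of_int] by simp
  \<comment> \<open>\<open>h\<close> lies in the product of the two copies of \<open>SL(2,\<int>)\<close>, \<open>l\<close> is \<open>diag(A, A^(-T))\<close> for a matrix \<open>A\<close> of determinant 1.\<close>
  define h :: mat4 where "h = vector [vector [of_int x, 0, of_int y, 0], vector [0, of_int x', 0, of_int y'],
     vector [of_int p, 0, of_int q, 0], vector [0, of_int p', 0, of_int q']]"
  define l :: mat4 where "l = vector [vector [of_int u, of_int v, 0, 0], vector [- of_int d2, of_int d1, 0, 0],
     vector [0, 0, of_int d1, of_int d2], vector [0, 0, - of_int v, of_int u]]"
  have "h \<in> Sp4R" using r1 r2 by (simp add: Sp4R_iff h_def mat4_entries algebra_simps)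
  moreover have "l \<in> Sp4R" using r3 by (simp add: Sp4R_iff l_def mat4_entries algebra_simps)
  ultimately have "h \<in> Sp4Z" "l \<in> Sp4Z"
    by (auto simp: Sp4Z_def forall_4 h_def l_def)
  then have "l ** h \<in> Sp4Z" by (intro Sp4Z_mult)
  moreover have "(l ** h)$3 = rvec (a, b, c, e)"
    by (simp add: l_def h_def vec_eq_iff forall_4 matrix_matrix_mult_def sum_4 1(1,2) 2(1,2))
  ultimately show thesis by (rule that)
qed

definition rel_beta :: "(mat4 \<times> mat4) set" where
  "rel_beta = {(\<gamma>, \<gamma>'). \<gamma> \<in> Sp4Z \<and> \<gamma>' \<in> Sp4Z \<and> (\<exists>p \<in> P_beta \<inter> Sp4Z. \<gamma>' = p ** \<gamma>)}"

text \<open>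
  Elements of \<open>P\<^sub>\<beta> \<inter> \<Gamma>\<close> have third row \<open>\<plusminus>e\<^sub>3\<close>, the diagonal entry being a unit of \<open>\<int>\<close>. Conversely a
  symplectic matrix with third row \<open>\<plusminus>e\<^sub>3\<close> has first column \<open>\<plusminus>e\<^sub>1\<close>, by pairing its rows with the third one.
\<close>
lemma rel_beta_iff:
  assumes g: "g \<in> Sp4Z" and h: "h \<in> Sp4Z"
  shows "(g, h) \<in> rel_beta \<longleftrightarrow> h$3 = g$3 \<or> h$3 = - g$3"
proof
  assume "(g, h) \<in> rel_beta"
  then obtain p where p: "p \<in> P_beta" "p \<in> Sp4Z" "h = p ** g" by (auto simp: rel_beta_def)
  have z: "p$3$1 = 0" "p$3$2 = 0" "p$3$4 = 0" using p by (auto simp: P_beta_def)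
  have "symp (p$1) (p$3) = 1" using Sp4R_symp[of p 1 3] p by (auto simp: Sp4Z_def)
  then have eq: "p$1$1 * p$3$3 = 1" by (simp add: symp_def z)
  obtain i j where ij: "p$1$1 = of_int i" "p$3$3 = of_int j"
  proof -
    have "p$1$1 \<in> \<int>" "p$3$3 \<in> \<int>" using p by (auto simp: Sp4Z_def)
    then show thesis using that by (metis Ints_cases)
  qed
  then have "i * j = 1" using eq by (metis of_int_eq_1_iff of_int_mult)
  then have "j = 1 \<or> j = -1" using zmult_eq_1_iff by auto
  then show "h$3 = g$3 \<or> h$3 = - g$3"
    by (auto simp: p(3) vec_eq_iff forall_4 matrix_matrix_mult_def sum_4 z ij)
next
  assume "h$3 = g$3 \<or> h$3 = - g$3"
  then obtain s :: real where s: "s = 1 \<or> s = -1" "h$3 = s *\<^sub>R g$3"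
    by (metis scaleR_minus1_left scaleR_one)
  define p where "p = h ** symp_inv g"
  have pZ: "p \<in> Sp4Z" unfolding p_def using g h by (intro Sp4Z_mult symp_inv_Sp4Z)
  have hp: "h = p ** g" using g by (simp add: p_def symp_inv_left Sp4Z_def flip: matrix_mul_assoc)
  have "p$3 = h$3 v* symp_inv g" by (simp add: p_def row_mult)
  also have "\<dots> = s *\<^sub>R (g$3 v* symp_inv g)" by (simp add: s(2) vec_eq_iff vector_matrix_mult_def sum_distrib_left mult_ac)
  also have "g$3 v* symp_inv g = (g ** symp_inv g)$3" by (simp add: row_mult)
  also have "\<dots> = mat 1 $ 3" using g by (simp add: symp_inv_right Sp4Z_def)
  finally have p3: "p$3$1 = 0" "p$3$2 = 0" "p$3$3 = s" "p$3$4 = 0" by (simp_all add: mat_def)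
  have "symp (p$2) (p$3) = 0" "symp (p$4) (p$3) = 0"
    using Sp4R_symp[of p 2 3] Sp4R_symp[of p 4 3] pZ by (auto simp: Sp4Z_def)
  then have "p$2$1 = 0" "p$4$1 = 0" using s by (auto simp: symp_def p3)
  then have "p \<in> P_beta" using pZ p3 by (simp add: P_beta_def Sp4Z_def)
  then show "(g, h) \<in> rel_beta" using g h pZ hp by (auto simp: rel_beta_def)
qed

lemma equiv_rel_beta: "equiv Sp4Z rel_beta"
proof (rule equivI)
  show "rel_beta \<subseteq> Sp4Z \<times> Sp4Z" by (auto simp: rel_beta_def)
  show "refl_on Sp4Z rel_beta" by (auto simp: refl_on_def rel_beta_iff)
  show "sym rel_beta"
  proof (rule symI)
    fix g h assume r: "(g, h) \<in> rel_beta"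
    then have "g \<in> Sp4Z" "h \<in> Sp4Z" by (auto simp: rel_beta_def)
    then show "(h, g) \<in> rel_beta" using r by (auto simp: rel_beta_iff)
  qed
  show "trans rel_beta"
  proof (rule transI)
    fix g h k assume r: "(g, h) \<in> rel_beta" "(h, k) \<in> rel_beta"
    then have "g \<in> Sp4Z" "h \<in> Sp4Z" "k \<in> Sp4Z" by (auto simp: rel_beta_def)
    then show "(g, k) \<in> rel_beta" using r by (auto simp: rel_beta_iff)
  qed
qed

definition rep_beta :: "mat4 set \<Rightarrow> mat4" where "rep_beta c = (SOME \<gamma>. \<gamma> \<in> c)"

lemma cosets_beta_eq: "cosets_beta = Sp4Z // rel_beta"
  by (simp add: cosets_beta_def rel_beta_def)

lemma rep_beta:
  assumes "c \<in> cosets_beta"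
  shows "rep_beta c \<in> c" "rep_beta c \<in> Sp4Z" "c = rel_beta `` {rep_beta c}"
proof -
  have ne: "c \<noteq> {}" using in_quotient_imp_non_empty[OF equiv_rel_beta] assms by (simp add: cosets_beta_eq)
  then show 1: "rep_beta c \<in> c" unfolding rep_beta_def by (meson ex_in_conv someI_ex)
  show "rep_beta c \<in> Sp4Z" using 1 in_quotient_imp_subset[OF equiv_rel_beta] assms by (auto simp: cosets_beta_eq)
  show "c = rel_beta `` {rep_beta c}"
  proof -
    obtain x where x: "c = rel_beta `` {x}" using assms unfolding cosets_beta_eq by (rule quotientE)
    then have "(x, rep_beta c) \<in> rel_beta" using 1 by blast
    from equiv_class_eq[OF equiv_rel_beta this] show ?thesis using x by simp
  qed
qed

definition coset_vec :: "mat4 set \<times> int \<Rightarrow> int4" where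
  "coset_vec = (\<lambda>(c, m). iscale m (ivec (rep_beta c $ 3)))"

lemma rvec_coset_vec: "c \<in> cosets_beta \<Longrightarrow> rvec (coset_vec (c, m)) = of_int m *\<^sub>R rep_beta c $ 3"
  by (simp add: coset_vec_def rvec_iscale rvec_ivec_row rep_beta)

text \<open>
  The first row of \<open>g\<close> is an integral vector that pairs to 1 with the third row, so the third row is
  primitive and an integral multiple of an integral vector reveals its multiplier.
\<close>
lemma Sp4Z_row_multiple:
  assumes g: "g \<in> Sp4Z" and h: "h \<in> Sp4Z" and eq: "of_int m *\<^sub>R g$3 = of_int k *\<^sub>R h$3"
  shows "k dvd m"
proof -
  have "symp (g$1) (of_int m *\<^sub>R g$3) = of_int m * symp (g$1) (g$3)" by (simp add: symp_def algebra_simps)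
  also have "symp (g$1) (g$3) = 1" using Sp4R_symp[of g 1 3] g by (simp add: Sp4Z_def)
  finally have "of_int m = symp (g$1) (of_int k *\<^sub>R h$3)" unfolding eq by simp
  also have "\<dots> = of_int k * symp (g$1) (h$3)" by (simp add: symp_def algebra_simps)
  finally have m: "real_of_int m = of_int k * symp (g$1) (h$3)" .
  have "symp (g$1) (h$3) \<in> \<int>" using g h by (auto simp: Sp4Z_def symp_def intro!: Ints_add Ints_diff Ints_mult)
  then obtain i where "symp (g$1) (h$3) = of_int i" by (auto elim: Ints_cases)
  then have "m = k * i" using m by (metis of_int_eq_iff of_int_mult)
  then show ?thesis by simp
qed

text \<open>
  A nonzero integral vector is a multiple of a primitive one, which is unique up to sign, and primitive
  vectors up to sign are the cosets. Letting the multiplier run through all nonzero integers accounts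
  for the content and for the sign at once; this is why the factor below is \<open>2 \<zeta>(s)\<close>.
\<close>
lemma bij_betw_coset_vec:
  "bij_betw coset_vec (cosets_beta \<times> (UNIV - {0})) (UNIV - {(0, 0, 0, 0)})"
  unfolding bij_betw_def
proof (intro conjI inj_onI set_eqI iffI)
  fix z z' assume "z \<in> cosets_beta \<times> (UNIV - {0})" "z' \<in> cosets_beta \<times> (UNIV - {0})" and eq: "coset_vec z = coset_vec z'"
  then obtain c m c' m' where z: "z = (c, m)" "z' = (c', m')" "c \<in> cosets_beta" "c' \<in> cosets_beta" "m \<noteq> 0" "m' \<noteq> 0"
    by auto
  have e: "of_int m *\<^sub>R rep_beta c $ 3 = of_int m' *\<^sub>R rep_beta c' $ 3"
    using rvec_coset_vec[OF z(3), of m] rvec_coset_vec[OF z(4), of m'] eq z(1,2) by simp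
  note r = rep_beta(2)[OF z(3)] rep_beta(2)[OF z(4)]
  have "\<bar>m\<bar> = \<bar>m'\<bar>"
    by (rule zdvd_antisym_abs[OF Sp4Z_row_multiple[OF r(2,1) e[symmetric]] Sp4Z_row_multiple[OF r e]])
  then have mm: "m' = m \<or> m' = - m" by linarith
  have "rep_beta c' $ 3 = rep_beta c $ 3 \<or> rep_beta c' $ 3 = - rep_beta c $ 3"
    using mm
  proof
    assume "m' = m" then show ?thesis using e z by simp
  next
    assume "m' = - m"
    then have "of_int m *\<^sub>R rep_beta c $ 3 = of_int m *\<^sub>R (- rep_beta c' $ 3)" using e by simp
    then have "rep_beta c $ 3 = - rep_beta c' $ 3" using z(5) unfolding scaleR_cancel_left by simp
    then show ?thesis by simp
  qed
  then have "(rep_beta c, rep_beta c') \<in> rel_beta" using r by (simp add: rel_beta_iff)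
  then have "c = c'" using rep_beta(3)[OF z(3)] rep_beta(3)[OF z(4)] equiv_class_eq[OF equiv_rel_beta] by metis
  moreover have "m = m'"
  proof -
    have "rep_beta c $ 3 \<noteq> 0" using iwasawa_y1_eq(2)[of "rep_beta c"] r by (simp add: Sp4Z_def)
    then show ?thesis using e \<open>c = c'\<close> by simp
  qed
  ultimately show "z = z'" using z by simp
next
  fix v assume "v \<in> coset_vec ` (cosets_beta \<times> (UNIV - {0}))"
  then obtain c m where v: "v = coset_vec (c, m)" "c \<in> cosets_beta" "m \<noteq> 0" by auto
  have "rep_beta c $ 3 \<noteq> 0" using iwasawa_y1_eq(2)[of "rep_beta c"] rep_beta(2)[OF v(2)] by (simp add: Sp4Z_def)
  then have "rvec v \<noteq> 0" using v by (simp add: rvec_coset_vec)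
  moreover have "rvec (0, 0, 0, 0) = 0" by (simp add: vec_eq_iff forall_4)
  ultimately show "v \<in> UNIV - {(0, 0, 0, 0)}" by auto
next
  fix v :: int4 assume v: "v \<in> UNIV - {(0, 0, 0, 0)}"
  obtain a b c e where abce: "v = (a, b, c, e)" by (cases v)
  define d where "d = gcd (gcd a c) (gcd b e)"
  have d: "d \<noteq> 0" using v abce by (auto simp: d_def)
  obtain a' b' c' e' where q: "a = d * a'" "b = d * b'" "c = d * c'" "e = d * e'"
    by (metis d_def dvd_def dvd_trans gcd_dvd1 gcd_dvd2)
  have "d * gcd (gcd a' c') (gcd b' e') = d * 1"
  proof -
    have "d \<ge> 0" by (simp add: d_def)
    have "d = gcd (gcd (d * a') (d * c')) (gcd (d * b') (d * e'))" using d_def q by simp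
    also have "\<dots> = d * gcd (gcd a' c') (gcd b' e')"
      using \<open>d \<ge> 0\<close> by (simp only: gcd_mult_distrib_int[symmetric] abs_of_nonneg)
    finally show ?thesis by simp
  qed
  then have "gcd (gcd a' c') (gcd b' e') = 1" using d by simp
  then obtain g where g: "g \<in> Sp4Z" "g$3 = rvec (a', b', c', e')" by (rule primitive_row_completion)
  define C where "C = rel_beta `` {g}"
  have C: "C \<in> cosets_beta" using g by (auto simp: C_def cosets_beta_eq intro: quotientI)
  have "(g, rep_beta C) \<in> rel_beta" using rep_beta(1)[OF C] by (simp add: C_def)
  then have "rep_beta C $ 3 = g$3 \<or> rep_beta C $ 3 = - g$3"
    by (simp add: rel_beta_iff[OF g(1) rep_beta(2)[OF C]])
  then obtain s :: int where s: "s = 1 \<or> s = -1" "g$3 = of_int s *\<^sub>R rep_beta C $ 3"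
  proof
    assume "rep_beta C $ 3 = g$3"
    then show thesis using that[of 1] by simp
  next
    assume "rep_beta C $ 3 = - g$3"
    then show thesis using that[of "-1"] by simp
  qed
  have "v = iscale d (a', b', c', e')" unfolding abce using q by simp
  then have "rvec v = of_int d *\<^sub>R (of_int s *\<^sub>R rep_beta C $ 3)"
    by (simp only: rvec_iscale g(2)[symmetric] s(2)[symmetric])
  also have "\<dots> = rvec (coset_vec (C, d * s))"
    by (simp add: rvec_coset_vec[OF C])
  finally have "rvec v = rvec (coset_vec (C, d * s))" .
  then have "v = coset_vec (C, d * s)" by (simp add: rvec_inject)
  then show "v \<in> coset_vec ` (cosets_beta \<times> (UNIV - {0}))" using C d s(1) by auto
qed

section \<open>Periodization over the integers\<close>

lemma nn_integral_count_space_swap: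
  fixes f :: "'k::countable \<Rightarrow> 'a \<Rightarrow> ennreal"
  assumes M: "sigma_finite_measure M" and f: "\<And>k. f k \<in> borel_measurable M"
  shows "(\<integral>\<^sup>+k. (\<integral>\<^sup>+x. f k x \<partial>M) \<partial>count_space UNIV) = (\<integral>\<^sup>+x. (\<integral>\<^sup>+k. f k x \<partial>count_space UNIV) \<partial>M)"
proof -
  interpret M: sigma_finite_measure M by fact
  interpret C: sigma_finite_measure "count_space (UNIV::'k set)"
    by (rule sigma_finite_measure_count_space)
  interpret pair_sigma_finite M "count_space (UNIV::'k set)" ..
  have "(\<lambda>(x, k). f k x) \<in> borel_measurable (M \<Otimes>\<^sub>M count_space UNIV)"
    using measurable_pair_measure_countable1[of UNIV "\<lambda>(k,x). f k x" M borel] f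
    by (subst measurable_pair_swap_iff) (auto simp: case_prod_beta)
  from Fubini'[OF this] show ?thesis by simp
qed

lemma borel_measurable_nn_integral_count_space [measurable (raw)]:
  fixes f :: "'a \<Rightarrow> 'k::countable \<Rightarrow> ennreal"
  assumes f: "\<And>k. (\<lambda>x. f x k) \<in> borel_measurable M"
  shows "(\<lambda>x. \<integral>\<^sup>+k. f x k \<partial>count_space UNIV) \<in> borel_measurable M"
proof -
  interpret C: sigma_finite_measure "count_space (UNIV::'k set)"
    by (rule sigma_finite_measure_count_space)
  have "(\<lambda>(x, k). f x k) \<in> borel_measurable (M \<Otimes>\<^sub>M count_space UNIV)"
    using measurable_pair_measure_countable1[of UNIV "\<lambda>(k,x). f x k" M borel] f
    by (subst measurable_pair_swap_iff) (auto simp: case_prod_beta)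
  from C.borel_measurable_nn_integral[OF this] show ?thesis by simp
qed

lemma nn_integral_count_space_reindex:
  assumes "bij h"
  shows "(\<integral>\<^sup>+k. f (h k) \<partial>count_space UNIV) = (\<integral>\<^sup>+k. f k \<partial>count_space UNIV)"
  using nn_integral_bij_count_space[of h UNIV UNIV f] assms by simp

lemma nn_integral_count_space_remove:
  "(\<integral>\<^sup>+k. F k \<partial>count_space UNIV) = F z + (\<integral>\<^sup>+k. F k \<partial>count_space (UNIV - {z}))"
proof -
  have "(\<integral>\<^sup>+k. F k \<partial>count_space UNIV) =
      (\<integral>\<^sup>+k. F k * indicator {z} k + F k * indicator (UNIV - {z}) k \<partial>count_space UNIV)"
    by (intro nn_integral_cong) (auto simp: indicator_def)
  also have "\<dots> = F z + (\<integral>\<^sup>+k. F k * indicator (UNIV - {z}) k \<partial>count_space UNIV)"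
    by (subst nn_integral_add) auto
  also have "(\<integral>\<^sup>+k. F k * indicator (UNIV - {z}) k \<partial>count_space UNIV) =
      (\<integral>\<^sup>+k. F k \<partial>count_space (UNIV - {z}))"
    by (subst nn_integral_restrict_space[symmetric]) (auto simp: restrict_count_space)
  finally show ?thesis .
qed

lemma nn_integral_lborel_shift:
  fixes f :: "real \<Rightarrow> ennreal"
  assumes [measurable]: "f \<in> borel_measurable borel"
  shows "(\<integral>\<^sup>+x. f (x + c) \<partial>lborel) = (\<integral>\<^sup>+x. f x \<partial>lborel)"
  using nn_integral_real_affine[of f 1 c] by (simp add: add.commute)

lemma bij_add_int: "bij (\<lambda>k::int. k + c)"
  by (rule bij_betw_byWitness[where f' = "\<lambda>k. k - c"]) auto

lemma bij_uminus_int: "bij (\<lambda>k::int. - k)"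
  by (rule bij_betw_byWitness[where f' = "\<lambda>k. - k"]) auto

lemma nn_integral_int_intervals:
  fixes x c :: real
  shows "(\<integral>\<^sup>+k. indicator {c - of_int k..<c - of_int k + 1} x \<partial>count_space UNIV) = (1 :: ennreal)"
proof -
  have "(\<integral>\<^sup>+k. indicator {c - of_int k..<c - of_int k + 1} x \<partial>count_space UNIV) =
     (\<integral>\<^sup>+k. indicator {\<lceil>c - x\<rceil>} k \<partial>count_space UNIV)"
  proof (rule nn_integral_cong)
    fix k :: int
    have "c - of_int k \<le> x \<and> x < c - of_int k + 1 \<longleftrightarrow> k = \<lceil>c - x\<rceil>"
      by linarith
    then show "indicator {c - of_int k..<c - of_int k + 1} x = (indicator {\<lceil>c - x\<rceil>} k :: ennreal)"
      by (auto simp: indicator_def)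
  qed
  then show ?thesis by simp
qed

text \<open>
  The translates by integers of a half-open interval of length 1 tile the line.
\<close>
lemma nn_integral_periodize:
  fixes f :: "real \<Rightarrow> ennreal"
  assumes [measurable]: "f \<in> borel_measurable borel"
  shows "(\<integral>\<^sup>+x. (\<integral>\<^sup>+k. f (x + of_int k) \<partial>count_space UNIV) * indicator {c..<c+1} x \<partial>lborel) =
         (\<integral>\<^sup>+x. f x \<partial>lborel)"
proof -
  have "(\<integral>\<^sup>+x. (\<integral>\<^sup>+k. f (x + of_int k) \<partial>count_space UNIV) * indicator {c..<c+1} x \<partial>lborel)
      = (\<integral>\<^sup>+k. (\<integral>\<^sup>+x. f (x + of_int k) * indicator {c..<c+1} x \<partial>lborel) \<partial>count_space UNIV)"
    by (subst nn_integral_count_space_swap) (auto intro: sigma_finite_lborel simp: nn_integral_multc)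
  also have "\<dots> = (\<integral>\<^sup>+k. (\<integral>\<^sup>+x. f x * indicator {c - of_int (-k)..<c - of_int (-k) + 1} x \<partial>lborel) \<partial>count_space UNIV)"
  proof (rule nn_integral_cong)
    fix k :: int
    have "(\<integral>\<^sup>+x. f x * indicator {c - of_int (-k)..<c - of_int (-k) + 1} x \<partial>lborel)
      = (\<integral>\<^sup>+x. f (x + of_int k) * indicator {c - of_int (-k)..<c - of_int (-k) + 1} (x + of_int k) \<partial>lborel)"
      by (rule nn_integral_lborel_shift[symmetric]) measurable
    also have "\<dots> = (\<integral>\<^sup>+x. f (x + of_int k) * indicator {c..<c+1} x \<partial>lborel)"
      by (intro nn_integral_cong) (auto simp: indicator_def)
    finally show "(\<integral>\<^sup>+x. f (x + of_int k) * indicator {c..<c+1} x \<partial>lborel) =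
      (\<integral>\<^sup>+x. f x * indicator {c - of_int (-k)..<c - of_int (-k) + 1} x \<partial>lborel)" ..
  qed
  also have "\<dots> = (\<integral>\<^sup>+k. (\<integral>\<^sup>+x. f x * indicator {c - of_int k..<c - of_int k + 1} x \<partial>lborel) \<partial>count_space UNIV)"
    by (rule nn_integral_count_space_reindex[OF bij_uminus_int])
  also have "\<dots> = (\<integral>\<^sup>+x. (\<integral>\<^sup>+k. f x * indicator {c - of_int k..<c - of_int k + 1} x \<partial>count_space UNIV) \<partial>lborel)"
    by (rule nn_integral_count_space_swap) (auto intro: sigma_finite_lborel)
  also have "\<dots> = (\<integral>\<^sup>+x. f x \<partial>lborel)"
    by (simp add: nn_integral_cmult nn_integral_int_intervals)
  finally show ?thesis .
qed

text \<open>
  Unfolding: as \<open>x\<close> runs through the unit interval, \<open>m x + b\<close> runs \<open>\<bar>m\<bar>\<close> times around the circle with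
  speed \<open>\<bar>m\<bar>\<close>, so the mean of the periodization is the whole integral for every \<open>m \<noteq> 0\<close> and every
  shift \<open>b\<close>. Each of the three Weyl group elements \<open>\<noteq> id\<close> contributes through this identity.
\<close>
lemma nn_integral_unfold_int:
  fixes f :: "real \<Rightarrow> ennreal" and m :: int
  assumes f[measurable]: "f \<in> borel_measurable borel" and m: "m \<noteq> 0"
  shows "(\<integral>\<^sup>+x. (\<integral>\<^sup>+k. f (of_int m * x + b + of_int k) \<partial>count_space UNIV) * indicator {0..<1} x \<partial>lborel) =
         (\<integral>\<^sup>+x. f x \<partial>lborel)"
proof -
  have pos: "(\<integral>\<^sup>+x. (\<integral>\<^sup>+k. f (of_nat m * x + b + of_int k) \<partial>count_space UNIV) * indicator {0..<1} x \<partial>lborel) =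
         (\<integral>\<^sup>+x. f x \<partial>lborel)" if f[measurable]: "f \<in> borel_measurable borel" and m: "m > 0"
    for m :: nat and f :: "real \<Rightarrow> ennreal" and b :: real
  proof -
    define F where "F x = (\<integral>\<^sup>+k. f (x + of_int k) \<partial>count_space UNIV)" for x
    have [measurable]: "F \<in> borel_measurable borel" unfolding F_def by measurable
    have F: "(\<integral>\<^sup>+x. F x * indicator {b..<b + of_nat m} x \<partial>lborel) = of_nat m * (\<integral>\<^sup>+x. f x \<partial>lborel)" for m :: nat
    proof (induction m)
      case (Suc m)
      have "(\<integral>\<^sup>+x. F x * indicator {b..<b + of_nat (Suc m)} x \<partial>lborel) =
        (\<integral>\<^sup>+x. F x * indicator {b..<b + of_nat m} x + F x * indicator {b + of_nat m..<b + of_nat m + 1} x \<partial>lborel)"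
        by (intro nn_integral_cong) (auto simp: indicator_def)
      also have "\<dots> = of_nat m * (\<integral>\<^sup>+x. f x \<partial>lborel) + (\<integral>\<^sup>+x. f x \<partial>lborel)"
        by (subst nn_integral_add) (auto simp: Suc.IH nn_integral_periodize[of f, folded F_def])
      finally show ?case by (simp add: algebra_simps)
    qed simp
    have "of_nat m * (\<integral>\<^sup>+x. F (of_nat m * x + b) * indicator {0..<1} x \<partial>lborel) =
          ennreal \<bar>of_nat m\<bar> * (\<integral>\<^sup>+x. F (b + of_nat m * x) * indicator {b..<b + of_nat m} (b + of_nat m * x) \<partial>lborel)"
      using m by (intro arg_cong2[of _ _ _ _ "(*)"] nn_integral_cong)
        (auto simp: indicator_def ennreal_of_nat_eq_real_of_nat add.commute mult_less_cancel_left1 zero_le_mult_iff)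
    also have "\<dots> = (\<integral>\<^sup>+x. F x * indicator {b..<b + of_nat m} x \<partial>lborel)"
      using m by (intro nn_integral_real_affine[symmetric]) auto
    also have "\<dots> = of_nat m * (\<integral>\<^sup>+x. f x \<partial>lborel)" by (rule F)
    finally have "(\<integral>\<^sup>+x. F (of_nat m * x + b) * indicator {0..<1} x \<partial>lborel) = (\<integral>\<^sup>+x. f x \<partial>lborel)"
      by (metis ennreal_mult_cancel_left m not_gr0 of_nat_0_eq_iff of_nat_less_top order_less_irrefl)
    then show ?thesis unfolding F_def .
  qed
  show ?thesis
  proof (cases "m > 0")
    case True
    then obtain p where p: "m = int p" "p > 0" using zero_less_imp_eq_int by blast
    show ?thesis using pos[OF f p(2)] p by simp
  next
    case False
    then obtain p where p: "m = - int p" "p > 0" using zero_less_imp_eq_int[of "-m"] m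
      by (metis add.inverse_inverse linorder_cases neg_0_less_iff_less)
    have "(\<integral>\<^sup>+x. (\<integral>\<^sup>+k. f (of_int m * x + b + of_int k) \<partial>count_space UNIV) * indicator {0..<1} x \<partial>lborel) =
        (\<integral>\<^sup>+x. (\<integral>\<^sup>+k. f (- (of_nat p * x + (- b) + of_int (- k))) \<partial>count_space UNIV) * indicator {0..<1} x \<partial>lborel)"
      using p by (simp add: algebra_simps)
    also have "\<dots> = (\<integral>\<^sup>+x. (\<integral>\<^sup>+k. f (- (of_nat p * x + (- b) + of_int k)) \<partial>count_space UNIV) * indicator {0..<1} x \<partial>lborel)"
      by (intro nn_integral_cong arg_cong2[of _ _ _ _ "(*)"] refl
          nn_integral_count_space_reindex[OF bij_uminus_int, of "\<lambda>k. f (- (of_nat p * _ + (- b) + of_int k))"])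
    also have "\<dots> = (\<integral>\<^sup>+x. f (- x) \<partial>lborel)"
      by (rule pos) (use p in auto)
    also have "\<dots> = (\<integral>\<^sup>+x. f x \<partial>lborel)"
      using nn_integral_real_affine[of f "-1" 0] by simp
    finally show ?thesis .
  qed
qed

section \<open>Equidistribution of heat on the circle\<close>

text \<open>
  The heat kernel of the line at time \<open>\<tau> / (4 \<pi>)\<close>; in this normalization
  \<open>exp (- \<pi> t x\<^sup>2) = t^(-1/2) heat (1/t) x\<close>, so small \<open>t\<close> corresponds to large times.
\<close>
definition heat :: "real \<Rightarrow> real \<Rightarrow> real" where
  "heat \<tau> x = exp (- pi * x\<^sup>2 / \<tau>) / sqrt \<tau>"

lemma heat_measurable [measurable]: "heat \<tau> \<in> borel_measurable borel"
  unfolding heat_def by measurable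

lemma heat_nonneg: "\<tau> > 0 \<Longrightarrow> heat \<tau> x \<ge> 0"
  by (simp add: heat_def)

lemma heat_eq_normal_density:
  assumes "\<tau> > 0"
  shows "heat \<tau> x = normal_density 0 (sqrt (\<tau> / (2 * pi))) x"
  using assms by (simp add: heat_def normal_density_def field_simps)

lemma nn_integral_heat: "\<tau> > 0 \<Longrightarrow> (\<integral>\<^sup>+x. ennreal (heat \<tau> x) \<partial>lborel) = 1"
  unfolding heat_eq_normal_density
  by (subst nn_integral_eq_integral) auto

lemma heat_convolution:
  assumes "\<tau> > 0" "\<rho> > 0"
  shows "(\<integral>\<^sup>+y. ennreal (heat \<rho> (x - y)) * ennreal (heat \<tau> y) \<partial>lborel) = ennreal (heat (\<tau> + \<rho>) x)"
proof -
  have "(\<integral>\<^sup>+y. ennreal (heat \<rho> (x - y)) * ennreal (heat \<tau> y) \<partial>lborel) =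
    ennreal (normal_density 0 (sqrt ((sqrt (\<rho> / (2*pi)))\<^sup>2 + (sqrt (\<tau> / (2*pi)))\<^sup>2)) x)"
    using fun_cong[OF conv_normal_density_zero_mean[of "sqrt (\<rho> / (2*pi))" "sqrt (\<tau> / (2*pi))"], of x] assms
    by (simp add: heat_eq_normal_density ennreal_mult')
  also have "(sqrt (\<rho> / (2*pi)))\<^sup>2 + (sqrt (\<tau> / (2*pi)))\<^sup>2 = (\<tau> + \<rho>) / (2 * pi)"
    using assms by (simp add: add_divide_distrib add.commute)
  finally show ?thesis using assms by (simp add: heat_eq_normal_density)
qed

text \<open>
  The heat kernel of the circle \<open>\<real>/\<int>\<close>, with values in \<open>[0, \<infinity>]\<close> so that sums and integrals can be
  exchanged freely.
\<close>
definition circle_heat :: "real \<Rightarrow> real \<Rightarrow> ennreal" where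
  "circle_heat \<tau> a = (\<integral>\<^sup>+k. ennreal (heat \<tau> (a + of_int k)) \<partial>count_space UNIV)"

lemma circle_heat_measurable [measurable]: "circle_heat \<tau> \<in> borel_measurable borel"
  unfolding circle_heat_def by measurable

lemma circle_heat_shift: "circle_heat \<tau> (a + of_int k) = circle_heat \<tau> a"
  unfolding circle_heat_def
  using nn_integral_count_space_reindex[OF bij_add_int, of "\<lambda>j. ennreal (heat \<tau> (a + of_int j))" k]
  by (simp add: algebra_simps)

lemma circle_heat_unfold: "m \<noteq> 0 \<Longrightarrow> \<tau> > 0 \<Longrightarrow> (\<integral>\<^sup>+x. circle_heat \<tau> (of_int m * x + b) * indicator {0..<1} x \<partial>lborel) = 1"
  unfolding circle_heat_def by (subst nn_integral_unfold_int) (auto simp: nn_integral_heat)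

lemma circle_heat_convolution:
  assumes "\<tau> > 0" "\<rho> > 0"
  shows "circle_heat (\<tau> + \<rho>) a = (\<integral>\<^sup>+b. circle_heat \<tau> b * circle_heat \<rho> (a - b) * indicator {0..<1} b \<partial>lborel)"
proof -
  have "circle_heat (\<tau> + \<rho>) a = (\<integral>\<^sup>+k. (\<integral>\<^sup>+b. ennreal (heat \<rho> (a + of_int k - b)) * ennreal (heat \<tau> b) \<partial>lborel) \<partial>count_space UNIV)"
    by (simp add: circle_heat_def heat_convolution assms)
  also have "\<dots> = (\<integral>\<^sup>+b. circle_heat \<rho> (a - b) * ennreal (heat \<tau> b) \<partial>lborel)"
    unfolding circle_heat_def
    by (subst nn_integral_count_space_swap) (auto intro: sigma_finite_lborel simp: nn_integral_multc diff_add_eq)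
  also have "\<dots> = (\<integral>\<^sup>+b. (\<integral>\<^sup>+k. circle_heat \<rho> (a - (b + of_int k)) * ennreal (heat \<tau> (b + of_int k)) \<partial>count_space UNIV) * indicator {0..<0+1} b \<partial>lborel)"
    by (rule nn_integral_periodize[symmetric]) measurable
  also have "\<dots> = (\<integral>\<^sup>+b. circle_heat \<tau> b * circle_heat \<rho> (a - b) * indicator {0..<1} b \<partial>lborel)"
  proof (intro nn_integral_cong)
    fix b
    have "circle_heat \<rho> (a - (b + of_int k)) = circle_heat \<rho> (a - b)" for k
      using circle_heat_shift[of \<rho> "a - b" "-k"] by (simp add: algebra_simps)
    then show "(\<integral>\<^sup>+k. circle_heat \<rho> (a - (b + of_int k)) * ennreal (heat \<tau> (b + of_int k)) \<partial>count_space UNIV) * indicator {0..<0+1} b =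
       circle_heat \<tau> b * circle_heat \<rho> (a - b) * indicator {0..<1} b"
      by (simp add: nn_integral_multc circle_heat_def mult.commute)
  qed
  finally show ?thesis .
qed

text \<open>
  The term of the integer translate \<open>a - \<lfloor>a\<rfloor> \<in> [0, 1)\<close> alone is large enough.
\<close>
lemma circle_heat_lower:
  assumes "\<tau> > 0"
  shows "ennreal (heat \<tau> 1) \<le> circle_heat \<tau> a"
proof -
  define k where "k = - \<lfloor>a\<rfloor>"
  have "(a + of_int k)\<^sup>2 \<le> 1\<^sup>2"
    unfolding k_def by (rule power_mono) linarith+
  then have "heat \<tau> 1 \<le> heat \<tau> (a + of_int k)"
    using assms by (simp add: heat_def divide_right_mono)
  then have "ennreal (heat \<tau> 1) \<le> (\<integral>\<^sup>+j. ennreal (heat \<tau> (a + of_int j)) * indicator {k} j \<partial>count_space UNIV)"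
    by (simp add: ennreal_leI)
  also have "\<dots> \<le> circle_heat \<tau> a"
    unfolding circle_heat_def by (intro nn_integral_mono) (auto simp: indicator_def)
  finally show ?thesis .
qed

text \<open>
  Compare with the mean at the doubled time: \<open>(x + u)\<^sup>2 \<le> 2 x\<^sup>2 + 2 u\<^sup>2\<close> gives
  \<open>heat \<tau> x \<le> \<surd>2 e^(\<pi>/\<tau>) heat (2\<tau>) (x + u)\<close> for \<open>0 \<le> u < 1\<close>, and the right hand side has mean \<open>\<surd>2 e^(\<pi>/\<tau>)\<close> over the
  circle.
\<close>
lemma circle_heat_upper:
  assumes "\<tau> > 0"
  shows "circle_heat \<tau> a \<le> ennreal (sqrt 2 * exp (pi / \<tau>))"
proof -
  have *: "heat \<tau> x \<le> sqrt 2 * exp (pi / \<tau>) * heat (2 * \<tau>) (x + u)" if u: "u \<in> {0..<1}" for x u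
  proof -
    have "(x + u)\<^sup>2 \<le> 2 * x\<^sup>2 + 2 * u\<^sup>2" using sum_squares_bound[of x u] by (simp add: power2_sum)
    moreover have "u\<^sup>2 \<le> 1" using u by (simp add: power_le_one)
    ultimately have "(x + u)\<^sup>2 \<le> 2 * x\<^sup>2 + 2" by simp
    then have "pi * (x + u)\<^sup>2 \<le> pi * (2 * x\<^sup>2 + 2)" by (intro mult_left_mono) auto
    then have "- pi * x\<^sup>2 / \<tau> \<le> pi / \<tau> + (- pi * (x + u)\<^sup>2 / (2 * \<tau>))"
      using assms by (simp add: field_simps)
    then have "exp (- pi * x\<^sup>2 / \<tau>) \<le> exp (pi / \<tau>) * exp (- pi * (x + u)\<^sup>2 / (2 * \<tau>))"
      by (simp flip: exp_add)
    then show ?thesis using assms by (simp add: heat_def real_sqrt_mult field_simps)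
  qed
  have "circle_heat \<tau> a = (\<integral>\<^sup>+u. circle_heat \<tau> a * indicator {0..<1::real} u \<partial>lborel)"
    by (simp add: nn_integral_cmult)
  also have "\<dots> \<le> (\<integral>\<^sup>+u. ennreal (sqrt 2 * exp (pi / \<tau>)) * (circle_heat (2 * \<tau>) (of_int 1 * u + a) * indicator {0..<1} u) \<partial>lborel)"
  proof (intro nn_integral_mono)
    fix u :: real
    have "circle_heat \<tau> a \<le> (\<integral>\<^sup>+k. ennreal (sqrt 2 * exp (pi / \<tau>)) * ennreal (heat (2 * \<tau>) (of_int 1 * u + a + of_int k)) \<partial>count_space UNIV)"
      if "u \<in> {0..<1}"
      unfolding circle_heat_def
    proof (intro nn_integral_mono)
      fix k :: int
      show "ennreal (heat \<tau> (a + of_int k)) \<le> ennreal (sqrt 2 * exp (pi / \<tau>)) * ennreal (heat (2 * \<tau>) (of_int 1 * u + a + of_int k))"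
        using *[OF that, of "a + of_int k"] assms
        by (subst ennreal_mult[symmetric]) (auto simp: heat_nonneg add_ac intro: ennreal_leI)
    qed
    then show "circle_heat \<tau> a * indicator {0..<1::real} u \<le> ennreal (sqrt 2 * exp (pi / \<tau>)) * (circle_heat (2 * \<tau>) (of_int 1 * u + a) * indicator {0..<1} u)"
      by (auto simp: indicator_def nn_integral_cmult circle_heat_def)
  qed
  also have "\<dots> = ennreal (sqrt 2 * exp (pi / \<tau>))"
    using assms circle_heat_unfold[of 1 "2 * \<tau>" a] by (simp add: nn_integral_cmult)
  finally show ?thesis .
qed

text \<open>
  Doeblin's argument: write the kernel at time \<open>\<rho>\<close> as the constant \<open>\<delta>\<close> plus a nonnegative rest of total
  mass \<open>1 - \<delta>\<close>. Convolution with the constant gives exactly \<open>\<delta>\<close>, because the kernel at time \<open>\<tau>\<close> has mean 1,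
  so a deviation \<open>e\<close> from the uniform density shrinks by the factor \<open>1 - \<delta>\<close>. For \<open>e > 1\<close> the lower bounds
  are truncated at 0 by the coercion into \<open>[0, \<infinity>]\<close>.
\<close>
lemma circle_heat_contraction:
  assumes "\<tau> > 0" "\<rho> > 0" and \<delta>: "0 < \<delta>" "\<delta> < 1" "\<And>a. ennreal \<delta> \<le> circle_heat \<rho> a" and e: "e \<ge> 0"
    and b: "\<And>a. ennreal (1 - e) \<le> circle_heat \<tau> a" "\<And>a. circle_heat \<tau> a \<le> ennreal (1 + e)"
  shows "ennreal (1 - (1 - \<delta>) * e) \<le> circle_heat (\<tau> + \<rho>) a" "circle_heat (\<tau> + \<rho>) a \<le> ennreal (1 + (1 - \<delta>) * e)"
proof -
  define r where "r x = circle_heat \<rho> x - ennreal \<delta>" for x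
  have [measurable]: "r \<in> borel_measurable borel" unfolding r_def by measurable
  have r: "circle_heat \<rho> x = ennreal \<delta> + r x" for x
    unfolding r_def using \<delta>(3)[of x] by (simp add: add_diff_inverse_ennreal)
  have "1 = (\<integral>\<^sup>+b. circle_heat \<rho> (of_int (-1) * b + a) * indicator {0..<1} b \<partial>lborel)"
    by (rule circle_heat_unfold[symmetric]) (use assms in auto)
  also have "\<dots> = (\<integral>\<^sup>+b. ennreal \<delta> * indicator {0..<1::real} b + r (a - b) * indicator {0..<1} b \<partial>lborel)"
    by (intro nn_integral_cong) (simp add: r algebra_simps)
  also have "\<dots> = ennreal \<delta> + (\<integral>\<^sup>+b. r (a - b) * indicator {0..<1} b \<partial>lborel)"
    by (subst nn_integral_add) (auto simp: nn_integral_cmult)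
  finally have R: "(\<integral>\<^sup>+b. r (a - b) * indicator {0..<1} b \<partial>lborel) = ennreal (1 - \<delta>)"
    using \<delta> by (metis ennreal_add_diff_cancel_left ennreal_minus ennreal_neq_top ennreal_1 less_imp_le)
  have P: "(\<integral>\<^sup>+b. circle_heat \<tau> b * indicator {0..<1} b \<partial>lborel) = 1"
    using circle_heat_unfold[of 1 \<tau> 0] assms by simp
  have "circle_heat (\<tau> + \<rho>) a = (\<integral>\<^sup>+b. ennreal \<delta> * (circle_heat \<tau> b * indicator {0..<1::real} b) + circle_heat \<tau> b * (r (a - b) * indicator {0..<1} b) \<partial>lborel)"
    unfolding circle_heat_convolution[OF assms(1,2)] r by (intro nn_integral_cong) (simp add: algebra_simps)
  also have "\<dots> = ennreal \<delta> + (\<integral>\<^sup>+b. circle_heat \<tau> b * (r (a - b) * indicator {0..<1} b) \<partial>lborel)"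
    by (subst nn_integral_add) (auto simp: nn_integral_cmult P)
  finally have E: "circle_heat (\<tau> + \<rho>) a = ennreal \<delta> + (\<integral>\<^sup>+b. circle_heat \<tau> b * (r (a - b) * indicator {0..<1} b) \<partial>lborel)" .
  have "(\<integral>\<^sup>+b. circle_heat \<tau> b * (r (a - b) * indicator {0..<1} b) \<partial>lborel) \<le> (\<integral>\<^sup>+b. ennreal (1 + e) * (r (a - b) * indicator {0..<1} b) \<partial>lborel)"
    by (intro nn_integral_mono mult_right_mono b) auto
  also have "\<dots> = ennreal ((1 + e) * (1 - \<delta>))"
    using \<delta> e by (simp add: nn_integral_cmult R ennreal_mult)
  finally have "circle_heat (\<tau> + \<rho>) a \<le> ennreal \<delta> + ennreal ((1 + e) * (1 - \<delta>))"
    unfolding E by (rule add_left_mono)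
  also have "\<dots> = ennreal (1 + (1 - \<delta>) * e)"
    using \<delta> e mult_nonneg_nonneg[of "1 + e" "1 - \<delta>"]
    by (subst ennreal_plus[symmetric]) (auto simp: algebra_simps)
  finally show "circle_heat (\<tau> + \<rho>) a \<le> ennreal (1 + (1 - \<delta>) * e)" .
  show "ennreal (1 - (1 - \<delta>) * e) \<le> circle_heat (\<tau> + \<rho>) a"
  proof -
    have "(\<integral>\<^sup>+b. circle_heat \<tau> b * (r (a - b) * indicator {0..<1} b) \<partial>lborel) \<ge> (\<integral>\<^sup>+b. ennreal (1 - e) * (r (a - b) * indicator {0..<1} b) \<partial>lborel)"
      by (intro nn_integral_mono mult_right_mono b) auto
    also have "(\<integral>\<^sup>+b. ennreal (1 - e) * (r (a - b) * indicator {0..<1} b) \<partial>lborel) = ennreal ((1 - e) * (1 - \<delta>))"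
      using \<delta> by (simp add: nn_integral_cmult R ennreal_mult'')
    finally have 1: "ennreal \<delta> + ennreal ((1 - e) * (1 - \<delta>)) \<le> circle_heat (\<tau> + \<rho>) a"
      unfolding E by (rule add_left_mono)
    have "1 - (1 - \<delta>) * e = \<delta> + (1 - e) * (1 - \<delta>)" by (simp add: algebra_simps)
    also have "ennreal \<dots> \<le> ennreal \<delta> + ennreal ((1 - e) * (1 - \<delta>))"
    proof (cases "(1 - e) * (1 - \<delta>) \<ge> 0")
      case True
      then show ?thesis using \<delta> by (subst ennreal_plus[symmetric]) auto
    next
      case False
      then have "ennreal (\<delta> + (1 - e) * (1 - \<delta>)) \<le> ennreal \<delta>" by (intro ennreal_leI) simp
      then show ?thesis by (rule order_trans) simp
    qed
    finally show ?thesis using 1 by order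
  qed
qed

text \<open>
  Iterating the contraction with the fixed step \<open>\<tau>0\<close> shows that the heat kernel tends to the uniform
  density exponentially fast, hence faster than every power of \<open>\<tau>\<close>. Applied to theta functions this
  plays the part of Poisson summation, and it is uniform in the point \<open>a\<close>.
\<close>
lemma circle_heat_rapid:
  assumes "\<tau>0 > 0"
  obtains C where "C \<ge> 0"
    "\<And>\<tau> a. \<tau> \<ge> \<tau>0 \<Longrightarrow> ennreal (1 - C / \<tau> ^ N) \<le> circle_heat \<tau> a"
    "\<And>\<tau> a. \<tau> \<ge> \<tau>0 \<Longrightarrow> circle_heat \<tau> a \<le> ennreal (1 + C / \<tau> ^ N)"
proof -
  \<comment> \<open>The minimum with 1/2 keeps \<open>1 - \<delta>\<close> away from 0, as the decay estimate below needs a positive ratio.\<close>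
  define \<delta> where "\<delta> = min (1/2) (heat \<tau>0 1)"
  define B where "B = sqrt 2 * exp (pi / \<tau>0)"
  have \<delta>: "0 < \<delta>" "\<delta> < 1" using assms by (auto simp: \<delta>_def heat_def)
  have \<delta>3: "ennreal \<delta> \<le> circle_heat \<tau>0 a" for a
    using circle_heat_lower[OF assms, of a] by (rule order_trans[rotated]) (auto simp: \<delta>_def intro: ennreal_leI)
  have B1: "B \<ge> 1" unfolding B_def using assms mult_mono[of 1 "sqrt 2" 1 "exp (pi/\<tau>0)"] by simp
  have step: "(\<forall>\<tau>\<ge>(real n + 1) * \<tau>0. \<forall>a. ennreal (1 - B * (1 - \<delta>) ^ n) \<le> circle_heat \<tau> a \<and> circle_heat \<tau> a \<le> ennreal (1 + B * (1 - \<delta>) ^ n))" for n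
  proof (induction n)
    case 0
    show ?case
    proof (intro allI impI conjI)
      fix \<tau> a assume "(real 0 + 1) * \<tau>0 \<le> \<tau>"
      then have t: "\<tau> > 0" "pi / \<tau> \<le> pi / \<tau>0" using assms by (auto intro: divide_left_mono)
      have "circle_heat \<tau> a \<le> ennreal (sqrt 2 * exp (pi / \<tau>))" by (rule circle_heat_upper) fact
      also have "\<dots> \<le> ennreal (1 + B * (1 - \<delta>) ^ 0)"
        unfolding B_def using t by (intro ennreal_leI) (simp add: add_increasing)
      finally show "circle_heat \<tau> a \<le> ennreal (1 + B * (1 - \<delta>) ^ 0)" .
      show "ennreal (1 - B * (1 - \<delta>) ^ 0) \<le> circle_heat \<tau> a" using B1 by (simp add: ennreal_neg)
    qed
  next
    case (Suc n)
    show ?case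
    proof (intro allI impI)
      fix \<tau> a assume t: "(real (Suc n) + 1) * \<tau>0 \<le> \<tau>"
      have t': "(real n + 1) * \<tau>0 \<le> \<tau> - \<tau>0" using t by (simp add: algebra_simps)
      have p: "0 < \<tau> - \<tau>0" by (rule less_le_trans[OF _ t']) (use assms in simp)
      have "ennreal (1 - (1 - \<delta>) * (B * (1 - \<delta>) ^ n)) \<le> circle_heat ((\<tau> - \<tau>0) + \<tau>0) a \<and> 
         circle_heat ((\<tau> - \<tau>0) + \<tau>0) a \<le> ennreal (1 + (1 - \<delta>) * (B * (1 - \<delta>) ^ n))"
        by (intro conjI circle_heat_contraction[OF p assms \<delta> \<delta>3]) (use Suc.IH t' B1 \<delta> in auto)
      then show "ennreal (1 - B * (1 - \<delta>) ^ Suc n) \<le> circle_heat \<tau> a \<and> circle_heat \<tau> a \<le> ennreal (1 + B * (1 - \<delta>) ^ Suc n)"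
        by (simp add: algebra_simps)
    qed
  qed
  have "(\<lambda>n. (real n + 2) ^ N * (1 - \<delta>) ^ n) \<longlonglongrightarrow> 0"
    using \<delta> by real_asymp
  then have "Bseq (\<lambda>n. (real n + 2) ^ N * (1 - \<delta>) ^ n)" by (intro convergent_imp_Bseq convergentI)
  then obtain K where K: "K > 0" "\<And>n. \<bar>(real n + 2) ^ N * (1 - \<delta>) ^ n\<bar> \<le> K" by (auto elim!: BseqE)
  define C where "C = B * K * \<tau>0 ^ N"
  have *: "ennreal (1 - C / \<tau> ^ N) \<le> circle_heat \<tau> a \<and> circle_heat \<tau> a \<le> ennreal (1 + C / \<tau> ^ N)" if t: "\<tau> \<ge> \<tau>0" for \<tau> a
  proof -
    have t1: "\<tau> / \<tau>0 \<ge> 1" using t assms by simp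
    \<comment> \<open>The base case of the iteration already uses up one step \<open>\<tau>0\<close>.\<close>
    define n where "n = nat \<lfloor>\<tau> / \<tau>0\<rfloor> - 1"
    have "1 \<le> \<lfloor>\<tau> / \<tau>0\<rfloor>" using t1 by linarith
    then have n: "real n + 1 \<le> \<tau> / \<tau>0" "\<tau> / \<tau>0 \<le> real n + 2" unfolding n_def by linarith+
    have "(real n + 2) ^ N * (1 - \<delta>) ^ n \<le> K" using K(2)[of n] by (simp add: abs_le_iff)
    have "(\<tau> / \<tau>0) ^ N * (1 - \<delta>) ^ n \<le> (real n + 2) ^ N * (1 - \<delta>) ^ n"
      using n t1 \<delta> by (intro mult_right_mono power_mono) auto
    also have "\<dots> \<le> K" by fact
    finally have "B * ((\<tau> / \<tau>0) ^ N * (1 - \<delta>) ^ n) \<le> B * K" using B1 by (intro mult_left_mono) auto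
    then have le: "B * (1 - \<delta>) ^ n \<le> C / \<tau> ^ N"
      using assms t unfolding C_def by (simp add: field_simps power_divide)
    have "(real n + 1) * \<tau>0 \<le> \<tau>" using n assms by (simp add: field_simps)
    with step[of n] have "ennreal (1 - B * (1 - \<delta>) ^ n) \<le> circle_heat \<tau> a" "circle_heat \<tau> a \<le> ennreal (1 + B * (1 - \<delta>) ^ n)" by auto
    moreover have "ennreal (1 - C / \<tau> ^ N) \<le> ennreal (1 - B * (1 - \<delta>) ^ n)"
      "ennreal (1 + B * (1 - \<delta>) ^ n) \<le> ennreal (1 + C / \<tau> ^ N)"
      using le by (auto intro!: ennreal_leI)
    ultimately show ?thesis by (meson order_trans)
  qed
  show thesis
    by (rule that[of C]) (use * B1 K assms in \<open>auto simp: C_def\<close>)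
qed

section \<open>Mellin transforms of theta functions\<close>

lemma norm_exp_minus_1_le:
  fixes z :: complex
  shows "norm (exp z - 1) \<le> norm z * exp (norm z)"
proof -
  have "norm (exp z - exp 0) \<le> exp (norm z) * norm (z - 0)"
  proof (rule field_differentiable_bound[of "cball 0 (norm z)" exp exp])
    fix w :: complex assume "w \<in> cball 0 (norm z)"
    then show "norm (exp w) \<le> exp (norm z)"
      using complex_Re_le_cmod[of w] by (simp add: norm_exp_eq_Re)
  qed (auto intro: DERIV_exp has_field_derivative_at_within)
  then show ?thesis by (simp add: mult.commute)
qed

text \<open>
  Differentiation under the integral sign: the difference quotients at \<open>s\<close> with increments bounded by
  \<open>K\<close> are dominated by \<open>exp ((\<bar>s\<bar> + K + 1) \<bar>L\<bar>) \<bar>f\<bar>\<close>.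
\<close>
lemma holomorphic_integral_exp:
  fixes f :: "'a \<Rightarrow> complex" and L :: "'a \<Rightarrow> real"
  assumes [measurable]: "f \<in> borel_measurable M" "L \<in> borel_measurable M"
    and int: "\<And>A. integrable M (\<lambda>x. exp (A * \<bar>L x\<bar>) * norm (f x))"
  shows "(\<lambda>s. \<integral>x. exp (s * of_real (L x)) * f x \<partial>M) holomorphic_on UNIV"
proof -
  define F where "F s = (\<integral>x. exp (s * of_real (L x)) * f x \<partial>M)" for s
  have norm_le: "norm (exp (s * of_real (L x)) * f x) \<le> exp (norm s * \<bar>L x\<bar>) * norm (f x)" for s x
  proof -
    have "Re s * L x \<le> norm s * \<bar>L x\<bar>"
    proof -
      have "Re s * L x \<le> \<bar>Re s\<bar> * \<bar>L x\<bar>" by (metis abs_ge_self abs_mult)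
      also have "\<dots> \<le> norm s * \<bar>L x\<bar>" by (intro mult_right_mono abs_Re_le_cmod) auto
      finally show ?thesis .
    qed
    then show ?thesis by (auto simp: norm_mult norm_exp_eq_Re intro!: mult_right_mono)
  qed
  have I: "integrable M (\<lambda>x. exp (s * of_real (L x)) * f x)" for s
    by (rule Bochner_Integration.integrable_bound[OF int[of "norm s"]]) (use norm_le in \<open>auto simp: abs_mult\<close>)
  have "(F has_field_derivative (\<integral>x. of_real (L x) * exp (s * of_real (L x)) * f x \<partial>M)) (at s)" for s
    unfolding has_field_derivative_iff tendsto_at_iff_sequentially comp_def
  proof (intro allI impI)
    fix X :: "nat \<Rightarrow> complex" assume X: "\<forall>i. X i \<in> UNIV - {s}" "X \<longlonglongrightarrow> s"
    have "Bseq (\<lambda>i. X i - s)"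
      using X by (intro convergent_imp_Bseq convergent_diff convergent_const) (auto simp: convergent_def)
    then obtain K where K: "K > 0" "\<And>i. norm (X i - s) \<le> K" by (auto elim!: BseqE)
    have eq: "(F (X i) - F s) / (X i - s) = (\<integral>x. (exp (X i * of_real (L x)) - exp (s * of_real (L x))) / (X i - s) * f x \<partial>M)" for i
    proof -
      have "(F (X i) - F s) / (X i - s) = (\<integral>x. (exp (X i * of_real (L x)) * f x - exp (s * of_real (L x)) * f x) / (X i - s) \<partial>M)"
        unfolding F_def by (simp add: I)
      then show ?thesis by (simp add: algebra_simps)
    qed
    show "(\<lambda>i. (F (X i) - F s) / (X i - s)) \<longlonglongrightarrow> (\<integral>x. of_real (L x) * exp (s * of_real (L x)) * f x \<partial>M)"
      unfolding eq
    proof (rule integral_dominated_convergence[where w = "\<lambda>x. exp ((norm s + K + 1) * \<bar>L x\<bar>) * norm (f x)"])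
      show "AE x in M. (\<lambda>i. (exp (X i * of_real (L x)) - exp (s * of_real (L x))) / (X i - s) * f x) \<longlonglongrightarrow> of_real (L x) * exp (s * of_real (L x)) * f x"
      proof (intro AE_I2 tendsto_mult tendsto_const)
        fix x
        have "((\<lambda>s. exp (s * of_real (L x))) has_field_derivative of_real (L x) * exp (s * of_real (L x))) (at s)"
          by (auto intro!: derivative_eq_intros)
        then show "(\<lambda>i. (exp (X i * of_real (L x)) - exp (s * of_real (L x))) / (X i - s)) \<longlonglongrightarrow> of_real (L x) * exp (s * of_real (L x))"
          using X unfolding has_field_derivative_iff tendsto_at_iff_sequentially comp_def by blast
      qed
      fix i
      show "AE x in M. norm ((exp (X i * of_real (L x)) - exp (s * of_real (L x))) / (X i - s) * f x) \<le> exp ((norm s + K + 1) * \<bar>L x\<bar>) * norm (f x)"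
      proof (rule AE_I2)
        fix x
        define h where "h = X i - s"
        have h: "h \<noteq> 0" "norm h \<le> K" using X K by (auto simp: h_def)
        have "norm (exp (h * of_real (L x)) - 1) \<le> norm h * (\<bar>L x\<bar> * exp (norm h * \<bar>L x\<bar>))"
          using norm_exp_minus_1_le[of "h * of_real (L x)"] by (simp add: norm_mult mult.assoc)
        also have "\<dots> \<le> norm h * (exp \<bar>L x\<bar> * exp (K * \<bar>L x\<bar>))"
          using h by (intro mult_left_mono mult_mono) (auto intro: mult_right_mono order_trans[OF _ exp_ge_add_one_self])
        finally have "norm (exp (h * of_real (L x)) - 1) / norm h \<le> exp \<bar>L x\<bar> * exp (K * \<bar>L x\<bar>)"
          using h by (simp add: field_simps)
        then have "(norm (exp (h * of_real (L x)) - 1) / norm h) * norm (exp (s * of_real (L x)) * f x) \<le>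
            (exp \<bar>L x\<bar> * exp (K * \<bar>L x\<bar>)) * (exp (norm s * \<bar>L x\<bar>) * norm (f x))"
          by (intro mult_mono norm_le) auto
        moreover have "(exp (X i * of_real (L x)) - exp (s * of_real (L x))) / (X i - s) * f x =
           ((exp (h * of_real (L x)) - 1) / h) * (exp (s * of_real (L x)) * f x)"
          using h by (simp add: h_def algebra_simps exp_diff divide_simps)
        moreover have "(exp \<bar>L x\<bar> * exp (K * \<bar>L x\<bar>)) * (exp (norm s * \<bar>L x\<bar>) * norm (f x)) = exp ((norm s + K + 1) * \<bar>L x\<bar>) * norm (f x)"
          by (simp add: algebra_simps exp_add)
        ultimately show "norm ((exp (X i * of_real (L x)) - exp (s * of_real (L x))) / (X i - s) * f x) \<le> exp ((norm s + K + 1) * \<bar>L x\<bar>) * norm (f x)"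
          by (simp only: norm_mult norm_divide)
      qed
    qed (use int in auto)
  qed
  then show ?thesis
    unfolding F_def[symmetric] holomorphic_on_def field_differentiable_def
    by (blast intro: has_field_derivative_at_within)
qed

text \<open>
  The behaviour of the theta function of a lattice of rank \<open>2 \<kappa>\<close> and covolume 1 at both ends of the
  half-line. The constants are an argument, so that the same constants can serve a whole family.
\<close>
definition theta_bounds :: "real \<Rightarrow> (nat \<Rightarrow> real) \<Rightarrow> (real \<Rightarrow> real) \<Rightarrow> bool" where
  "theta_bounds \<kappa> C \<theta> \<longleftrightarrow> (\<forall>N t. t \<ge> 1 \<longrightarrow> \<bar>\<theta> t - 1\<bar> \<le> C N / t ^ N) \<and>
     (\<forall>N t. 0 < t \<longrightarrow> t \<le> 1 \<longrightarrow> \<bar>\<theta> t - t powr (-\<kappa>)\<bar> \<le> C N * t ^ N)"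

text \<open>
  The leading term of such a theta function at either end.
\<close>
definition theta_main :: "real \<Rightarrow> real \<Rightarrow> real" where
  "theta_main \<kappa> t = (if t \<ge> 1 then 1 else t powr (-\<kappa>))"

text \<open>
  Up to a constant, an integrable majorant of \<open>t\<^sup>A (\<theta> t - theta_main t)\<close>, whatever the exponent \<open>A\<close>.
\<close>
definition mellin_dom :: "real \<Rightarrow> real" where
  "mellin_dom t = (if t \<ge> 1 then t powr (-2) else 1)"

text \<open>
  Riemann's continuation of the Mellin transform of \<open>\<theta> - 1\<close> from \<open>Re w > \<kappa>\<close> to the plane. The difference
  \<open>\<theta> - theta_main\<close> decays rapidly at both ends, so its Mellin transform is entire, while the integral of
  \<open>t^(w-1) (t^(-\<kappa>) - 1)\<close> over \<open>0 < t < 1\<close> supplies the two poles.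
\<close>
definition mellin :: "real \<Rightarrow> (real \<Rightarrow> real) \<Rightarrow> complex \<Rightarrow> complex" where
  "mellin \<kappa> \<theta> w = (LINT t:{0<..}|lborel. of_real t powr (w - 1) * of_real (\<theta> t - theta_main \<kappa> t))
     + 1 / (w - of_real \<kappa>) - 1 / w"

lemma theta_main_measurable [measurable]: "theta_main \<kappa> \<in> borel_measurable borel"
  unfolding theta_main_def by measurable

lemma mellin_dom_measurable [measurable]: "mellin_dom \<in> borel_measurable borel"
  unfolding mellin_dom_def by measurable

lemma set_integrable_mellin_dom: "set_integrable lborel {0<..} mellin_dom"
proof -
  have "set_integrable lborel ({0<..<1} \<union> {1..}) mellin_dom"
  proof (rule set_integrable_Un)
    show "set_integrable lborel {0<..<1} mellin_dom"
    proof -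
      have "(\<lambda>x. indicat_real {0<..<1} x *\<^sub>R mellin_dom x) = indicat_real {0<..<1}"
        by (auto simp: mellin_dom_def indicator_def)
      then show ?thesis by (simp add: set_integrable_def)
    qed
    have "(\<lambda>x::real. x powr (-2)) absolutely_integrable_on {1..}"
      using has_integral_powr_to_inf[of "-2" 1] 
      by (intro nonnegative_absolutely_integrable_1) (auto simp: integrable_on_def)
    then have "set_integrable lborel {1..} (\<lambda>x::real. x powr (-2))"
      unfolding set_integrable_def by (subst (asm) integrable_completion) auto
    moreover have "(\<lambda>x. indicat_real ({1..}) x *\<^sub>R mellin_dom x) = (\<lambda>x. indicat_real ({1..}) x *\<^sub>R (x powr (-2)))"
      by (auto simp: mellin_dom_def indicator_def)
    ultimately show "set_integrable lborel {1..} mellin_dom" by (simp add: set_integrable_def)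
  qed auto
  moreover have "{0<..<1} \<union> {1..} = ({0<..} :: real set)" by auto
  ultimately show ?thesis by simp
qed

lemma theta_bounds_dom:
  assumes "theta_bounds \<kappa> C \<theta>" "real N \<ge> \<bar>A\<bar> + 2" "t > 0"
  shows "t powr A * \<bar>\<theta> t - theta_main \<kappa> t\<bar> \<le> C N * mellin_dom t"
proof (cases "t \<ge> 1")
  case True
  have "\<bar>\<theta> t - 1\<bar> \<le> C N * t powr (- real N)"
    using assms True by (auto simp: theta_bounds_def powr_minus powr_realpow divide_inverse)
  then have "t powr A * \<bar>\<theta> t - 1\<bar> \<le> t powr A * (C N * t powr (- real N))"
    by (intro mult_left_mono) auto
  also have "\<dots> = C N * t powr (A - real N)" by (simp add: powr_diff powr_minus divide_inverse)
  also have "\<dots> \<le> C N * t powr (-2)"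
  proof (intro mult_left_mono powr_mono)
    have "\<bar>\<theta> 1 - 1\<bar> \<le> C N / 1 ^ N" using assms(1) unfolding theta_bounds_def by (metis order_refl)
    then show "C N \<ge> 0" by simp
  qed (use assms True in auto)
  finally show ?thesis using True by (simp add: theta_main_def mellin_dom_def)
next
  case False
  have "\<bar>\<theta> t - t powr (-\<kappa>)\<bar> \<le> C N * t powr real N"
    using assms False by (auto simp: theta_bounds_def powr_realpow)
  then have "t powr A * \<bar>\<theta> t - t powr (-\<kappa>)\<bar> \<le> t powr A * (C N * t powr real N)"
    by (intro mult_left_mono) auto
  also have "\<dots> = C N * t powr (A + real N)" by (simp add: powr_add)
  also have "\<dots> \<le> C N * t powr 0"
  proof (intro mult_left_mono powr_mono')
    have "\<bar>\<theta> 1 - 1\<bar> \<le> C N / 1 ^ N" using assms(1) unfolding theta_bounds_def by (metis order_refl)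
    then show "C N \<ge> 0" by simp
  qed (use assms False in auto)
  finally show ?thesis using False assms by (simp add: theta_main_def mellin_dom_def)
qed

lemma theta_bounds_set_integrable:
  assumes "theta_bounds \<kappa> C \<theta>" and [measurable]: "\<theta> \<in> borel_measurable borel"
  shows "set_integrable lborel {0<..} (\<lambda>t. of_real t powr w * of_real (\<theta> t - theta_main \<kappa> t) :: complex)"
proof -
  obtain N :: nat where N: "real N \<ge> \<bar>Re w\<bar> + 2" using real_arch_simple by blast
  have "set_integrable lborel {0<..} (\<lambda>t. C N * mellin_dom t)"
    using set_integrable_mellin_dom by simp
  then show ?thesis
    unfolding set_integrable_def
  proof (rule Bochner_Integration.integrable_bound)
    show "AE t in lborel. norm (indicat_real {0<..} t *\<^sub>R (of_real t powr w * of_real (\<theta> t - theta_main \<kappa> t) :: complex)) \<le> norm (indicat_real {0<..} t *\<^sub>R (C N * mellin_dom t))"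
    proof (rule AE_I2)
      fix t :: real
      show "norm (indicat_real {0<..} t *\<^sub>R (of_real t powr w * of_real (\<theta> t - theta_main \<kappa> t) :: complex)) \<le> norm (indicat_real {0<..} t *\<^sub>R (C N * mellin_dom t))"
        using theta_bounds_dom[OF assms(1) N, of t]
        by (auto simp: indicator_def norm_mult norm_powr_real_powr simp flip: of_real_diff)
    qed
  qed measurable
qed

lemma mellin_regular_part_holomorphic:
  assumes "theta_bounds \<kappa> C \<theta>" and [measurable]: "\<theta> \<in> borel_measurable borel"
  shows "(\<lambda>w. LINT t:{0<..}|lborel. of_real t powr (w - 1) * (of_real (\<theta> t - theta_main \<kappa> t) :: complex)) holomorphic_on UNIV"
proof -
  define f where "f t = indicat_real {0<..} t *\<^sub>R (of_real t powr (-1) * of_real (\<theta> t - theta_main \<kappa> t) :: complex)" for t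
  have [measurable]: "f \<in> borel_measurable lborel" unfolding f_def by measurable
  have "(\<lambda>w. \<integral>t. exp (w * of_real (ln t)) * f t \<partial>lborel) holomorphic_on UNIV"
  proof (rule holomorphic_integral_exp)
    fix A :: real
    let ?P = "\<lambda>A t. norm (indicat_real {0<..} t *\<^sub>R (of_real t powr of_real (A - 1) * of_real (\<theta> t - theta_main \<kappa> t) :: complex))"
    have "integrable lborel (\<lambda>t. ?P A t + ?P (-A) t)"
      using theta_bounds_set_integrable[OF assms] unfolding set_integrable_def
      by (intro Bochner_Integration.integrable_add integrable_norm)
    then show "integrable lborel (\<lambda>t. exp (A * \<bar>ln t\<bar>) * norm (f t))"
    proof (rule Bochner_Integration.integrable_bound)
      show "AE t in lborel. norm (exp (A * \<bar>ln t\<bar>) * norm (f t)) \<le> norm (?P A t + ?P (-A) t)"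
      proof (rule AE_I2)
        fix t :: real
        show "norm (exp (A * \<bar>ln t\<bar>) * norm (f t)) \<le> norm (?P A t + ?P (-A) t)"
        proof (cases "t > 0")
          case True
          have "exp (A * \<bar>ln t\<bar>) \<le> t powr A + t powr (-A)"
            using True by (auto simp: powr_def abs_if)
          then have "exp (A * \<bar>ln t\<bar>) * (t powr (-1) * \<bar>\<theta> t - theta_main \<kappa> t\<bar>) \<le> (t powr A + t powr (-A)) * (t powr (-1) * \<bar>\<theta> t - theta_main \<kappa> t\<bar>)"
            by (intro mult_right_mono) auto
          also have "\<dots> = t powr (A - 1) * \<bar>\<theta> t - theta_main \<kappa> t\<bar> + t powr (- A - 1) * \<bar>\<theta> t - theta_main \<kappa> t\<bar>"
            using True by (simp add: powr_diff powr_minus field_simps)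
          finally show ?thesis using True
            by (simp add: f_def norm_mult norm_powr_real_powr abs_mult flip: of_real_diff)
        qed (auto simp: f_def)
      qed
    qed measurable
  qed measurable
  moreover have "exp (w * of_real (ln t)) * f t = indicat_real {0<..} t *\<^sub>R (of_real t powr (w - 1) * (of_real (\<theta> t - theta_main \<kappa> t) :: complex))" for w t
    by (auto simp: f_def indicator_def powr_def Ln_of_real algebra_simps exp_diff exp_minus divide_inverse)
  ultimately show ?thesis unfolding set_lebesgue_integral_def by simp
qed

lemma mellin_analytic:
  assumes "theta_bounds \<kappa> C \<theta>" "\<theta> \<in> borel_measurable borel" "w \<noteq> 0" "w \<noteq> of_real \<kappa>"
  shows "mellin \<kappa> \<theta> analytic_on {w}"
proof -
  have "(\<lambda>w. LINT t:{0<..}|lborel. of_real t powr (w - 1) * (of_real (\<theta> t - theta_main \<kappa> t) :: complex)) analytic_on {w}"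
    using mellin_regular_part_holomorphic[OF assms(1,2)] analytic_on_open[of UNIV] analytic_on_subset by blast
  then show ?thesis unfolding mellin_def
    using assms(3,4) by (intro analytic_intros) auto
qed

lemma mellin_meromorphic:
  assumes "theta_bounds \<kappa> C \<theta>" "\<theta> \<in> borel_measurable borel"
  shows "mellin \<kappa> \<theta> meromorphic_on UNIV"
proof -
  have "(\<lambda>w. LINT t:{0<..}|lborel. of_real t powr (w - 1) * (of_real (\<theta> t - theta_main \<kappa> t) :: complex)) analytic_on UNIV"
    using mellin_regular_part_holomorphic[OF assms(1,2)] by (simp add: analytic_on_open)
  then have 1: "(\<lambda>w. LINT t:{0<..}|lborel. of_real t powr (w - 1) * (of_real (\<theta> t - theta_main \<kappa> t) :: complex)) meromorphic_on UNIV"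
    by (rule analytic_on_imp_meromorphic_on)
  have 2: "(\<lambda>w. 1 / (w - of_real \<kappa>)) meromorphic_on UNIV" "(\<lambda>w::complex. 1 / w) meromorphic_on UNIV"
    by (intro meromorphic_intros)+
  show ?thesis unfolding mellin_def[abs_def]
    by (rule meromorphic_on_diff[OF meromorphic_on_add[OF 1 2(1)] 2(2)])
qed

lemma set_integral_powr_unit:
  fixes z :: complex
  assumes "Re z > 0"
  shows "set_integrable lborel {0<..<1} (\<lambda>t. of_real t powr (z - 1))" (is ?A)
    and "(LINT t:{0<..<1}|lborel. of_real t powr (z - 1)) = 1 / z" (is ?B)
proof -
  have "(\<lambda>t. t powr (Re z - 1)) absolutely_integrable_on {0..1}"
    using has_integral_powr_from_0[of "Re z - 1" 1] assms
    by (intro nonnegative_absolutely_integrable_1) (auto simp: integrable_on_def)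
  then have "set_integrable lborel {0..1} (\<lambda>t. t powr (Re z - 1))"
    unfolding set_integrable_def by (subst (asm) integrable_completion) auto
  then have "set_integrable lborel {0<..<1} (\<lambda>t. t powr (Re z - 1))"
    by (rule set_integrable_subset) auto
  then show A: ?A
    unfolding set_integrable_def
    by (rule Bochner_Integration.integrable_bound) (auto intro!: AE_I2 simp: indicator_def norm_powr_real_powr)
  have z: "z \<noteq> 0" using assms by auto
  have "(LBINT t=ereal 0..ereal 1. of_real t powr (z - 1)) = 1 / z - 0"
  proof (rule interval_integral_FTC_integrable[where F = "\<lambda>t. of_real t powr z / z"])
    fix x assume "ereal 0 < ereal x" "ereal x < ereal 1"
    then have x: "x > 0" by simp
    show "((\<lambda>t. of_real t powr z / z) has_vector_derivative of_real x powr (z - 1)) (at x)"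
    proof -
      have "((\<lambda>t. t powr z / z) has_field_derivative (of_real x powr (z - 1))) (at (of_real x))"
        using x z by (auto intro!: derivative_eq_intros simp: complex_nonpos_Reals_iff)
      from has_vector_derivative_real_field[OF this] show ?thesis by (simp add: o_def)
    qed
    show "isCont (\<lambda>t. of_real t powr (z - 1)) x"
      using x by (intro continuous_intros) (auto simp: complex_nonpos_Reals_iff)
  next
    show "set_integrable lborel (einterval (ereal 0) (ereal 1)) (\<lambda>t. of_real t powr (z - 1))"
      using A by (simp add: einterval_eq)
    have "((\<lambda>t. of_real t powr z / z) \<longlongrightarrow> 0) (at_right (0::real))"
    proof (rule tendsto_norm_zero_cancel)
      have "((\<lambda>t. t powr Re z / norm z) \<longlongrightarrow> 0) (at_right (0::real))"
        using assms z by real_asymp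
      then show "((\<lambda>t. norm (of_real t powr z / z)) \<longlongrightarrow> 0) (at_right (0::real))"
        by (rule Lim_transform_eventually)
           (auto simp: eventually_at_right_less norm_divide norm_powr_real_powr intro: eventually_mono[OF eventually_at_right_less])
    qed
    then show "(((\<lambda>t. of_real t powr z / z) \<circ> real_of_ereal) \<longlongrightarrow> 0) (at_right (ereal 0))"
      by (simp add: ereal_tendsto_simps)
    have "((\<lambda>t. of_real t powr z / z) \<longlongrightarrow> of_real 1 powr z / z) (at_left (1::real))"
      using z by (intro tendsto_intros) (auto intro!: tendsto_ident_at)
    then show "(((\<lambda>t. of_real t powr z / z) \<circ> real_of_ereal) \<longlongrightarrow> 1 / z) (at_left (ereal 1))"
      by (simp add: ereal_tendsto_simps)
  qed simp_all
  then show ?B by (simp add: interval_lebesgue_integral_def einterval_eq)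
qed

lemma mellin_eq_integral:
  assumes "theta_bounds \<kappa> C \<theta>" and [measurable]: "\<theta> \<in> borel_measurable borel" and w: "Re w > \<kappa>" "\<kappa> > 0"
  shows "set_integrable lborel {0<..} (\<lambda>t. of_real t powr (w - 1) * of_real (\<theta> t - 1) :: complex)" (is ?A)
    and "mellin \<kappa> \<theta> w = (LINT t:{0<..}|lborel. of_real t powr (w - 1) * of_real (\<theta> t - 1))" (is ?B)
proof -
  let ?f = "\<lambda>t. of_real t powr (w - 1) * of_real (\<theta> t - theta_main \<kappa> t) :: complex"
  let ?g = "\<lambda>t. indicat_real {0<..<1} t *\<^sub>R (of_real t powr (w - of_real \<kappa> - 1)) - indicat_real {0<..<1} t *\<^sub>R (of_real t powr (w - 1) :: complex)"
  have g: "integrable lborel ?g" "integral\<^sup>L lborel ?g = 1 / (w - of_real \<kappa>) - 1 / w"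
    using set_integral_powr_unit[of w] set_integral_powr_unit[of "w - of_real \<kappa>"] w
    unfolding set_integrable_def set_lebesgue_integral_def by auto
  have f: "integrable lborel (\<lambda>t. indicat_real {0<..} t *\<^sub>R ?f t)"
    using theta_bounds_set_integrable[OF assms(1,2), of "w - 1"] unfolding set_integrable_def .
  have eq: "indicat_real {0<..} t *\<^sub>R (of_real t powr (w - 1) * of_real (\<theta> t - 1) :: complex) = indicat_real {0<..} t *\<^sub>R ?f t + ?g t" for t
  proof -
    have "of_real (t powr (-\<kappa>)) = (of_real t powr (of_real (- \<kappa>)) :: complex)" if "t > 0"
      using that by (subst powr_of_real) auto
    moreover have "of_real t powr (w - of_real \<kappa> - 1) = of_real t powr (w - 1) * (of_real t powr (of_real (- \<kappa>)) :: complex)"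
      using powr_add[of "of_real t :: complex" "w - 1" "- of_real \<kappa>"] by (simp add: algebra_simps)
    ultimately show ?thesis
      by (auto simp: indicator_def theta_main_def algebra_simps)
  qed
  show ?A unfolding set_integrable_def eq by (intro Bochner_Integration.integrable_add f g)
  show ?B unfolding mellin_def set_lebesgue_integral_def eq
    by (subst Bochner_Integration.integral_add[OF f g(1)]) (simp add: g(2))
qed

lemma Gamma_mellin:
  fixes w :: complex
  assumes "Re w > 0" "a > 0"
  shows "set_integrable lborel {0<..} (\<lambda>t. of_real t powr (w - 1) * of_real (exp (- a * t)))" (is ?A)
    and "(LINT t:{0<..}|lborel. of_real t powr (w - 1) * of_real (exp (- a * t))) = Gamma w * of_real a powr (- w)" (is ?B)
proof -
  have A: "set_integrable lborel {0<..} (\<lambda>t. of_real t powr (w - 1) * of_real (exp (- a * t)) :: complex)" if "a > 0" for a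
    using absolutely_integrable_Gamma_integral[OF assms(1) that]
    unfolding set_integrable_def
    by (subst (asm) integrable_completion) (auto simp: exp_minus divide_inverse simp flip: of_real_inverse)
  then show ?A using assms by blast
  have 1: "(LINT t:{0<..}|lborel. of_real t powr (w - 1) * of_real (exp (- 1 * t))) = Gamma w"
  proof -
    have "(LINT t:{0<..}|lborel. of_real t powr (w - 1) * of_real (exp (- 1 * t))) = integral {0<..} (\<lambda>t. of_real t powr (w - 1) * of_real (exp (- 1 * t)))"
      using A[of 1] by (intro set_borel_integral_eq_integral) auto
    also have "\<dots> = Gamma w"
      using Gamma_integral_complex'[OF assms(1)]
      by (intro integral_unique) (auto simp: exp_minus divide_inverse simp flip: of_real_inverse)
    finally show ?thesis .
  qed
  have "(LINT t:{0<..}|lborel. of_real t powr (w - 1) * of_real (exp (- 1 * t))) =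
     a *\<^sub>R (\<integral>t. indicat_real {0<..} (0 + a * t) *\<^sub>R (of_real (0 + a * t) powr (w - 1) * of_real (exp (- 1 * (0 + a * t)))) \<partial>lborel)"
    unfolding set_lebesgue_integral_def using assms
    by (subst lborel_integral_real_affine[where c = a and t = 0]) auto
  also have "\<dots> = a *\<^sub>R (\<integral>t. of_real a powr (w - 1) * (indicat_real {0<..} t *\<^sub>R (of_real t powr (w - 1) * of_real (exp (- a * t)))) \<partial>lborel)"
    using assms by (intro arg_cong[of _ _ "\<lambda>x. a *\<^sub>R x"] Bochner_Integration.integral_cong)
      (auto simp: indicator_def zero_less_mult_iff powr_times_real mult.assoc)
  also have "\<dots> = a *\<^sub>R (of_real a powr (w - 1) * (LINT t:{0<..}|lborel. of_real t powr (w - 1) * of_real (exp (- a * t))))"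
    unfolding set_lebesgue_integral_def by (subst integral_mult_right_zero) (rule refl)
  also have "\<dots> = of_real a powr w * (LINT t:{0<..}|lborel. of_real t powr (w - 1) * of_real (exp (- a * t)))"
    using assms(2) by (simp add: scaleR_conv_of_real powr_diff)
  finally have "Gamma w = of_real a powr w * (LINT t:{0<..}|lborel. of_real t powr (w - 1) * of_real (exp (- a * t)))"
    unfolding 1 .
  then show ?B using assms by (simp add: powr_minus field_simps)
qed

text \<open>
  Integrate the sum of Gaussians term by term, each term being a Gamma integral. The exchange is
  justified because the integral of \<open>t^(Re w - 1) \<phi> t\<close> is finite and all Gaussians are positive; the absolute
  convergence of the Dirichlet series comes with it.
\<close>
lemma mellin_gaussian_sum:
  fixes q :: "'v \<Rightarrow> real" and w :: complex
  assumes V: "countable V" and q: "\<And>v. v \<in> V \<Longrightarrow> q v > 0" and w: "Re w > 0"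
    and \<phi>: "\<And>t. t > 0 \<Longrightarrow> (\<integral>\<^sup>+v. ennreal (exp (- pi * t * q v)) \<partial>count_space V) = ennreal (\<phi> t)"
           "\<And>t. t > 0 \<Longrightarrow> \<phi> t \<ge> 0"
    and int: "set_integrable lborel {0<..} (\<lambda>t. of_real t powr (w - 1) * of_real (\<phi> t) :: complex)"
  shows "(\<lambda>v. of_real (q v) powr (- w)) summable_on V"
    and "(LINT t:{0<..}|lborel. of_real t powr (w - 1) * of_real (\<phi> t)) =
         of_real pi powr (- w) * Gamma w * (\<Sum>\<^sub>\<infinity>v\<in>V. of_real (q v) powr (- w))"
proof -
  interpret C: sigma_finite_measure "count_space V"
    by (rule sigma_finite_measure_count_space_countable) fact
  interpret pair_sigma_finite lborel "count_space V" ..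
  define G where "G t v = indicat_real {0<..} t *\<^sub>R (of_real t powr (w - 1) * of_real (exp (- (pi * q v) * t)) :: complex)" for t v
  have meas: "(\<lambda>(t, v). G t v) \<in> borel_measurable (lborel \<Otimes>\<^sub>M count_space V)"
  proof -
    have "(\<lambda>(v, t). G t v) \<in> borel_measurable (count_space V \<Otimes>\<^sub>M lborel)"
      by (rule measurable_pair_measure_countable1[OF V]) (simp add: G_def)
    then show ?thesis by (subst measurable_pair_swap_iff) (simp add: case_prod_beta)
  qed
  have nnG: "(\<integral>\<^sup>+v. ennreal (exp (- (pi * q v) * t)) \<partial>count_space V) = ennreal (\<phi> t)" if "t > 0" for t
    using \<phi>(1)[OF that] by (simp add: mult_ac)
  have ie: "integrable (count_space V) (\<lambda>v. exp (- (pi * q v) * t))" "(\<integral>v. exp (- (pi * q v) * t) \<partial>count_space V) = \<phi> t"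
    if "t > 0" for t
  proof -
    show "integrable (count_space V) (\<lambda>v. exp (- (pi * q v) * t))"
      by (rule integrableI_nonneg) (use nnG[OF that] in auto)
    show "(\<integral>v. exp (- (pi * q v) * t) \<partial>count_space V) = \<phi> t"
      using nnG[OF that] \<phi>(2)[OF that] by (subst integral_eq_nn_integral) auto
  qed
  have norms: "(\<integral>v. norm (G t v) \<partial>count_space V) = norm (indicat_real {0<..} t *\<^sub>R (of_real t powr (w - 1) * of_real (\<phi> t) :: complex))" for t
    using ie(2)[of t] \<phi>(2)[of t] by (auto simp: G_def indicator_def norm_mult)
  have inner: "(\<integral>v. G t v \<partial>count_space V) = indicat_real {0<..} t *\<^sub>R (of_real t powr (w - 1) * of_real (\<phi> t) :: complex)" for t
    using ie(2)[of t] by (auto simp: G_def indicator_def)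
  have inner_int: "integrable (count_space V) (G t)" for t
  proof (cases "t > 0")
    case True
    have "integrable (count_space V) (\<lambda>v. of_real t powr (w - 1) * of_real (exp (- (pi * q v) * t)) :: complex)"
      by (intro integrable_mult_right integrable_of_real ie(1)[OF True])
    then show ?thesis using True by (simp add: G_def[abs_def])
  qed (simp add: G_def[abs_def])
  have fub: "integrable (lborel \<Otimes>\<^sub>M count_space V) (\<lambda>(t, v). G t v)"
  proof (rule Fubini_integrable[OF meas])
    have "integrable lborel (\<lambda>t. \<integral>v. norm (G t v) \<partial>count_space V)"
      unfolding norms by (rule integrable_norm) (use int in \<open>simp add: set_integrable_def\<close>)
    then show "integrable lborel (\<lambda>t. \<integral>v. norm (case (t, v) of (t, v) \<Rightarrow> G t v) \<partial>count_space V)" by simp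
  qed (simp add: inner_int)
  have outer: "(\<integral>t. G t v \<partial>lborel) = of_real pi powr (- w) * Gamma w * of_real (q v) powr (- w)" if "v \<in> V" for v
    using Gamma_mellin(2)[OF w, of "pi * q v"] q[OF that]
    unfolding G_def set_lebesgue_integral_def by (simp add: powr_times_real mult_ac)
  have "integrable (count_space V) (\<lambda>v. \<integral>t. G t v \<partial>lborel)"
    by (rule integrable_snd[OF fub])
  then have "integrable (count_space V) (\<lambda>v. of_real pi powr (- w) * Gamma w * of_real (q v) powr (- w))"
    by (subst Bochner_Integration.integrable_cong[OF refl]) (auto simp: outer)
  moreover have nz: "of_real pi powr (- w) * Gamma w \<noteq> 0"
    using w Gamma_eq_zero_iff[of w] by (auto elim!: nonpos_Ints_cases)
  ultimately have abs: "Infinite_Set_Sum.abs_summable_on (\<lambda>v. of_real (q v) powr (- w)) V"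
  proof -
    define c where "c = of_real pi powr (- w) * Gamma w"
    assume I: "integrable (count_space V) (\<lambda>v. of_real pi powr (- w) * Gamma w * of_real (q v) powr (- w))"
      and nz: "of_real pi powr (- w) * Gamma w \<noteq> 0"
    have "integrable (count_space V) (\<lambda>v. inverse c * (c * of_real (q v) powr (- w)))"
      unfolding c_def by (rule integrable_mult_right) (rule I)
    moreover have "inverse c * (c * x) = x" for x
    proof -
      have "c \<noteq> 0" using nz unfolding c_def .
      then show ?thesis by simp
    qed
    ultimately show ?thesis unfolding abs_summable_on_def by (simp only:)
  qed
  then show "(\<lambda>v. of_real (q v) powr (- w)) summable_on V"
    by (simp add: abs_summable_equivalent abs_summable_summable)
  have "(LINT t:{0<..}|lborel. of_real t powr (w - 1) * of_real (\<phi> t)) = (\<integral>t. (\<integral>v. G t v \<partial>count_space V) \<partial>lborel)"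
    unfolding inner set_lebesgue_integral_def ..
  also have "\<dots> = (\<integral>v. (\<integral>t. G t v \<partial>lborel) \<partial>count_space V)"
    by (rule Fubini_integral[OF fub, symmetric])
  also have "\<dots> = (\<integral>v. of_real pi powr (- w) * Gamma w * of_real (q v) powr (- w) \<partial>count_space V)"
    by (intro Bochner_Integration.integral_cong) (auto simp: outer)
  also have "\<dots> = of_real pi powr (- w) * Gamma w * infsetsum (\<lambda>v. of_real (q v) powr (- w)) V"
    by (simp add: infsetsum_def)
  finally show "(LINT t:{0<..}|lborel. of_real t powr (w - 1) * of_real (\<phi> t)) =
         of_real pi powr (- w) * Gamma w * (\<Sum>\<^sub>\<infinity>v\<in>V. of_real (q v) powr (- w))"
    using infsetsum_infsum[OF abs] by simp
qed

section \<open>Gaussian sums and lattice theta functions\<close>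

definition gauss :: "real \<Rightarrow> real \<Rightarrow> ennreal" where
  "gauss t x = ennreal (exp (- pi * t * x\<^sup>2))"

lemma gauss_measurable [measurable]: "gauss t \<in> borel_measurable borel"
  unfolding gauss_def by measurable

lemma gauss_0 [simp]: "gauss t 0 = 1" by (simp add: gauss_def)

definition gauss_sum :: "real \<Rightarrow> real \<Rightarrow> real \<Rightarrow> ennreal" where
  "gauss_sum l t b = (\<integral>\<^sup>+k. gauss t (l * (b + of_int k)) \<partial>count_space UNIV)"

lemma gauss_sum_measurable [measurable]: "gauss_sum l t \<in> borel_measurable borel"
  unfolding gauss_sum_def by measurable

text \<open>
  The integral of the Gaussian \<open>gauss t (l x)\<close> over \<open>x \<in> \<real>\<close>.
\<close>
definition gauss_mass :: "real \<Rightarrow> real \<Rightarrow> ennreal" where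
  "gauss_mass l t = ennreal (1 / (l * sqrt t))"

lemma gauss_sum_eq_circle_heat:
  assumes "l > 0" "t > 0"
  shows "gauss_sum l t b = gauss_mass l t * circle_heat (1 / (l\<^sup>2 * t)) b"
proof -
  have "gauss t (l * x) = gauss_mass l t * ennreal (heat (1 / (l\<^sup>2 * t)) x)" for x
    unfolding gauss_def gauss_mass_def using assms
    by (subst ennreal_mult[symmetric]) (auto simp: heat_def real_sqrt_divide real_sqrt_mult power_mult_distrib mult_ac)
  then show ?thesis unfolding gauss_sum_def circle_heat_def by (simp add: nn_integral_cmult)
qed

lemma gauss_sum_unfold:
  assumes "m \<noteq> 0" "l > 0" "t > 0"
  shows "(\<integral>\<^sup>+x. gauss_sum l t (of_int m * x + b) * indicator {0..<1} x \<partial>lborel) = gauss_mass l t"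
  using circle_heat_unfold[OF assms(1), of "1 / (l\<^sup>2 * t)" b] assms
  by (simp add: gauss_sum_eq_circle_heat nn_integral_cmult mult.assoc)

text \<open>
  The periodized Gaussian equals its mass up to a relative error of arbitrary power order. The shift
  \<open>b\<close> does not enter the error, which allows these sums to be nested.
\<close>
lemma gauss_sum_bounds:
  assumes "l > 0"
  shows "\<exists>C\<ge>0. \<forall>t b. 0 < t \<longrightarrow> t \<le> 1 \<longrightarrow>
    gauss_mass l t * ennreal (1 - C * t ^ N) \<le> gauss_sum l t b \<and> gauss_sum l t b \<le> gauss_mass l t * ennreal (1 + C * t ^ N)"
proof -
  obtain C where C: "C \<ge> 0" "\<And>\<tau> a. \<tau> \<ge> 1 / l\<^sup>2 \<Longrightarrow> ennreal (1 - C / \<tau> ^ N) \<le> circle_heat \<tau> a"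
    "\<And>\<tau> a. \<tau> \<ge> 1 / l\<^sup>2 \<Longrightarrow> circle_heat \<tau> a \<le> ennreal (1 + C / \<tau> ^ N)"
    by (rule circle_heat_rapid[of "1 / l\<^sup>2" N]) (use assms in auto)
  have le: "1 / (l\<^sup>2 * t) \<ge> 1 / l\<^sup>2" if "0 < t" "t \<le> 1" for t
    using that assms by (intro divide_left_mono) (auto intro: mult_left_le)
  have eq: "C / (1 / (l\<^sup>2 * t)) ^ N = C * l ^ (2 * N) * t ^ N" for t
    by (simp add: power_divide power_mult_distrib power_mult)
  show ?thesis
  proof (intro exI[of _ "C * l ^ (2 * N)"] conjI allI impI)
    fix t b :: real assume t: "0 < t" "t \<le> 1"
    show "gauss_mass l t * ennreal (1 - C * l ^ (2 * N) * t ^ N) \<le> gauss_sum l t b"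
      using C(2)[OF le[OF t], of b] t assms unfolding eq by (simp add: gauss_sum_eq_circle_heat mult_left_mono)
    show "gauss_sum l t b \<le> gauss_mass l t * ennreal (1 + C * l ^ (2 * N) * t ^ N)"
      using C(3)[OF le[OF t], of b] t assms unfolding eq by (simp add: gauss_sum_eq_circle_heat mult_left_mono)
  qed (use C assms in auto)
qed

definition gauss_theta :: "('v \<Rightarrow> real) \<Rightarrow> real \<Rightarrow> ennreal" where
  "gauss_theta q t = (\<integral>\<^sup>+v. ennreal (exp (- pi * t * q v)) \<partial>count_space UNIV)"

lemma gauss_theta_measurable [measurable]:
  fixes q :: "'v::countable \<Rightarrow> real"
  shows "gauss_theta q \<in> borel_measurable borel"
  unfolding gauss_theta_def by measurable

lemma gauss_theta_split:
  assumes "q v0 = 0"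
  shows "gauss_theta q t = 1 + (\<integral>\<^sup>+v. ennreal (exp (- pi * t * q v)) \<partial>count_space (UNIV - {v0}))"
  unfolding gauss_theta_def by (subst nn_integral_count_space_remove[of _ v0]) (simp add: assms)

text \<open>
  The first summand controls \<open>t \<le> 1\<close>, where the factor \<open>t^(-\<kappa>)\<close> costs \<open>\<lceil>\<kappa>\<rceil>\<close> powers of \<open>t\<close>, the second one
  controls \<open>t \<ge> 1\<close>. The formula involves only the data \<open>\<kappa>, \<delta>, K\<close>, hence uniformity in families.
\<close>
definition theta_const :: "real \<Rightarrow> real \<Rightarrow> (nat \<Rightarrow> real) \<Rightarrow> nat \<Rightarrow> real" where
  "theta_const \<kappa> \<delta> K N = K (N + nat \<lceil>\<kappa>\<rceil>) + exp (pi * \<delta>) * (real N / (pi * \<delta>)) ^ N * (1 + K 0)"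

text \<open>
  For \<open>N = 0\<close> both sides make sense since \<open>0\<^sup>0 = 1\<close>; otherwise \<open>(1 + x/N)\<^sup>N \<le> e\<^sup>x\<close>.
\<close>
lemma exp_minus_le_power:
  assumes "x > 0"
  shows "exp (- x) \<le> (real N / x) ^ N"
proof (cases "N = 0")
  case False
  have "(x / real N) ^ N \<le> exp x"
    using exp_ge_one_plus_x_over_n_power_n[of N x] False assms
    by (intro order_trans[OF power_mono[of "x / real N" "1 + x / real N" N]]) auto
  then show ?thesis using assms False by (simp add: exp_minus field_simps power_divide)
qed (use assms in auto)

text \<open>
  For \<open>t \<ge> 1\<close> the gap gives \<open>e^(-\<pi>tq) \<le> e^(-\<pi>\<delta>(t-1)) e^(-\<pi>q)\<close> for all vectors except \<open>v0\<close>, so the theta function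
  approaches 1 exponentially; for \<open>t \<le> 1\<close> the assumed relative error bounds are used at a higher order.
\<close>
lemma gauss_theta_bounds:
  fixes q :: "'v::countable \<Rightarrow> real"
  assumes \<delta>: "\<delta> > 0" and \<kappa>: "\<kappa> \<ge> 0" and q0: "q v0 = 0" and gap: "\<And>v. v \<noteq> v0 \<Longrightarrow> q v \<ge> \<delta>"
    and K: "\<And>N. K N \<ge> 0"
    and lo: "\<And>N t. 0 < t \<Longrightarrow> t \<le> 1 \<Longrightarrow> ennreal (t powr (-\<kappa>)) * ennreal (1 - K N * t ^ N) \<le> gauss_theta q t"
    and hi: "\<And>N t. 0 < t \<Longrightarrow> t \<le> 1 \<Longrightarrow> gauss_theta q t \<le> ennreal (t powr (-\<kappa>)) * ennreal (1 + K N * t ^ N)"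
  shows "theta_bounds \<kappa> (theta_const \<kappa> \<delta> K) (\<lambda>t. enn2real (gauss_theta q t))"
    and "\<And>t. t > 0 \<Longrightarrow> gauss_theta q t < \<infinity>"
proof -
  have 1: "gauss_theta q 1 \<le> ennreal (1 + K 0)" using hi[of 1 0] by simp
  have decay: "(\<integral>\<^sup>+v. ennreal (exp (- pi * t * q v)) \<partial>count_space (UNIV - {v0})) \<le> ennreal (exp (- (pi * \<delta> * (t - 1))) * (1 + K 0))"
    if t: "t \<ge> 1" for t
  proof -
    have "(\<integral>\<^sup>+v. ennreal (exp (- pi * t * q v)) \<partial>count_space (UNIV - {v0})) \<le>
      (\<integral>\<^sup>+v. ennreal (exp (- (pi * \<delta> * (t - 1)))) * ennreal (exp (- pi * 1 * q v)) \<partial>count_space (UNIV - {v0}))"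
    proof (rule nn_integral_mono)
      fix v assume "v \<in> space (count_space (UNIV - {v0}))"
      then have "q v \<ge> \<delta>" using gap by auto
      then have "pi * (t - 1) * \<delta> \<le> pi * (t - 1) * q v" using t by (intro mult_left_mono) auto
      then have "exp (- pi * t * q v) \<le> exp (- (pi * \<delta> * (t - 1))) * exp (- pi * 1 * q v)"
        unfolding exp_add[symmetric] by (simp add: algebra_simps)
      then show "ennreal (exp (- pi * t * q v)) \<le> ennreal (exp (- (pi * \<delta> * (t - 1)))) * ennreal (exp (- pi * 1 * q v))"
        by (subst ennreal_mult[symmetric]) (auto intro: ennreal_leI)
    qed
    also have "\<dots> = ennreal (exp (- (pi * \<delta> * (t - 1)))) * (\<integral>\<^sup>+v. ennreal (exp (- pi * 1 * q v)) \<partial>count_space (UNIV - {v0}))"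
      by (rule nn_integral_cmult) simp
    also have "\<dots> \<le> ennreal (exp (- (pi * \<delta> * (t - 1)))) * ennreal (1 + K 0)"
    proof (rule mult_left_mono)
      show "(\<integral>\<^sup>+v. ennreal (exp (- pi * 1 * q v)) \<partial>count_space (UNIV - {v0})) \<le> ennreal (1 + K 0)"
        using 1 unfolding gauss_theta_split[of q v0, OF q0] by (rule order_trans[rotated]) simp
    qed simp
    also have "\<dots> = ennreal (exp (- (pi * \<delta> * (t - 1))) * (1 + K 0))"
      using K[of 0] by (subst ennreal_mult[symmetric]) auto
    finally show ?thesis .
  qed
  show fin: "gauss_theta q t < \<infinity>" if "t > 0" for t
  proof (cases "t \<le> 1")
    case True
    show ?thesis using hi[OF that True, of 0] by (rule le_less_trans) (simp add: ennreal_mult_less_top)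
  next
    case False
    then show ?thesis unfolding gauss_theta_split[of q v0, OF q0] using decay[of t]
      by (auto simp: less_top[symmetric] top_unique)
  qed
  have ge1: "enn2real (gauss_theta q t) \<ge> 1" if "t > 0" for t
  proof -
    have "1 \<le> gauss_theta q t" unfolding gauss_theta_split[of q v0, OF q0] by simp
    then have "enn2real 1 \<le> enn2real (gauss_theta q t)" using fin[OF that] by (intro enn2real_mono) auto
    then show ?thesis by simp
  qed
  have C0: "0 \<le> exp (pi * \<delta>) * (real N / (pi * \<delta>)) ^ N * (1 + K 0)" for N
    using \<delta> K[of 0] by simp
  show "theta_bounds \<kappa> (theta_const \<kappa> \<delta> K) (\<lambda>t. enn2real (gauss_theta q t))"
    unfolding theta_bounds_def
  proof (intro conjI allI impI)
    fix N :: nat and t :: real assume t: "1 \<le> t"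
    have "gauss_theta q t \<le> ennreal (1 + exp (- (pi * \<delta> * (t - 1))) * (1 + K 0))"
      unfolding gauss_theta_split[of q v0, OF q0] using decay[OF t] K[of 0]
      by (subst ennreal_plus) (auto intro: add_left_mono)
    then have "enn2real (gauss_theta q t) \<le> 1 + exp (- (pi * \<delta> * (t - 1))) * (1 + K 0)"
      by (rule enn2real_leI[rotated]) (use K[of 0] in auto)
    also have "exp (- (pi * \<delta> * (t - 1))) = exp (pi * \<delta>) * exp (- (pi * \<delta> * t))"
      unfolding exp_add[symmetric] by (simp add: algebra_simps)
    also have "\<dots> * (1 + K 0) \<le> exp (pi * \<delta>) * (real N / (pi * \<delta> * t)) ^ N * (1 + K 0)"
      using exp_minus_le_power[of "pi * \<delta> * t" N] t \<delta> K[of 0] by (intro mult_right_mono mult_left_mono) auto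
    also have "\<dots> = (exp (pi * \<delta>) * (real N / (pi * \<delta>)) ^ N * (1 + K 0)) / t ^ N"
      by (simp add: power_divide power_mult_distrib)
    also have "\<dots> \<le> theta_const \<kappa> \<delta> K N / t ^ N"
      unfolding theta_const_def using t K[of "N + nat \<lceil>\<kappa>\<rceil>"] by (intro divide_right_mono) auto
    finally show "\<bar>enn2real (gauss_theta q t) - 1\<bar> \<le> theta_const \<kappa> \<delta> K N / t ^ N"
      using ge1[of t] t by simp
  next
    fix N :: nat and t :: real assume t: "0 < t" "t \<le> 1"
    \<comment> \<open>The extra order absorbs the factor \<open>t^(-\<kappa>)\<close>.\<close>
    define M where "M = N + nat \<lceil>\<kappa>\<rceil>"
    have up: "enn2real (gauss_theta q t) \<le> t powr (-\<kappa>) * (1 + K M * t ^ M)"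
      using hi[OF t, of M] K[of M] t by (intro enn2real_leI) (auto simp: ennreal_mult)
    have low: "t powr (-\<kappa>) * (1 - K M * t ^ M) \<le> enn2real (gauss_theta q t)"
    proof (cases "1 - K M * t ^ M \<ge> 0")
      case True
      have "enn2real (ennreal (t powr (-\<kappa>)) * ennreal (1 - K M * t ^ M)) \<le> enn2real (gauss_theta q t)"
        using lo[OF t, of M] fin[OF t(1)] by (intro enn2real_mono) auto
      then show ?thesis using True by (simp add: enn2real_mult)
    next
      case False
      then have "t powr (-\<kappa>) * (1 - K M * t ^ M) \<le> 0" by (intro mult_nonneg_nonpos) auto
      then show ?thesis using ge1[OF t(1)] by simp
    qed
    have "t powr (-\<kappa>) * t ^ M \<le> t ^ N"
    proof -
      have "t powr (-\<kappa>) * t ^ M = t ^ N * (t powr (-\<kappa>) * t powr (real (nat \<lceil>\<kappa>\<rceil>)))"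
        using t by (simp add: M_def power_add powr_realpow)
      also have "t powr (-\<kappa>) * t powr (real (nat \<lceil>\<kappa>\<rceil>)) = t powr (real (nat \<lceil>\<kappa>\<rceil>) - \<kappa>)"
        using t by (simp add: powr_add[symmetric])
      also have "\<dots> \<le> t powr 0"
        using t \<kappa> by (intro powr_mono') auto
      finally show ?thesis using t by simp
    qed
    then have "K M * (t powr (-\<kappa>) * t ^ M) \<le> K M * t ^ N" using K by (intro mult_left_mono) auto
    also have "\<dots> \<le> theta_const \<kappa> \<delta> K N * t ^ N"
      unfolding theta_const_def M_def[symmetric] using C0[of N] t by (intro mult_right_mono) auto
    finally show "\<bar>enn2real (gauss_theta q t) - t powr (-\<kappa>)\<bar> \<le> theta_const \<kappa> \<delta> K N * t ^ N"
      using up low by (simp add: algebra_simps abs_le_iff)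
  qed
qed

text \<open>
  The squared norm of the row \<open>(a, b, c, d) \<eta>(n) diag(y)\<close>. The four coordinates are listed in the order
  1, 2, 4, 3: then \<open>b\<close>, \<open>d\<close> and \<open>c\<close> appear for the first time in the second, third and fourth summand,
  each as an integer shift.
\<close>
fun row_form :: "real \<Rightarrow> real \<Rightarrow> real \<times> real \<times> real \<times> real \<Rightarrow> int4 \<Rightarrow> real" where
  "row_form y1 y2 (n1, n2, n4, n5) (a, b, c, d) =
     (y1 * of_int a)\<^sup>2 + (y2 * (of_int a * n1 + of_int b))\<^sup>2
     + (1 / y2 * (of_int a * (n1 * n5 + n4) + of_int b * n5 + of_int d))\<^sup>2
     + (1 / y1 * (of_int a * n2 + of_int b * n4 - of_int d * n1 + of_int c))\<^sup>2"

lemma norm_row_eq_row_form: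
  assumes "k \<in> K4"
  shows "(norm (rvec v v* (eta n ** diag4 y1 y2 ** k)))\<^sup>2 = row_form y1 y2 n v"
proof -
  define T where "T = eta n ** diag4 y1 y2"
  have kk: "(x v* k) \<bullet> (x v* k) = x \<bullet> x" for x
  proof -
    have t: "x v* k = transpose k *v x" by (rule transpose_matrix_vector[symmetric])
    have "(x v* k) \<bullet> (x v* k) = x \<bullet> (k *v (transpose k *v x))"
      by (subst dot_lmul_matrix) (simp only: t)
    also have "\<dots> = x \<bullet> x" by (simp only: matrix_vector_mul_assoc K4_orthogonal[OF assms] matrix_vector_mul_lid)
    finally show ?thesis .
  qed
  have "rvec v v* (T ** k) = (rvec v v* T) v* k" by (simp add: vector_matrix_mul_assoc)
  then have "(norm (rvec v v* (T ** k)))\<^sup>2 = (rvec v v* T) \<bullet> (rvec v v* T)"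
    by (simp add: power2_norm_eq_inner kk)
  also have "\<dots> = row_form y1 y2 n v"
    by (cases n; cases v) (simp add: T_def inner_vec_def sum_4 vector_matrix_mult_def matrix_matrix_mult_def diag4_def
         power2_eq_square divide_inverse algebra_simps)
  finally show ?thesis by (simp add: T_def)
qed

lemma nn_integral_int4:
  "(\<integral>\<^sup>+v. f v \<partial>count_space (UNIV :: int4 set)) =
   (\<integral>\<^sup>+a. \<integral>\<^sup>+b. \<integral>\<^sup>+d. \<integral>\<^sup>+c. f (a, b, c, d) \<partial>count_space UNIV \<partial>count_space UNIV \<partial>count_space UNIV \<partial>count_space UNIV)"
proof -
  have "(\<integral>\<^sup>+q. f (a, b, q) \<partial>count_space UNIV) = (\<integral>\<^sup>+d. \<integral>\<^sup>+c. f (a, b, c, d) \<partial>count_space UNIV \<partial>count_space UNIV)" for a b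
    by (rule nn_integral_snd_count_space[of "\<lambda>q. f (a, b, q)", symmetric])
  moreover have "(\<integral>\<^sup>+p. f (a, p) \<partial>count_space UNIV) = (\<integral>\<^sup>+b. \<integral>\<^sup>+q. f (a, b, q) \<partial>count_space UNIV \<partial>count_space UNIV)" for a
    by (rule nn_integral_fst_count_space[of "\<lambda>p. f (a, p)", symmetric])
  moreover have "(\<integral>\<^sup>+v. f v \<partial>count_space UNIV) = (\<integral>\<^sup>+a. \<integral>\<^sup>+p. f (a, p) \<partial>count_space UNIV \<partial>count_space UNIV)"
    by (rule nn_integral_fst_count_space[symmetric])
  ultimately show ?thesis by (simp only:)
qed

text \<open>
  The sum over \<open>c\<close> and \<open>d\<close> of the Gaussians in the last two coordinates, for fixed \<open>a\<close> and \<open>b\<close>.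
\<close>
definition fiber_sum3 :: "real \<Rightarrow> real \<Rightarrow> real \<Rightarrow> real \<times> real \<times> real \<times> real \<Rightarrow> int \<Rightarrow> int \<Rightarrow> ennreal" where
  "fiber_sum3 y1 y2 t = (\<lambda>(n1, n2, n4, n5) a b. \<integral>\<^sup>+d. gauss t (1 / y2 * (of_int a * (n1 * n5 + n4) + of_int b * n5 + of_int d)) *
        gauss_sum (1 / y1) t (of_int a * n2 + of_int b * n4 - of_int d * n1) \<partial>count_space UNIV)"

text \<open>
  The sum over \<open>b\<close>, \<open>c\<close> and \<open>d\<close> of the Gaussians in the last three coordinates, for fixed \<open>a\<close>.
\<close>
definition fiber_sum2 :: "real \<Rightarrow> real \<Rightarrow> real \<Rightarrow> real \<times> real \<times> real \<times> real \<Rightarrow> int \<Rightarrow> ennreal" where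
  "fiber_sum2 y1 y2 t n a = (\<integral>\<^sup>+b. gauss t (y2 * (of_int a * fst n + of_int b)) * fiber_sum3 y1 y2 t n a b \<partial>count_space UNIV)"

lemma gauss_theta_row_form:
  "gauss_theta (row_form y1 y2 n) t = (\<integral>\<^sup>+a. gauss t (y1 * of_int a) * fiber_sum2 y1 y2 t n a \<partial>count_space UNIV)"
proof -
  obtain n1 n2 n4 n5 where n: "n = (n1, n2, n4, n5)" by (cases n)
  have e: "ennreal (exp (- pi * t * row_form y1 y2 (n1, n2, n4, n5) (a, b, c, d))) =
    gauss t (y1 * of_int a) * (gauss t (y2 * (of_int a * n1 + of_int b)) *
      (gauss t (1 / y2 * (of_int a * (n1 * n5 + n4) + of_int b * n5 + of_int d)) *
        gauss t (1 / y1 * (of_int a * n2 + of_int b * n4 - of_int d * n1 + of_int c))))" for a b c d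
  proof -
    have s: "- pi * t * (w + x + y + z) = - pi * t * w + (- pi * t * x + (- pi * t * y + - pi * t * z))" for w x y z
      by (simp add: algebra_simps)
    show ?thesis unfolding gauss_def row_form.simps s exp_add by (simp add: ennreal_mult)
  qed
  show ?thesis
    unfolding gauss_theta_def nn_integral_int4 n e fiber_sum2_def fiber_sum3_def gauss_sum_def
    by (simp add: nn_integral_cmult)
qed

text \<open>
  Take the first nonzero entry of \<open>v\<close> in the order \<open>a, b, d, c\<close>. One of the coordinates is a multiple of
  this entry alone, with a factor that depends on \<open>y1\<close> or \<open>y2\<close> only; hence the bound is uniform in \<open>n\<close>.
\<close>
lemma row_form_gap:
  assumes y: "y1 > 0" "y2 > 0" and v: "v \<noteq> (0, 0, 0, 0)"
  shows "row_form y1 y2 n v \<ge> min (min (y1\<^sup>2) (y2\<^sup>2)) (min ((1 / y1)\<^sup>2) ((1 / y2)\<^sup>2))"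
proof -
  obtain n1 n2 n4 n5 where n: "n = (n1, n2, n4, n5)" by (cases n)
  obtain a b c d where abcd: "v = (a, b, c, d)" by (cases v)
  have sq: "(l * of_int k)\<^sup>2 \<ge> l\<^sup>2" if "k \<noteq> 0" for k :: int and l :: real
  proof -
    have "1 \<le> \<bar>k\<bar>" using that by linarith
    then have "1 \<le> (real_of_int k)\<^sup>2"
      by (metis of_int_1_le_iff of_int_power one_le_power power2_abs)
    then show ?thesis using mult_left_mono[of 1 "(real_of_int k)\<^sup>2" "l\<^sup>2"] by (simp add: power_mult_distrib)
  qed
  have g: "w\<^sup>2 \<le> w\<^sup>2 + x\<^sup>2 + y\<^sup>2 + z\<^sup>2" "x\<^sup>2 \<le> w\<^sup>2 + x\<^sup>2 + y\<^sup>2 + z\<^sup>2"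
    "y\<^sup>2 \<le> w\<^sup>2 + x\<^sup>2 + y\<^sup>2 + z\<^sup>2" "z\<^sup>2 \<le> w\<^sup>2 + x\<^sup>2 + y\<^sup>2 + z\<^sup>2" for w x y z :: real
    by simp_all
  have comp: "(y1 * of_int a)\<^sup>2 \<le> row_form y1 y2 n v" "(y2 * (of_int a * n1 + of_int b))\<^sup>2 \<le> row_form y1 y2 n v"
    "(1 / y2 * (of_int a * (n1 * n5 + n4) + of_int b * n5 + of_int d))\<^sup>2 \<le> row_form y1 y2 n v"
    "(1 / y1 * (of_int a * n2 + of_int b * n4 - of_int d * n1 + of_int c))\<^sup>2 \<le> row_form y1 y2 n v"
    unfolding n abcd row_form.simps by (rule g)+
  consider "a \<noteq> 0" | "a = 0" "b \<noteq> 0" | "a = 0" "b = 0" "d \<noteq> 0" | "a = 0" "b = 0" "d = 0" "c \<noteq> 0"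
    using v abcd by blast
  then have "y1\<^sup>2 \<le> row_form y1 y2 n v \<or> y2\<^sup>2 \<le> row_form y1 y2 n v \<or> (1 / y1)\<^sup>2 \<le> row_form y1 y2 n v \<or> (1 / y2)\<^sup>2 \<le> row_form y1 y2 n v"
  proof cases
    case 1
    from order_trans[OF sq[OF this] comp(1)] show ?thesis by blast
  next
    case 2
    have "(y2 * of_int b)\<^sup>2 \<le> row_form y1 y2 n v"
      using comp(2) unfolding 2(1) by (simp only: of_int_0 mult_zero_left add_0)
    from order_trans[OF sq[OF 2(2)] this] show ?thesis by blast
  next
    case 3
    have "(1 / y2 * of_int d)\<^sup>2 \<le> row_form y1 y2 n v"
      using comp(3) unfolding 3(1,2) by (simp only: of_int_0 mult_zero_left add_0)
    from order_trans[OF sq[OF 3(3)] this] show ?thesis by blast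
  next
    case 4
    have "(1 / y1 * of_int c)\<^sup>2 \<le> row_form y1 y2 n v"
      using comp(4) unfolding 4(1-3) by (simp only: of_int_0 mult_zero_left add_0 diff_0_right)
    from order_trans[OF sq[OF 4(4)] this] show ?thesis by blast
  qed
  then show ?thesis unfolding min_le_iff_disj by blast
qed

lemma nn_integral_sum_le:
  assumes "(\<integral>\<^sup>+k. g k \<partial>count_space UNIV) \<le> G" "\<And>k. F k \<le> B"
  shows "(\<integral>\<^sup>+k. g k * F k \<partial>count_space UNIV) \<le> G * (B :: ennreal)"
proof -
  have "(\<integral>\<^sup>+k. g k * F k \<partial>count_space UNIV) \<le> (\<integral>\<^sup>+k. g k * B \<partial>count_space UNIV)"
    by (intro nn_integral_mono mult_left_mono assms) auto
  also have "\<dots> = (\<integral>\<^sup>+k. g k \<partial>count_space UNIV) * B" by (rule nn_integral_multc) simp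
  also have "\<dots> \<le> G * B" by (intro mult_right_mono assms) auto
  finally show ?thesis .
qed

lemma nn_integral_sum_ge:
  assumes "G \<le> (\<integral>\<^sup>+k. g k \<partial>count_space UNIV)" "\<And>k. B \<le> F k"
  shows "G * (B :: ennreal) \<le> (\<integral>\<^sup>+k. g k * F k \<partial>count_space UNIV)"
proof -
  have "G * B \<le> (\<integral>\<^sup>+k. g k \<partial>count_space UNIV) * B" by (intro mult_right_mono assms) auto
  also have "\<dots> = (\<integral>\<^sup>+k. g k * B \<partial>count_space UNIV)" by (rule nn_integral_multc[symmetric]) simp
  also have "\<dots> \<le> (\<integral>\<^sup>+k. g k * F k \<partial>count_space UNIV)"
    by (intro nn_integral_mono mult_left_mono assms) auto
  finally show ?thesis .
qed

text \<open>
  Summing over \<open>c\<close>, \<open>d\<close>, \<open>b\<close>, \<open>a\<close> in this order, each sum is a shifted Gaussian sum in one variable whose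
  bounds do not depend on the variables that are still fixed.
\<close>
lemma gauss_theta_row_form_sandwich:
  assumes lo: "\<And>l b. l \<in> {y1, y2, 1 / y1, 1 / y2} \<Longrightarrow> gauss_mass l t * L \<le> gauss_sum l t b"
    and hi: "\<And>l b. l \<in> {y1, y2, 1 / y1, 1 / y2} \<Longrightarrow> gauss_sum l t b \<le> gauss_mass l t * U"
  shows "(gauss_mass y1 t * L) * ((gauss_mass y2 t * L) * ((gauss_mass (1 / y2) t * L) * (gauss_mass (1 / y1) t * L))) \<le> gauss_theta (row_form y1 y2 n) t"
    and "gauss_theta (row_form y1 y2 n) t \<le> (gauss_mass y1 t * U) * ((gauss_mass y2 t * U) * ((gauss_mass (1 / y2) t * U) * (gauss_mass (1 / y1) t * U)))"
proof -
  obtain n1 n2 n4 n5 where n: "n = (n1, n2, n4, n5)" by (cases n)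
  have g: "(\<integral>\<^sup>+k. gauss t (l * (b + of_int k)) \<partial>count_space UNIV) = gauss_sum l t b" for l b
    by (simp add: gauss_sum_def)
  have g0: "(\<integral>\<^sup>+k. gauss t (l * of_int k) \<partial>count_space UNIV) = gauss_sum l t 0" for l
    by (simp add: gauss_sum_def)
  show "(gauss_mass y1 t * L) * ((gauss_mass y2 t * L) * ((gauss_mass (1 / y2) t * L) * (gauss_mass (1 / y1) t * L))) \<le> gauss_theta (row_form y1 y2 n) t"
    unfolding gauss_theta_row_form fiber_sum2_def fiber_sum3_def n prod.case fst_conv
    by (rule nn_integral_sum_ge, unfold g0, rule lo, simp,
       rule nn_integral_sum_ge, unfold g, rule lo, simp, rule nn_integral_sum_ge, unfold g, rule lo, simp, rule lo, simp)
  show "gauss_theta (row_form y1 y2 n) t \<le> (gauss_mass y1 t * U) * ((gauss_mass y2 t * U) * ((gauss_mass (1 / y2) t * U) * (gauss_mass (1 / y1) t * U)))"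
    unfolding gauss_theta_row_form fiber_sum2_def fiber_sum3_def n prod.case fst_conv
    by (rule nn_integral_sum_le, unfold g0, rule hi, simp,
       rule nn_integral_sum_le, unfold g, rule hi, simp, rule nn_integral_sum_le, unfold g, rule hi, simp, rule hi, simp)
qed

lemma one_plus_power4_le:
  fixes e :: real
  assumes "0 \<le> e" "e \<le> C"
  shows "(1 + e) ^ 4 \<le> 1 + (4 + 6 * C + 4 * C ^ 2 + C ^ 3) * e"
proof -
  have "(1 + e) ^ 4 = 1 + (4 + 6 * e + 4 * e ^ 2 + e ^ 3) * e"
    by (simp add: power2_eq_square power3_eq_cube power4_eq_xxxx algebra_simps)
  also have "\<dots> \<le> 1 + (4 + 6 * C + 4 * C ^ 2 + C ^ 3) * e"
    using assms by (intro add_left_mono mult_right_mono add_mono power_mono mult_left_mono) auto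
  finally show ?thesis .
qed

text \<open>
  The four masses multiply to \<open>t^(-2)\<close>, since the scaling factors \<open>y1, y2, 1/y2, 1/y1\<close> have product 1, and the
  four relative errors multiply to \<open>(1 \<plusminus> C t\<^sup>N)\<^sup>4\<close>.
\<close>
lemma lattice_theta_small:
  assumes y: "y1 > 0" "y2 > 0"
  shows "\<exists>K\<ge>0. \<forall>n t. 0 < t \<longrightarrow> t \<le> 1 \<longrightarrow>
    ennreal (t powr (-2)) * ennreal (1 - K * t ^ N) \<le> gauss_theta (row_form y1 y2 n) t \<and>
    gauss_theta (row_form y1 y2 n) t \<le> ennreal (t powr (-2)) * ennreal (1 + K * t ^ N)"
proof -
  define \<Lambda> where "\<Lambda> = {y1, y2, 1 / y1, 1 / y2}"
  have \<Lambda>_pos: "l > 0" if "l \<in> \<Lambda>" for l using that y by (auto simp: \<Lambda>_def)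
  obtain c where c: "\<And>l. l \<in> \<Lambda> \<Longrightarrow> c l \<ge> 0"
    "\<And>l t b. l \<in> \<Lambda> \<Longrightarrow> 0 < t \<Longrightarrow> t \<le> 1 \<Longrightarrow> gauss_mass l t * ennreal (1 - c l * t ^ N) \<le> gauss_sum l t b"
    "\<And>l t b. l \<in> \<Lambda> \<Longrightarrow> 0 < t \<Longrightarrow> t \<le> 1 \<Longrightarrow> gauss_sum l t b \<le> gauss_mass l t * ennreal (1 + c l * t ^ N)"
    using gauss_sum_bounds[OF \<Lambda>_pos, of _ N] by metis
  define C where "C = Max (c ` \<Lambda>)"
  have cC: "c l \<le> C" if "l \<in> \<Lambda>" for l using that by (auto simp: C_def \<Lambda>_def)
  have C0: "C \<ge> 0" using c(1)[of y1] cC[of y1] by (simp add: \<Lambda>_def)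
  define K where "K = 4 + 6 * C + 4 * C ^ 2 + C ^ 3"
  have K4: "K \<ge> 4" using C0 by (simp add: K_def)
  have prod: "(gauss_mass y1 t * X) * ((gauss_mass y2 t * X) * ((gauss_mass (1 / y2) t * X) * (gauss_mass (1 / y1) t * X))) = ennreal (t powr (-2)) * X ^ 4"
    if "t > 0" for t X
  proof -
    have "gauss_mass y1 t * gauss_mass y2 t * gauss_mass (1 / y2) t * gauss_mass (1 / y1) t = ennreal (t powr (-2))"
    proof -
      have "1 / (y1 * sqrt t) * (1 / (y2 * sqrt t)) * (1 / (1 / y2 * sqrt t)) * (1 / (1 / y1 * sqrt t)) = 1 / (sqrt t * sqrt t) * (1 / (sqrt t * sqrt t))"
        using y that by (simp add: field_simps)
      also have "\<dots> = t powr (-2)" using that by (simp add: powr_minus divide_inverse powr_numeral power2_eq_square)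
      finally show ?thesis using y that unfolding gauss_mass_def by (simp add: ennreal_mult[symmetric])
    qed
    then show ?thesis by (simp add: power4_eq_xxxx mult_ac)
  qed
  show ?thesis
  proof (intro exI[of _ "K * C"] conjI allI impI)
    fix n and t :: real assume t: "0 < t" "t \<le> 1"
    \<comment> \<open>The same relative error serves all four nested sums.\<close>
    define e where "e = C * t ^ N"
    have e: "0 \<le> e" "e \<le> C" using C0 t by (auto simp: e_def mult_left_le power_le_one)
    have lo: "gauss_mass l t * ennreal (1 - e) \<le> gauss_sum l t b" if "l \<in> {y1, y2, 1 / y1, 1 / y2}" for l b
    proof -
      have "gauss_mass l t * ennreal (1 - e) \<le> gauss_mass l t * ennreal (1 - c l * t ^ N)"
        unfolding e_def using cC[of l] t that by (intro mult_left_mono ennreal_leI) (auto simp: \<Lambda>_def mult_right_mono)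
      also have "\<dots> \<le> gauss_sum l t b" using c(2)[of l t b] that t by (simp add: \<Lambda>_def)
      finally show ?thesis .
    qed
    have hi: "gauss_sum l t b \<le> gauss_mass l t * ennreal (1 + e)" if "l \<in> {y1, y2, 1 / y1, 1 / y2}" for l b
    proof -
      have "gauss_sum l t b \<le> gauss_mass l t * ennreal (1 + c l * t ^ N)" using c(3)[of l t b] that t by (simp add: \<Lambda>_def)
      also have "\<dots> \<le> gauss_mass l t * ennreal (1 + e)"
        unfolding e_def using cC[of l] t that by (intro mult_left_mono ennreal_leI) (auto simp: \<Lambda>_def mult_right_mono)
      finally show ?thesis .
    qed
    have sw: "ennreal (t powr (-2)) * ennreal (1 - e) ^ 4 \<le> gauss_theta (row_form y1 y2 n) t"
      "gauss_theta (row_form y1 y2 n) t \<le> ennreal (t powr (-2)) * ennreal (1 + e) ^ 4"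
      unfolding prod[OF t(1), symmetric] by (rule gauss_theta_row_form_sandwich[OF lo hi]; assumption)+
    show "gauss_theta (row_form y1 y2 n) t \<le> ennreal (t powr (-2)) * ennreal (1 + K * C * t ^ N)"
    proof -
      have "ennreal (1 + e) ^ 4 = ennreal ((1 + e) ^ 4)" by (rule ennreal_power) (use e in simp)
      also have "\<dots> \<le> ennreal (1 + K * C * t ^ N)"
        using one_plus_power4_le[OF e] by (intro ennreal_leI) (simp add: K_def e_def mult.assoc)
      finally have "ennreal (1 + e) ^ 4 \<le> ennreal (1 + K * C * t ^ N)" .
      then show ?thesis by (intro order_trans[OF sw(2)] mult_left_mono) auto
    qed
    show "ennreal (t powr (-2)) * ennreal (1 - K * C * t ^ N) \<le> gauss_theta (row_form y1 y2 n) t"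
    proof -
      have Ke: "4 * e \<le> K * C * t ^ N" using K4 e(1) by (simp add: e_def mult.assoc mult_right_mono)
      have "ennreal (1 - K * C * t ^ N) \<le> ennreal (1 - e) ^ 4"
      proof (cases "e \<le> 1")
        case True
        have "1 + 4 * (- e) \<le> (1 + (- e)) ^ 4" using Bernoulli_inequality[of "- e" 4] True by simp
        then have "1 - K * C * t ^ N \<le> (1 - e) ^ 4" using Ke by simp
        then have "ennreal (1 - K * C * t ^ N) \<le> ennreal ((1 - e) ^ 4)" by (rule ennreal_leI)
        also have "\<dots> = ennreal (1 - e) ^ 4" by (rule ennreal_power[symmetric]) (use True in simp)
        finally show ?thesis .
      next
        case False
        then have "1 - K * C * t ^ N \<le> 0" using Ke by simp
        then show ?thesis by (simp add: ennreal_neg)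
      qed
      then show ?thesis by (intro order_trans[OF _ sw(1)] mult_left_mono) auto
    qed
  qed (use C0 K4 in auto)
qed

definition lattice_theta :: "real \<Rightarrow> real \<Rightarrow> real \<times> real \<times> real \<times> real \<Rightarrow> real \<Rightarrow> real" where
  "lattice_theta y1 y2 n t = enn2real (gauss_theta (row_form y1 y2 n) t)"

lemma lattice_theta_measurable [measurable]: "lattice_theta y1 y2 n \<in> borel_measurable borel"
  unfolding lattice_theta_def by measurable

lemma lattice_theta_uniform:
  assumes y: "y1 > 0" "y2 > 0"
  shows "\<exists>C. \<forall>n. theta_bounds 2 C (lattice_theta y1 y2 n)"
    and "\<And>n t. t > 0 \<Longrightarrow> gauss_theta (row_form y1 y2 n) t < \<infinity>"
proof -
  define \<delta> where "\<delta> = min (min (y1\<^sup>2) (y2\<^sup>2)) (min ((1 / y1)\<^sup>2) ((1 / y2)\<^sup>2))"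
  have \<delta>: "\<delta> > 0" using y by (simp add: \<delta>_def)
  obtain K where K: "\<And>N. K N \<ge> 0"
    "\<And>N n t. 0 < t \<Longrightarrow> t \<le> 1 \<Longrightarrow> ennreal (t powr (-2)) * ennreal (1 - K N * t ^ N) \<le> gauss_theta (row_form y1 y2 n) t"
    "\<And>N n t. 0 < t \<Longrightarrow> t \<le> 1 \<Longrightarrow> gauss_theta (row_form y1 y2 n) t \<le> ennreal (t powr (-2)) * ennreal (1 + K N * t ^ N)"
    using lattice_theta_small[OF y] by metis
  have q0: "row_form y1 y2 n (0, 0, 0, 0) = 0" for n by (cases n) simp
  note B = gauss_theta_bounds[of \<delta> 2 "row_form y1 y2 n" "(0, 0, 0, 0)" K for n, OF \<delta> _ q0 row_form_gap[OF y, folded \<delta>_def] K]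
  show "\<exists>C. \<forall>n. theta_bounds 2 C (lattice_theta y1 y2 n)"
    unfolding lattice_theta_def[abs_def] by (intro exI allI) (rule B(1); simp)
  show "gauss_theta (row_form y1 y2 n) t < \<infinity>" if "t > 0" for n t
    by (rule B(2)) (simp_all add: that)
qed

section \<open>Unfolding the mean of the theta function\<close>

text \<open>
  The uniform distribution on the unit interval, on all Borel sets of the line so that measurability
  is that of the line.
\<close>
definition unif :: "real measure" where
  "unif = density lborel (indicator {0..<1})"

lemma sets_unif [measurable_cong, simp]: "sets unif = sets borel"
  by (simp add: unif_def)

lemma nn_integral_unif:
  assumes [measurable]: "f \<in> borel_measurable borel"
  shows "(\<integral>\<^sup>+x. f x \<partial>unif) = (\<integral>\<^sup>+x. f x * indicator {0..<1} x \<partial>lborel)"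
  unfolding unif_def by (subst nn_integral_density) (auto simp: mult.commute)

lemma prob_space_unif: "prob_space unif"
  by (rule prob_spaceI) (simp add: unif_def emeasure_density)

lemma emeasure_space_unif [simp]: "emeasure unif (space unif) = 1"
  by (rule prob_space.emeasure_space_1[OF prob_space_unif])

lemma nn_integral_unif_const: "(\<integral>\<^sup>+x. c \<partial>unif) = c"
  by simp

lemma sigma_finite_unif: "sigma_finite_measure unif"
proof -
  interpret prob_space unif by (rule prob_space_unif)
  show ?thesis by unfold_locales
qed

lemma nn_integral_unif_sum:
  fixes F :: "'k::countable \<Rightarrow> real \<Rightarrow> ennreal"
  assumes [measurable]: "\<And>k. F k \<in> borel_measurable borel"
  shows "(\<integral>\<^sup>+x. (\<integral>\<^sup>+k. c k * F k x \<partial>count_space UNIV) \<partial>unif) = (\<integral>\<^sup>+k. c k * (\<integral>\<^sup>+x. F k x \<partial>unif) \<partial>count_space UNIV)"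
  by (subst nn_integral_count_space_swap[symmetric]) (auto intro: sigma_finite_unif simp: nn_integral_cmult)

lemma gauss_sum_unif:
  assumes "m \<noteq> 0" "l > 0" "t > 0"
  shows "(\<integral>\<^sup>+x. gauss_sum l t (of_int m * x + b) \<partial>unif) = gauss_mass l t"
  using gauss_sum_unfold[OF assms, of b] by (simp add: nn_integral_unif)

text \<open>
  The mean over the unit box. The order of integration is chosen so that every variable is integrated
  before those that occur in its shift: \<open>x2\<close> translates the third coordinate of a row, \<open>x4\<close> the fourth, or
  the third if \<open>a = 0\<close>, and so on.
\<close>
definition box_mean :: "(real \<times> real \<times> real \<times> real \<Rightarrow> ennreal) \<Rightarrow> ennreal" where
  "box_mean f = (\<integral>\<^sup>+x1. \<integral>\<^sup>+x5. \<integral>\<^sup>+x4. \<integral>\<^sup>+x2. f (x1, x2, x4, x5) \<partial>unif \<partial>unif \<partial>unif \<partial>unif)"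

lemma nn_integral_lborel_pair:
  fixes f :: "'a::euclidean_space \<times> 'b::euclidean_space \<Rightarrow> ennreal"
  assumes "f \<in> borel_measurable borel"
  shows "(\<integral>\<^sup>+z. f z \<partial>lborel) = (\<integral>\<^sup>+x. \<integral>\<^sup>+y. f (x, y) \<partial>lborel \<partial>lborel)"
proof -
  have "f \<in> borel_measurable (lborel \<Otimes>\<^sub>M lborel)" using assms by (simp add: lborel_prod)
  from lborel.nn_integral_fst[OF this] show ?thesis by (simp add: lborel_prod)
qed

lemma nn_integral_unif_swap:
  assumes [measurable]: "case_prod f \<in> borel_measurable borel"
  shows "(\<integral>\<^sup>+x. \<integral>\<^sup>+y. f x y \<partial>unif \<partial>unif) = (\<integral>\<^sup>+y. \<integral>\<^sup>+x. f x y \<partial>unif \<partial>unif)"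
proof -
  interpret u: sigma_finite_measure unif by (rule sigma_finite_unif)
  interpret pair_sigma_finite unif unif ..
  have "sets (unif \<Otimes>\<^sub>M unif) = sets (borel :: (real \<times> real) measure)"
    by (simp add: borel_prod[symmetric] cong: sets_pair_measure_cong)
  then have "case_prod f \<in> borel_measurable (unif \<Otimes>\<^sub>M unif)"
    using assms by (simp cong: measurable_cong_sets)
  from Fubini'[OF this] show ?thesis by simp
qed

lemma borel_measurable_nn_integral_unif [measurable (raw)]:
  assumes "case_prod f \<in> borel_measurable (M \<Otimes>\<^sub>M borel)"
  shows "(\<lambda>x. \<integral>\<^sup>+y. f x y \<partial>unif) \<in> borel_measurable M"
proof -
  interpret u: sigma_finite_measure unif by (rule sigma_finite_unif)
  have "case_prod f \<in> borel_measurable (M \<Otimes>\<^sub>M unif)"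
    using assms by (simp cong: measurable_cong_sets sets_pair_measure_cong)
  then show ?thesis by (rule u.borel_measurable_nn_integral)
qed

lemma nn_integral_unit_box:
  assumes f[measurable]: "f \<in> borel_measurable borel"
  shows "(\<integral>\<^sup>+n. f n * indicator unit_box n \<partial>lborel) = box_mean f"
proof -
  have box[measurable]: "unit_box \<in> sets borel"
    unfolding unit_box_def by (simp add: borel_prod[symmetric])
  let ?i = "indicator {0..<1} :: real \<Rightarrow> ennreal"
  have ind: "(indicator unit_box (x1, x2, x4, x5) :: ennreal) = ?i x1 * (?i x2 * (?i x4 * ?i x5))" for x1 x2 x4 x5
    by (auto simp: unit_box_def indicator_def)
  have [measurable]: "f \<in> borel_measurable (borel \<Otimes>\<^sub>M borel \<Otimes>\<^sub>M borel \<Otimes>\<^sub>M borel)"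
    using f by (simp add: borel_prod)
  have m1: "(\<lambda>p. f (x1, p) * indicator unit_box (x1, p)) \<in> borel_measurable borel" for x1 by measurable
  have m2: "(\<lambda>p. f (x1, x2, p) * indicator unit_box (x1, x2, p)) \<in> borel_measurable borel" for x1 x2 by measurable
  have "(\<integral>\<^sup>+n. f n * indicator unit_box n \<partial>lborel) =
    (\<integral>\<^sup>+x1. \<integral>\<^sup>+x2. \<integral>\<^sup>+x4. \<integral>\<^sup>+x5. f (x1, x2, x4, x5) * indicator unit_box (x1, x2, x4, x5) \<partial>lborel \<partial>lborel \<partial>lborel \<partial>lborel)"
  proof -
    have "(\<integral>\<^sup>+n. f n * indicator unit_box n \<partial>lborel) = (\<integral>\<^sup>+x1. \<integral>\<^sup>+p. f (x1, p) * indicator unit_box (x1, p) \<partial>lborel \<partial>lborel)"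
      by (rule nn_integral_lborel_pair) measurable
    moreover have "(\<integral>\<^sup>+p. f (x1, p) * indicator unit_box (x1, p) \<partial>lborel) = (\<integral>\<^sup>+x2. \<integral>\<^sup>+p. f (x1, x2, p) * indicator unit_box (x1, x2, p) \<partial>lborel \<partial>lborel)" for x1
      by (rule nn_integral_lborel_pair[OF m1])
    moreover have "(\<integral>\<^sup>+p. f (x1, x2, p) * indicator unit_box (x1, x2, p) \<partial>lborel) = (\<integral>\<^sup>+x4. \<integral>\<^sup>+x5. f (x1, x2, x4, x5) * indicator unit_box (x1, x2, x4, x5) \<partial>lborel \<partial>lborel)" for x1 x2
      by (rule nn_integral_lborel_pair[OF m2])
    ultimately show ?thesis by (simp only:)
  qed
  also have "\<dots> = (\<integral>\<^sup>+x1. (\<integral>\<^sup>+x2. (\<integral>\<^sup>+x4. (\<integral>\<^sup>+x5. f (x1, x2, x4, x5) * ?i x5 \<partial>lborel) * ?i x4 \<partial>lborel) * ?i x2 \<partial>lborel) * ?i x1 \<partial>lborel)"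
    unfolding ind by (simp add: nn_integral_cmult mult_ac)
  also have "\<dots> = (\<integral>\<^sup>+x1. \<integral>\<^sup>+x2. \<integral>\<^sup>+x4. \<integral>\<^sup>+x5. f (x1, x2, x4, x5) \<partial>unif \<partial>unif \<partial>unif \<partial>unif)"
    by (simp add: nn_integral_unif)
  also have "\<dots> = (\<integral>\<^sup>+x1. \<integral>\<^sup>+x2. \<integral>\<^sup>+x5. \<integral>\<^sup>+x4. f (x1, x2, x4, x5) \<partial>unif \<partial>unif \<partial>unif \<partial>unif)"
    by (intro nn_integral_cong nn_integral_unif_swap) (simp add: borel_prod[symmetric])
  also have "\<dots> = (\<integral>\<^sup>+x1. \<integral>\<^sup>+x5. \<integral>\<^sup>+x2. \<integral>\<^sup>+x4. f (x1, x2, x4, x5) \<partial>unif \<partial>unif \<partial>unif \<partial>unif)"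
    by (intro nn_integral_cong nn_integral_unif_swap) (simp add: borel_prod[symmetric])
  also have "\<dots> = box_mean f"
    unfolding box_mean_def
    by (intro nn_integral_cong nn_integral_unif_swap) (simp add: borel_prod[symmetric])
  finally show ?thesis .
qed

lemma box_mean_sum:
  fixes F :: "'k::countable \<Rightarrow> real \<times> real \<times> real \<times> real \<Rightarrow> ennreal"
  assumes F: "\<And>k. F k \<in> borel_measurable borel"
  shows "box_mean (\<lambda>x. \<integral>\<^sup>+k. c k * F k x \<partial>count_space UNIV) = (\<integral>\<^sup>+k. c k * box_mean (F k) \<partial>count_space UNIV)"
proof -
  have [measurable]: "F k \<in> borel_measurable (borel \<Otimes>\<^sub>M borel \<Otimes>\<^sub>M borel \<Otimes>\<^sub>M borel)" for k
    using F by (simp add: borel_prod)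
  have 2: "(\<integral>\<^sup>+x2. \<integral>\<^sup>+k. c k * F k (x1, x2, x4, x5) \<partial>count_space UNIV \<partial>unif) =
      (\<integral>\<^sup>+k. c k * (\<integral>\<^sup>+x2. F k (x1, x2, x4, x5) \<partial>unif) \<partial>count_space UNIV)" for x1 x4 x5
    by (rule nn_integral_unif_sum) measurable
  have 4: "(\<integral>\<^sup>+x4. \<integral>\<^sup>+k. c k * (\<integral>\<^sup>+x2. F k (x1, x2, x4, x5) \<partial>unif) \<partial>count_space UNIV \<partial>unif) =
      (\<integral>\<^sup>+k. c k * (\<integral>\<^sup>+x4. \<integral>\<^sup>+x2. F k (x1, x2, x4, x5) \<partial>unif \<partial>unif) \<partial>count_space UNIV)" for x1 x5
    by (rule nn_integral_unif_sum) measurable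
  have 5: "(\<integral>\<^sup>+x5. \<integral>\<^sup>+k. c k * (\<integral>\<^sup>+x4. \<integral>\<^sup>+x2. F k (x1, x2, x4, x5) \<partial>unif \<partial>unif) \<partial>count_space UNIV \<partial>unif) =
      (\<integral>\<^sup>+k. c k * (\<integral>\<^sup>+x5. \<integral>\<^sup>+x4. \<integral>\<^sup>+x2. F k (x1, x2, x4, x5) \<partial>unif \<partial>unif \<partial>unif) \<partial>count_space UNIV)" for x1
    by (rule nn_integral_unif_sum) measurable
  show ?thesis unfolding box_mean_def 2 4 5
    by (rule nn_integral_unif_sum) measurable
qed

lemma box_mean_const [simp]: "box_mean (\<lambda>x. c) = c"
  by (simp add: box_mean_def)

text \<open>
  The multiplication of \<open>N\<^sub>0(\<real>)\<close> in coordinates. The base point \<open>n\<close> of the Iwasawa decomposition of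
  \<open>g\<close> only shifts the integration variables by quantities that the unfolding ignores.
\<close>
fun eta_prod :: "real \<times> real \<times> real \<times> real \<Rightarrow> real \<times> real \<times> real \<times> real \<Rightarrow> real \<times> real \<times> real \<times> real" where
  "eta_prod (m1, m2, m4, m5) (n1, n2, n4, n5) =
     (m1 + n1, n2 + m1 * n4 + m2 - n1 * (m1 * m5 + m4), n4 + m4 - n1 * m5, n5 + m5)"

lemma eta_eta_prod: "eta m ** eta n = eta (eta_prod m n)"
  by (cases m; cases n) (simp only: eta_mult eta_prod.simps)

lemma eta_prod_measurable: "(\<lambda>x. eta_prod x n) \<in> borel_measurable borel"
proof -
  obtain n1 n2 n4 n5 where n: "n = (n1, n2, n4, n5)" by (cases n)
  have "(\<lambda>x. eta_prod x n) = (\<lambda>x. (fst x + n1, n2 + fst x * n4 + fst (snd x) - n1 * (fst x * snd (snd (snd x)) + fst (snd (snd x))),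
      n4 + fst (snd (snd x)) - n1 * snd (snd (snd x)), n5 + snd (snd (snd x))))"
    by (auto simp: n fun_eq_iff)
  also have "\<dots> \<in> borel_measurable borel"
    by (intro borel_measurable_continuous_onI continuous_intros)
  finally show ?thesis .
qed

lemma fiber_sum3_measurable: "(\<lambda>n. fiber_sum3 y1 y2 t n a b) \<in> borel_measurable borel"
proof -
  have "(\<lambda>n. fiber_sum3 y1 y2 t n a b) \<in> borel_measurable (borel \<Otimes>\<^sub>M borel \<Otimes>\<^sub>M borel \<Otimes>\<^sub>M borel)"
    unfolding fiber_sum3_def case_prod_beta by measurable
  then show ?thesis by (simp add: borel_prod)
qed

lemma fiber_sum2_measurable: "(\<lambda>n. fiber_sum2 y1 y2 t n a) \<in> borel_measurable borel"
proof -
  have [measurable]: "(\<lambda>n. fiber_sum3 y1 y2 t n a b) \<in> borel_measurable (borel \<Otimes>\<^sub>M borel \<Otimes>\<^sub>M borel \<Otimes>\<^sub>M borel)" for b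
    using fiber_sum3_measurable by (simp add: borel_prod)
  have "(\<lambda>n. fiber_sum2 y1 y2 t n a) \<in> borel_measurable (borel \<Otimes>\<^sub>M borel \<Otimes>\<^sub>M borel \<Otimes>\<^sub>M borel)"
    unfolding fiber_sum2_def by measurable
  then show ?thesis by (simp add: borel_prod)
qed

lemma gauss_sum_alt: "(\<integral>\<^sup>+k. gauss t (l * (b + of_int k)) * c \<partial>count_space UNIV) = gauss_sum l t b * c"
  unfolding gauss_sum_def by (rule nn_integral_multc) simp

definition gauss_sum_nz :: "real \<Rightarrow> real \<Rightarrow> ennreal" where
  "gauss_sum_nz l t = (\<integral>\<^sup>+k. gauss t (l * of_int k) \<partial>count_space (UNIV - {0}))"

lemma gauss_sum_nz_sum:
  assumes "\<And>k. k \<noteq> 0 \<Longrightarrow> F k = c"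
  shows "(\<integral>\<^sup>+k. gauss t (l * of_int k) * F k \<partial>count_space UNIV) = F 0 + gauss_sum_nz l t * c"
proof -
  have "(\<integral>\<^sup>+k. gauss t (l * of_int k) * F k \<partial>count_space (UNIV - {0})) = (\<integral>\<^sup>+k. gauss t (l * of_int k) * c \<partial>count_space (UNIV - {0}))"
    by (intro nn_integral_cong) (auto simp: assms)
  also have "\<dots> = gauss_sum_nz l t * c" unfolding gauss_sum_nz_def by (rule nn_integral_multc) simp
  finally show ?thesis by (subst nn_integral_count_space_remove[of _ 0]) simp
qed

context
  fixes y1 y2 t :: real and n :: "real \<times> real \<times> real \<times> real"
  assumes y: "y1 > 0" "y2 > 0" and t: "t > 0"
begin

text \<open>
  Vectors with \<open>a \<noteq> 0\<close>: the variables \<open>x2\<close>, \<open>x4\<close>, \<open>x1\<close> occur with coefficient \<open>a\<close> in the third, fourth and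
  second coordinate and unfold the sums over \<open>c\<close>, \<open>d\<close> and \<open>b\<close> in turn.
\<close>
lemma mean_fiber_sum2:
  assumes a: "a \<noteq> 0"
  shows "box_mean (\<lambda>x. fiber_sum2 y1 y2 t (eta_prod x n) a) = gauss_mass y2 t * (gauss_mass (1 / y2) t * gauss_mass (1 / y1) t)"
proof -
  obtain n1 n2 n4 n5 where n: "n = (n1, n2, n4, n5)" by (cases n)
  let ?X1 = "\<lambda>x1. x1 + n1"
  have i2: "(\<integral>\<^sup>+x2. fiber_sum2 y1 y2 t (eta_prod (x1, x2, x4, x5) n) a \<partial>unif) =
     (\<integral>\<^sup>+b. gauss t (y2 * (of_int a * (x1 + n1) + of_int b)) *
        (gauss_sum (1 / y2) t (of_int a * x4 + (of_int a * ((x1 + n1) * (n5 + x5) + n4 - n1 * x5) + of_int b * (n5 + x5))) * gauss_mass (1 / y1) t) \<partial>count_space UNIV)"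
    for x1 x4 x5
  proof -
    have 1: "of_int a * (n2 + x1 * n4 + x2 - n1 * (x1 * x5 + x4)) + of_int b * (n4 + x4 - n1 * x5) - of_int d * (x1 + n1) =
        of_int a * x2 + (of_int a * (n2 + x1 * n4 - n1 * (x1 * x5 + x4)) + of_int b * (n4 + x4 - n1 * x5) - of_int d * (x1 + n1))" for x2 b d
      by (simp add: algebra_simps)
    have 2: "of_int a * ((x1 + n1) * (n5 + x5) + (n4 + x4 - n1 * x5)) + of_int b * (n5 + x5) =
       of_int a * x4 + (of_int a * ((x1 + n1) * (n5 + x5) + n4 - n1 * x5) + of_int b * (n5 + x5))" for b
      by (simp add: algebra_simps)
    show ?thesis
      unfolding fiber_sum2_def fiber_sum3_def n eta_prod.simps prod.case fst_conv 1 2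
      by (subst nn_integral_unif_sum, measurable)+ (simp only: gauss_sum_unif[OF a _ t] y gauss_sum_alt divide_pos_pos zero_less_one)
  qed
  have i4: "(\<integral>\<^sup>+x4. \<integral>\<^sup>+x2. fiber_sum2 y1 y2 t (eta_prod (x1, x2, x4, x5) n) a \<partial>unif \<partial>unif) = gauss_sum y2 t (of_int a * x1 + of_int a * n1) * (gauss_mass (1 / y2) t * gauss_mass (1 / y1) t)"
    for x1 x5
  proof -
    have "(\<integral>\<^sup>+x4. gauss_sum (1 / y2) t (of_int a * x4 + s) * gauss_mass (1 / y1) t \<partial>unif) = gauss_mass (1 / y2) t * gauss_mass (1 / y1) t" for s
      using y by (subst nn_integral_multc) (auto simp: gauss_sum_unif[OF a _ t])
    then show ?thesis unfolding i2
      by (subst nn_integral_unif_sum, measurable) (simp only: gauss_sum_alt distrib_left[of "of_int a"])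
  qed
  show ?thesis unfolding box_mean_def i4
    using y by (simp add: nn_integral_multc gauss_sum_unif[OF a _ t])
qed

text \<open>
  Vectors with \<open>a = 0\<close> and \<open>b \<noteq> 0\<close>: now \<open>x4\<close> and \<open>x5\<close> occur with coefficient \<open>b\<close> in the third and fourth
  coordinate and unfold the sums over \<open>c\<close> and \<open>d\<close>.
\<close>
lemma mean_fiber_sum3:
  assumes b: "b \<noteq> 0"
  shows "box_mean (\<lambda>x. fiber_sum3 y1 y2 t (eta_prod x n) 0 b) = gauss_mass (1 / y2) t * gauss_mass (1 / y1) t"
proof -
  obtain n1 n2 n4 n5 where n: "n = (n1, n2, n4, n5)" by (cases n)
  have T: "fiber_sum3 y1 y2 t (eta_prod (x1, x2, x4, x5) n) 0 b = (\<integral>\<^sup>+d. gauss t (1 / y2 * ((of_int b * x5 + of_int b * n5) + of_int d)) *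
        gauss_sum (1 / y1) t (of_int b * x4 + (of_int b * (n4 - n1 * x5) - of_int d * (x1 + n1))) \<partial>count_space UNIV)" for x1 x2 x4 x5
    unfolding fiber_sum3_def n eta_prod.simps prod.case by (simp add: algebra_simps)
  have i4: "(\<integral>\<^sup>+x4. \<integral>\<^sup>+x2. fiber_sum3 y1 y2 t (eta_prod (x1, x2, x4, x5) n) 0 b \<partial>unif \<partial>unif) = gauss_sum (1 / y2) t (of_int b * x5 + of_int b * n5) * gauss_mass (1 / y1) t" for x1 x5
    unfolding T nn_integral_unif_const
    by (subst nn_integral_unif_sum, measurable) (simp only: gauss_sum_unif[OF b _ t] y gauss_sum_alt divide_pos_pos zero_less_one)
  show ?thesis unfolding box_mean_def i4
    using y by (simp add: nn_integral_multc gauss_sum_unif[OF b _ t])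
qed

text \<open>
  Vectors with \<open>a = b = 0\<close> and \<open>d \<noteq> 0\<close>: here \<open>x1\<close> unfolds the sum over \<open>c\<close>.
\<close>
lemma mean_gauss_sum:
  assumes d: "d \<noteq> 0"
  shows "box_mean (\<lambda>x. gauss_sum (1 / y1) t (- of_int d * fst (eta_prod x n))) = gauss_mass (1 / y1) t"
proof -
  obtain n1 n2 n4 n5 where n: "n = (n1, n2, n4, n5)" by (cases n)
  have 1: "- of_int d * (x1 + n1) = of_int (- d) * x1 + - of_int d * n1" for x1 by (simp add: algebra_simps)
  have "- d \<noteq> 0" using d by simp
  show ?thesis unfolding box_mean_def n eta_prod.simps fst_conv 1 nn_integral_unif_const
    by (rule gauss_sum_unif) (use \<open>- d \<noteq> 0\<close> y t in auto)
qed

text \<open>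
  The four nonconstant summands come from the vectors with \<open>a = b = d = 0\<close>, with \<open>a = b = 0 \<noteq> d\<close>, with
  \<open>a = 0 \<noteq> b\<close> and with \<open>a \<noteq> 0\<close>. They become the four terms of the constant term, in this order.
\<close>
lemma mean_theta:
  "box_mean (\<lambda>x. gauss_theta (row_form y1 y2 (eta_prod x n)) t) =
    1 + gauss_sum_nz (1 / y1) t + gauss_sum_nz (1 / y2) t * gauss_mass (1 / y1) t + gauss_sum_nz y2 t * (gauss_mass (1 / y2) t * gauss_mass (1 / y1) t)
      + gauss_sum_nz y1 t * (gauss_mass y2 t * (gauss_mass (1 / y2) t * gauss_mass (1 / y1) t))"
proof -
  have m2: "(\<lambda>x. fiber_sum2 y1 y2 t (eta_prod x n) a) \<in> borel_measurable borel" for a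
    by (rule measurable_compose[OF eta_prod_measurable fiber_sum2_measurable])
  have m3: "(\<lambda>x. fiber_sum3 y1 y2 t (eta_prod x n) a b) \<in> borel_measurable borel" for a b
    by (rule measurable_compose[OF eta_prod_measurable fiber_sum3_measurable])
  have mf: "(\<lambda>x. fst (eta_prod x n)) \<in> borel_measurable borel"
    by (rule measurable_compose[OF eta_prod_measurable borel_measurable_continuous_onI[OF continuous_on_fst[OF continuous_on_id]]])
  have mg: "(\<lambda>x. gauss_sum (1 / y1) t (- of_int d * fst (eta_prod x n))) \<in> borel_measurable borel" for d :: int
    using mf by measurable
  have g0: "gauss_sum l t 0 = 1 + gauss_sum_nz l t" for l
    using gauss_sum_nz_sum[of "\<lambda>_. 1" 1 t l] by (simp add: gauss_sum_def)
  have T30: "box_mean (\<lambda>x. fiber_sum3 y1 y2 t (eta_prod x n) 0 0) = gauss_sum (1 / y1) t 0 + gauss_sum_nz (1 / y2) t * gauss_mass (1 / y1) t"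
  proof -
    have "fiber_sum3 y1 y2 t x 0 0 = (\<integral>\<^sup>+d. gauss t (1 / y2 * of_int d) * gauss_sum (1 / y1) t (- of_int d * fst x) \<partial>count_space UNIV)" for x
      by (cases x) (simp add: fiber_sum3_def)
    then have "box_mean (\<lambda>x. fiber_sum3 y1 y2 t (eta_prod x n) 0 0) = (\<integral>\<^sup>+d. gauss t (1 / y2 * of_int d) * box_mean (\<lambda>x. gauss_sum (1 / y1) t (- of_int d * fst (eta_prod x n))) \<partial>count_space UNIV)"
      by (simp only: box_mean_sum[OF mg])
    also have "\<dots> = gauss_sum (1 / y1) t 0 + gauss_sum_nz (1 / y2) t * gauss_mass (1 / y1) t"
      by (subst gauss_sum_nz_sum[OF mean_gauss_sum]) simp_all
    finally show ?thesis .
  qed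
  have T20: "box_mean (\<lambda>x. fiber_sum2 y1 y2 t (eta_prod x n) 0) = gauss_sum (1 / y1) t 0 + gauss_sum_nz (1 / y2) t * gauss_mass (1 / y1) t
     + gauss_sum_nz y2 t * (gauss_mass (1 / y2) t * gauss_mass (1 / y1) t)"
  proof -
    have "fiber_sum2 y1 y2 t x 0 = (\<integral>\<^sup>+b. gauss t (y2 * of_int b) * fiber_sum3 y1 y2 t x 0 b \<partial>count_space UNIV)" for x
      by (simp add: fiber_sum2_def)
    then have "box_mean (\<lambda>x. fiber_sum2 y1 y2 t (eta_prod x n) 0) = (\<integral>\<^sup>+b. gauss t (y2 * of_int b) * box_mean (\<lambda>x. fiber_sum3 y1 y2 t (eta_prod x n) 0 b) \<partial>count_space UNIV)"
      by (simp only: box_mean_sum[OF m3])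
    also have "\<dots> = box_mean (\<lambda>x. fiber_sum3 y1 y2 t (eta_prod x n) 0 0) + gauss_sum_nz y2 t * (gauss_mass (1 / y2) t * gauss_mass (1 / y1) t)"
      by (rule gauss_sum_nz_sum[OF mean_fiber_sum3])
    finally show ?thesis by (simp only: T30)
  qed
  have "box_mean (\<lambda>x. gauss_theta (row_form y1 y2 (eta_prod x n)) t) = (\<integral>\<^sup>+a. gauss t (y1 * of_int a) * box_mean (\<lambda>x. fiber_sum2 y1 y2 t (eta_prod x n) a) \<partial>count_space UNIV)"
    unfolding gauss_theta_row_form by (rule box_mean_sum[OF m2])
  also have "\<dots> = box_mean (\<lambda>x. fiber_sum2 y1 y2 t (eta_prod x n) 0) + gauss_sum_nz y1 t * (gauss_mass y2 t * (gauss_mass (1 / y2) t * gauss_mass (1 / y1) t))"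
    by (rule gauss_sum_nz_sum[OF mean_fiber_sum2])
  finally show ?thesis by (simp only: T20 g0)
qed

end

section \<open>Meromorphic continuation and the zeta function\<close>

text \<open>
  A meromorphic function on the plane is zero almost everywhere or nonzero almost everywhere, and the
  second case is impossible for a difference that vanishes on a half-plane.
\<close>
lemma meromorphic_identity:
  assumes f: "f meromorphic_on UNIV" and g: "g meromorphic_on UNIV" and eq: "\<And>z. Re z > c \<Longrightarrow> f z = g z"
  shows "\<forall>\<^sub>\<approx>z\<in>UNIV. f z = g z"
proof -
  have m: "(\<lambda>z. f z - g z) meromorphic_on UNIV" by (intro meromorphic_on_diff f g)
  have "\<not> (\<forall>\<^sub>\<approx>z\<in>UNIV. f z - g z \<noteq> 0)"
  proof
    assume "\<forall>\<^sub>\<approx>z\<in>UNIV. f z - g z \<noteq> 0"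
    then have "\<forall>\<^sub>F z in at (of_real (c + 1)). f z - g z \<noteq> 0"
      by (rule eventually_cosparse_imp_eventually_at) simp
    moreover have "\<forall>\<^sub>F z in at (of_real (c + 1)). z \<in> {z. c < Re z}"
      by (rule eventually_at_in_open') (auto simp: open_halfspace_Re_gt)
    ultimately have "\<forall>\<^sub>F z in at (complex_of_real (c + 1)). False"
      by eventually_elim (use eq in auto)
    then show False by simp
  qed
  then have "\<forall>\<^sub>\<approx>z\<in>UNIV. f z - g z = 0"
    using meromorphic_imp_constant_or_avoid[OF m, of 0] by auto
  then show ?thesis by eventually_elim simp
qed

lemma nicely_meromorphic_remove_sings:
  assumes "f nicely_meromorphic_on UNIV"
  shows "remove_sings f = f"
proof
  fix z
  show "remove_sings f z = f z"
  proof (cases "is_pole f z")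
    case True
    then have "\<not> f \<midarrow>z\<rightarrow> f z"
      using not_tendsto_and_filterlim_at_infinity[of "at z" f "f z"] by (auto simp: is_pole_def)
    then show ?thesis using assms True by (auto simp: nicely_meromorphic_on_def)
  next
    case False
    then have "f analytic_on {z}" using nicely_meromorphic_on_imp_analytic_at[OF assms] by simp
    then show ?thesis by simp
  qed
qed

text \<open>
  By the identity theorem a meromorphic extension is determined up to its values on a sparse set,
  and being nicely meromorphic fixes these values.
\<close>
lemma mero_cont_eqI:
  assumes F: "F meromorphic_on UNIV" and eq: "\<And>z. Re z > c \<Longrightarrow> F analytic_on {z} \<and> F z = f z"
  shows "mero_cont c f = remove_sings F"
  unfolding mero_cont_def
proof (rule the_equality)
  show "remove_sings F nicely_meromorphic_on UNIV \<and> (\<forall>z. c < Re z \<longrightarrow> remove_sings F z = f z)"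
    using remove_sings_nicely_meromorphic[OF F] eq by simp
next
  fix G assume G: "G nicely_meromorphic_on UNIV \<and> (\<forall>z. c < Re z \<longrightarrow> G z = f z)"
  then have mG: "G meromorphic_on UNIV" by (simp add: nicely_meromorphic_on_def)
  have "\<forall>\<^sub>\<approx>z\<in>UNIV. G z = F z"
    by (rule meromorphic_identity[OF mG F, of c]) (use G eq in auto)
  then have "remove_sings G z = remove_sings F z" for z
    by (intro remove_sings_cong eventually_cosparse_imp_eventually_at[where A = UNIV]) auto
  then have "remove_sings G = remove_sings F" by blast
  then show "G = remove_sings F" using nicely_meromorphic_remove_sings[of G] G by simp
qed

text \<open>
  \<open>\<vartheta>(t) = \<Sum>\<^sub>k exp (- \<pi> t k\<^sup>2)\<close>, whose Mellin transform is the completed zeta function.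
\<close>
definition jacobi_theta :: "real \<Rightarrow> real" where
  "jacobi_theta t = enn2real (gauss_sum 1 t 0)"

lemma gauss_sum_eq_gauss_theta: "gauss_sum 1 t 0 = gauss_theta (\<lambda>k::int. (of_int k)\<^sup>2) t"
  by (simp add: gauss_sum_def gauss_theta_def gauss_def)

lemma jacobi_theta_bounds:
  obtains C where "theta_bounds (1 / 2) C jacobi_theta"
proof -
  obtain K where K: "\<And>N. K N \<ge> 0"
    "\<And>N t. 0 < t \<Longrightarrow> t \<le> 1 \<Longrightarrow> gauss_mass 1 t * ennreal (1 - K N * t ^ N) \<le> gauss_sum 1 t 0"
    "\<And>N t. 0 < t \<Longrightarrow> t \<le> 1 \<Longrightarrow> gauss_sum 1 t 0 \<le> gauss_mass 1 t * ennreal (1 + K N * t ^ N)"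
    using gauss_sum_bounds[OF zero_less_one] by metis
  have gauss_mass: "gauss_mass 1 t = ennreal (t powr (- (1 / 2)))" if "0 < t" for t
    by (simp only: gauss_mass_def powr_minus_divide powr_half_sqrt[OF less_imp_le[OF that]] mult_1_left)
  have gap: "(1::real) \<le> (of_int k)\<^sup>2" if "k \<noteq> 0" for k :: int
  proof -
    have "1 \<le> k\<^sup>2" using that by (simp add: int_one_le_iff_zero_less)
    then show ?thesis by (metis of_int_1_le_iff of_int_power)
  qed
  have "theta_bounds (1 / 2) (theta_const (1 / 2) 1 K) (\<lambda>t. enn2real (gauss_theta (\<lambda>k::int. (of_int k)\<^sup>2) t))"
    by (rule gauss_theta_bounds(1)[where ?v0.0 = 0])
      (use K gap in \<open>simp_all add: gauss_mass flip: gauss_sum_eq_gauss_theta\<close>)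
  then show thesis using that by (simp add: jacobi_theta_def[abs_def] gauss_sum_eq_gauss_theta)
qed

lemma jacobi_theta_measurable [measurable]: "jacobi_theta \<in> borel_measurable borel"
  unfolding jacobi_theta_def gauss_sum_eq_gauss_theta by measurable

lemma gauss_sum_1_finite:
  assumes "t > 0"
  shows "gauss_sum 1 t 0 < \<infinity>"
proof -
  have "circle_heat (1 / t) 0 < \<infinity>" by (rule le_less_trans[OF circle_heat_upper]) (use assms in auto)
  then show ?thesis using assms by (simp add: gauss_sum_eq_circle_heat gauss_mass_def ennreal_mult_less_top)
qed

lemma gauss_sum_nz_eq_jacobi_theta:
  assumes "t > 0"
  shows "gauss_sum_nz 1 t = ennreal (jacobi_theta t - 1)" "jacobi_theta t - 1 \<ge> 0"
proof -
  have s: "gauss_sum 1 t 0 = 1 + gauss_sum_nz 1 t"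
    using gauss_sum_nz_sum[of "\<lambda>_. 1" 1 t 1] by (simp add: gauss_sum_def)
  then have fin: "gauss_sum_nz 1 t < \<infinity>" using gauss_sum_1_finite[OF assms] by (simp add: less_top)
  then obtain z where z: "gauss_sum_nz 1 t = ennreal z" "z \<ge> 0" by (cases "gauss_sum_nz 1 t") auto
  have "jacobi_theta t = 1 + z" unfolding jacobi_theta_def s z(1)
    using z(2) by (simp add: ennreal_1[symmetric] ennreal_plus[symmetric] del: ennreal_1 ennreal_plus)
  then show "gauss_sum_nz 1 t = ennreal (jacobi_theta t - 1)" "jacobi_theta t - 1 \<ge> 0" using z by auto
qed

definition zeta_series :: "complex \<Rightarrow> complex" where
  "zeta_series s = (\<Sum>n. 1 / of_nat (Suc n) powr s)"

lemma square_powr: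
  fixes u :: complex
  assumes "k \<noteq> 0"
  shows "of_real ((of_int k)\<^sup>2) powr (- u) = 1 / of_nat (nat \<bar>k\<bar>) powr (2 * u)"
proof -
  have k: "real (nat \<bar>k\<bar>) > 0" using assms by simp
  have "(real_of_int k)\<^sup>2 = (real (nat \<bar>k\<bar>))\<^sup>2" by simp
  then have "ln ((real_of_int k)\<^sup>2) = 2 * ln (real (nat \<bar>k\<bar>))" using k by (simp only: ln_realpow)
  moreover have "(real_of_int k)\<^sup>2 > 0" using assms by simp
  ultimately have "of_real ((of_int k)\<^sup>2) powr (- u) = exp (- (2 * u) * of_real (ln (real (nat \<bar>k\<bar>))))"
    unfolding powr_def by (subst Ln_of_real) (use assms in \<open>auto simp: mult_ac simp del: of_real_power\<close>)
  also have "\<dots> = of_real (real (nat \<bar>k\<bar>)) powr (- (2 * u))"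
    using k unfolding powr_def by (subst Ln_of_real) (auto simp: mult_ac)
  finally show ?thesis by (simp only: of_real_of_nat_eq powr_minus divide_inverse mult_1_left)
qed

lemma infsum_nonzero_int:
  fixes f :: "nat \<Rightarrow> complex"
  assumes sm: "(\<lambda>k::int. f (nat \<bar>k\<bar>)) summable_on (UNIV - {0})"
  shows "(\<Sum>\<^sub>\<infinity>k\<in>UNIV - {0}. f (nat \<bar>k\<bar>)) = 2 * (\<Sum>n. f (Suc n))" "summable (\<lambda>n. f (Suc n))"
proof -
  define P where "P = (\<lambda>n. int (Suc n)) ` UNIV"
  define M where "M = (\<lambda>n. - int (Suc n)) ` UNIV"
  have U: "UNIV - {0} = P \<union> M"
  proof (intro set_eqI iffI)
    fix k :: int assume "k \<in> UNIV - {0}"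
    then consider "k > 0" | "k < 0" by force
    then show "k \<in> P \<union> M"
    proof cases
      case 1
      then have "k = int (Suc (nat k - 1))" by simp
      then show ?thesis unfolding P_def by blast
    next
      case 2
      then have "k = - int (Suc (nat (- k) - 1))" by simp
      then show ?thesis unfolding M_def by blast
    qed
  qed (auto simp: P_def M_def)
  have PM: "P \<inter> M = {}" by (auto simp: P_def M_def)
  have inj: "inj (\<lambda>n. int (Suc n))" "inj (\<lambda>n. - int (Suc n))" by (auto intro: injI)
  have s: "(\<lambda>k. f (nat \<bar>k\<bar>)) summable_on P" "(\<lambda>k. f (nat \<bar>k\<bar>)) summable_on M"
    by (rule summable_on_subset_banach[OF sm]; simp add: U)+
  have cP: "(\<lambda>k. f (nat \<bar>k\<bar>)) \<circ> (\<lambda>n. int (Suc n)) = (\<lambda>n. f (Suc n))"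
    and cM: "(\<lambda>k. f (nat \<bar>k\<bar>)) \<circ> (\<lambda>n. - int (Suc n)) = (\<lambda>n. f (Suc n))" by (auto simp: fun_eq_iff nat_add_distrib)
  have sf: "(\<lambda>n. f (Suc n)) summable_on UNIV"
    using s(1) unfolding P_def summable_on_reindex[OF inj(1)] cP .
  then have "(\<lambda>n. f (Suc n)) sums infsum (\<lambda>n. f (Suc n)) UNIV"
    by (intro has_sum_imp_sums has_sum_infsum)
  then have e: "infsum (\<lambda>n. f (Suc n)) UNIV = (\<Sum>n. f (Suc n))" and sum: "summable (\<lambda>n. f (Suc n))"
    by (simp_all add: sums_iff)
  show "summable (\<lambda>n. f (Suc n))" by (rule sum)
  have "(\<Sum>\<^sub>\<infinity>k\<in>UNIV - {0}. f (nat \<bar>k\<bar>)) = (\<Sum>\<^sub>\<infinity>k\<in>P. f (nat \<bar>k\<bar>)) + (\<Sum>\<^sub>\<infinity>k\<in>M. f (nat \<bar>k\<bar>))"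
    unfolding U by (rule infsum_Un_disjoint[OF s PM])
  also have "\<dots> = 2 * (\<Sum>n. f (Suc n))"
    unfolding P_def M_def infsum_reindex[OF inj(1)] infsum_reindex[OF inj(2)] cP cM e by simp
  finally show "(\<Sum>\<^sub>\<infinity>k\<in>UNIV - {0}. f (nat \<bar>k\<bar>)) = 2 * (\<Sum>n. f (Suc n))" .
qed

text \<open>
  Riemann's integral representation: the sum over all nonzero integers counts every term of the zeta
  series twice.
\<close>
lemma mellin_jacobi_theta:
  assumes "Re u > 1 / 2"
  shows "set_integrable lborel {0<..} (\<lambda>t. of_real t powr (u - 1) * of_real (jacobi_theta t - 1) :: complex)"
    and "(LINT t:{0<..}|lborel. of_real t powr (u - 1) * of_real (jacobi_theta t - 1)) = mellin (1 / 2) jacobi_theta u"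
    and "mellin (1 / 2) jacobi_theta u = 2 * (of_real pi powr (- u) * Gamma u * zeta_series (2 * u))"
    and "(\<Sum>\<^sub>\<infinity>k\<in>UNIV - {0::int}. of_real ((of_int k)\<^sup>2) powr (- u)) = 2 * zeta_series (2 * u)"
    and "summable (\<lambda>n. 1 / of_nat (Suc n) powr (2 * u))"
proof -
  obtain C where C: "theta_bounds (1 / 2) C jacobi_theta" by (rule jacobi_theta_bounds)
  show i: "set_integrable lborel {0<..} (\<lambda>t. of_real t powr (u - 1) * of_real (jacobi_theta t - 1) :: complex)"
    by (rule mellin_eq_integral(1)[OF C]) (use assms in auto)
  show m: "(LINT t:{0<..}|lborel. of_real t powr (u - 1) * of_real (jacobi_theta t - 1)) = mellin (1 / 2) jacobi_theta u"
    by (rule mellin_eq_integral(2)[OF C, symmetric]) (use assms in auto)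
  have nn: "(\<integral>\<^sup>+k. ennreal (exp (- pi * t * (real_of_int k)\<^sup>2)) \<partial>count_space (UNIV - {0})) = ennreal (jacobi_theta t - 1)" if "t > 0" for t
    using gauss_sum_nz_eq_jacobi_theta(1)[OF that] by (simp add: gauss_sum_nz_def gauss_def)
  have w: "Re u > 0" using assms by simp
  have pos: "(real_of_int k)\<^sup>2 > 0" if "k \<in> UNIV - {0}" for k using that by simp
  note G = mellin_gaussian_sum[of "UNIV - {0::int}" "\<lambda>k. (of_int k)\<^sup>2" u "\<lambda>t. jacobi_theta t - 1", OF _ pos w nn gauss_sum_nz_eq_jacobi_theta(2) i]
  have eq: "(\<lambda>k::int. of_real ((of_int k)\<^sup>2) powr (- u) :: complex) = (\<lambda>k. if k = 0 then of_real 0 powr (- u) else 1 / of_nat (nat \<bar>k\<bar>) powr (2 * u))"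
  proof
    fix k :: int
    show "of_real ((of_int k)\<^sup>2) powr (- u) = (if k = 0 then of_real 0 powr (- u) else 1 / of_nat (nat \<bar>k\<bar>) powr (2 * u) :: complex)"
      by (cases "k = 0") (simp_all only: square_powr if_True if_False of_int_0 zero_power2 simp_thms)
  qed
  have sm: "(\<lambda>k::int. 1 / of_nat (nat \<bar>k\<bar>) powr (2 * u) :: complex) summable_on (UNIV - {0})"
    using G(1) unfolding eq by (subst summable_on_cong) auto
  note I = infsum_nonzero_int[of "\<lambda>n. 1 / of_nat n powr (2 * u)", OF sm]
  show s2: "(\<Sum>\<^sub>\<infinity>k\<in>UNIV - {0::int}. of_real ((of_int k)\<^sup>2) powr (- u)) = 2 * zeta_series (2 * u)"
    unfolding zeta_series_def I(1)[symmetric] eq by (intro infsum_cong) auto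
  show "summable (\<lambda>n. 1 / of_nat (Suc n) powr (2 * u) :: complex)" by (rule I(2))
  show "mellin (1 / 2) jacobi_theta u = 2 * (of_real pi powr (- u) * Gamma u * zeta_series (2 * u))"
    using G(2) unfolding m s2 by simp
qed

lemma mellin_jacobi_theta_meromorphic: "mellin (1 / 2) jacobi_theta meromorphic_on UNIV"
proof -
  obtain C where C: "theta_bounds (1 / 2) C jacobi_theta" by (rule jacobi_theta_bounds)
  show ?thesis by (rule mellin_meromorphic[OF C]) measurable
qed

lemma mellin_jacobi_theta_analytic: "Re u > 1 / 2 \<Longrightarrow> mellin (1 / 2) jacobi_theta analytic_on {u}"
proof -
  assume u: "Re u > 1 / 2"
  obtain C where C: "theta_bounds (1 / 2) C jacobi_theta" by (rule jacobi_theta_bounds)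
  have "u \<noteq> 0" "u \<noteq> of_real (1 / 2)" using u by (auto simp: complex_eq_iff)
  then show ?thesis by (intro mellin_analytic[OF C]) auto
qed

lemma meromorphic_on_affine:
  assumes "f meromorphic_on UNIV"
  shows "(\<lambda>s. f (a * s + b)) meromorphic_on UNIV"
  by (rule meromorphic_on_compose[OF assms]) (auto intro!: analytic_intros)

lemma analytic_on_affine:
  assumes "f analytic_on {a * s + b}"
  shows "(\<lambda>s. f (a * s + b)) analytic_on {s}"
proof -
  have "(f \<circ> (\<lambda>s. a * s + b)) analytic_on {s}"
    by (rule analytic_on_compose) (use assms in \<open>auto intro!: analytic_intros\<close>)
  then show ?thesis by (simp add: o_def)
qed

text \<open>
  The representation above solved for \<open>\<zeta>\<close>, with the entire function \<open>1/\<Gamma>\<close> in place of a quotient.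
\<close>
definition zeta_mellin :: "complex \<Rightarrow> complex" where
  "zeta_mellin s = mellin (1 / 2) jacobi_theta (s / 2) * of_real pi powr (s / 2) * rGamma (s / 2) / 2"

lemma zeta_mellin_meromorphic: "zeta_mellin meromorphic_on UNIV"
proof -
  have 1: "(\<lambda>s. mellin (1 / 2) jacobi_theta (s / 2)) meromorphic_on UNIV"
    using meromorphic_on_affine[OF mellin_jacobi_theta_meromorphic, of "1/2" 0] by simp
  have 2: "(\<lambda>s. of_real pi powr (s / 2) * rGamma (s / 2) / 2) meromorphic_on UNIV"
    by (intro analytic_on_imp_meromorphic_on analytic_intros) (auto dest: order.strict_trans2[OF pi_gt_zero])
  show ?thesis unfolding zeta_mellin_def[abs_def]
    using meromorphic_on_mult[OF 1 2] by (simp add: mult.assoc)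
qed

lemma zeta_mellin_analytic: "Re s > 1 \<Longrightarrow> zeta_mellin analytic_on {s}"
proof -
  assume s: "Re s > 1"
  have 1: "(\<lambda>s. mellin (1 / 2) jacobi_theta (s / 2)) analytic_on {s}"
    using analytic_on_affine[of "mellin (1/2) jacobi_theta" "1/2" s 0] mellin_jacobi_theta_analytic[of "s / 2"] s by simp
  show ?thesis unfolding zeta_mellin_def[abs_def]
    by (intro analytic_intros 1) (auto dest: order.strict_trans2[OF pi_gt_zero])
qed

lemma zeta_mellin_eq_series: "Re s > 1 \<Longrightarrow> zeta_mellin s = zeta_series s"
proof -
  assume s: "Re s > 1"
  have "Gamma (s / 2) * rGamma (s / 2) = 1"
  proof -
    have "s / 2 \<notin> \<int>\<^sub>\<le>\<^sub>0" using s by (auto elim!: nonpos_Ints_cases simp: complex_eq_iff)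
    then show ?thesis by (simp add: rGamma_inverse_Gamma Gamma_eq_zero_iff)
  qed
  moreover have "of_real pi powr (- (s / 2)) * of_real pi powr (s / 2) = (1 :: complex)"
    by (simp add: powr_minus)
  ultimately show ?thesis
    unfolding zeta_mellin_def mellin_jacobi_theta(3)[of "s / 2", simplified, OF s]
    by (simp add: powr_minus field_simps)
qed

lemma zeta_eq: "zeta = remove_sings zeta_mellin"
  unfolding zeta_def using zeta_mellin_analytic zeta_mellin_eq_series
  by (intro mero_cont_eqI zeta_mellin_meromorphic) (auto simp: zeta_series_def)

lemma zeta_eq_series: "Re s > 1 \<Longrightarrow> zeta s = zeta_series s"
  by (simp add: zeta_eq zeta_mellin_analytic zeta_mellin_eq_series)

lemma Lambda_meromorphic: "Lambda meromorphic_on UNIV"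
proof -
  have 1: "zeta meromorphic_on UNIV"
    unfolding zeta_eq by (intro remove_sings_meromorphic zeta_mellin_meromorphic)
  have 2: "(\<lambda>s. of_real pi powr (- s / 2) * inverse (rGamma (s / 2))) meromorphic_on UNIV"
    by (intro meromorphic_on_mult meromorphic_on_inverse analytic_on_imp_meromorphic_on analytic_intros) (auto dest: order.strict_trans2[OF pi_gt_zero])
  show ?thesis unfolding Lambda_def[abs_def] Gamma_def
    by (rule meromorphic_on_mult[OF 2 1])
qed

lemma Lambda_eq_mellin: "Re s > 1 \<Longrightarrow> 2 * Lambda s = mellin (1 / 2) jacobi_theta (s / 2)"
  using mellin_jacobi_theta(3)[of "s / 2"] by (simp add: Lambda_def zeta_eq_series)

lemma Lambda_analytic: "Re s > 1 \<Longrightarrow> Lambda analytic_on {s}"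
proof -
  assume s: "Re s > 1"
  have "\<forall>\<^sub>F z in nhds s. z \<in> {z. 1 < Re z}"
    by (rule eventually_nhds_in_open) (use s in \<open>auto simp: open_halfspace_Re_gt\<close>)
  then have ev: "\<forall>\<^sub>F z in nhds s. Lambda z = mellin (1 / 2) jacobi_theta (1 / 2 * z + 0) / 2"
    by eventually_elim (use Lambda_eq_mellin in \<open>simp add: field_simps\<close>)
  moreover have "(\<lambda>z. mellin (1 / 2) jacobi_theta (1 / 2 * z + 0) / 2) analytic_on {s}"
    by (intro analytic_intros analytic_on_affine mellin_jacobi_theta_analytic) (use s in auto)
  ultimately show ?thesis using analytic_at_cong[OF ev refl] by blast
qed

text \<open>
  The first term exceeds all others together: \<open>\<bar>n\<^sup>s\<bar> \<ge> 2 n\<^sup>2\<close> for \<open>n \<ge> 2\<close>, and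
  \<open>(\<pi>\<^sup>2/6 - 1)/2 < 1\<close> follows from \<open>\<pi> < 4\<close>.
\<close>
lemma zeta_series_nonzero:
  assumes s: "Re s \<ge> 3"
  shows "zeta_series s \<noteq> 0"
proof -
  have sm: "summable (\<lambda>n. 1 / of_nat (Suc n) powr s :: complex)"
    using mellin_jacobi_theta(5)[of "s / 2"] s by simp
  have sq: "(\<lambda>n. 1 / (real n + 1)\<^sup>2) sums (pi\<^sup>2 / 6)" using inverse_squares_sums by (simp add: add.commute)
  have "(\<lambda>n. 1 / (real (Suc n) + 1)\<^sup>2) sums (pi\<^sup>2 / 6 - 1)"
    using sums_split_initial_segment[OF sq, of 1] by simp
  then have sq2: "(\<lambda>n. 1 / 2 * (1 / (real (Suc n) + 1)\<^sup>2)) sums (1 / 2 * (pi\<^sup>2 / 6 - 1))" by (rule sums_mult)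
  have tail: "norm (\<Sum>n. 1 / of_nat (Suc (Suc n)) powr s) \<le> (\<Sum>n. 1 / 2 * (1 / (real (Suc n) + 1)\<^sup>2))"
  proof (rule norm_suminf_le[OF _ sums_summable[OF sq2]])
    fix n
    have "norm (of_nat (Suc (Suc n)) powr s) = real (Suc (Suc n)) powr Re s"
      using norm_powr_real_powr[of "real (Suc (Suc n))" s] by simp
    also have "\<dots> \<ge> real (Suc (Suc n)) powr 3" using s by (intro powr_mono) auto
    also have "real (Suc (Suc n)) powr 3 = real (Suc (Suc n)) * (real (Suc (Suc n)))\<^sup>2"
      by (simp add: powr_numeral power3_eq_cube power2_eq_square)
    also have "\<dots> \<ge> 2 * (real (Suc (Suc n)))\<^sup>2" by (intro mult_right_mono) auto
    finally have "norm (of_nat (Suc (Suc n)) powr s) \<ge> 2 * (real (Suc n) + 1)\<^sup>2" by (simp add: add.commute)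
    then show "norm (1 / of_nat (Suc (Suc n)) powr s) \<le> 1 / 2 * (1 / (real (Suc n) + 1)\<^sup>2)"
      by (simp add: norm_divide frac_le)
  qed
  have "pi\<^sup>2 < 4\<^sup>2" using pi_less_4 by (intro power_strict_mono) auto
  then have "1 / 2 * (pi\<^sup>2 / 6 - 1) < 1" by simp
  then have "norm (\<Sum>n. 1 / of_nat (Suc (Suc n)) powr s) < 1" using tail sums_unique[OF sq2] by linarith
  moreover have "zeta_series s = 1 + (\<Sum>n. 1 / of_nat (Suc (Suc n)) powr s)"
    unfolding zeta_series_def using suminf_split_head[OF sm] by simp
  ultimately show ?thesis by (metis add_eq_0_iff norm_minus_cancel norm_one order_less_irrefl)
qed

lemma Lambda_nonzero: "Re s \<ge> 3 \<Longrightarrow> Lambda s \<noteq> 0"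
proof -
  assume s: "Re s \<ge> 3"
  have "s / 2 \<notin> \<int>\<^sub>\<le>\<^sub>0" using s by (auto elim!: nonpos_Ints_cases simp: complex_eq_iff)
  then show ?thesis using zeta_series_nonzero[OF s] s
    by (simp add: Lambda_def zeta_eq_series Gamma_eq_zero_iff)
qed

section \<open>The Eisenstein series as an Epstein zeta function\<close>

lemma of_real_powr_powr:
  fixes z :: complex
  assumes "y > 0"
  shows "of_real (y powr r) powr z = of_real y powr (of_real r * z)"
  using assms unfolding powr_def by (simp add: Ln_of_real ln_powr[unfolded powr_def] mult_ac)

lemma of_real_square_powr: "y > 0 \<Longrightarrow> of_real (y\<^sup>2) powr z = of_real y powr (2 * z :: complex)"
  using of_real_powr_powr[of y 2 z] by (simp add: powr_numeral)

lemma of_real_inverse_powr: "y > 0 \<Longrightarrow> of_real (1 / y) powr z = of_real y powr (- z :: complex)"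
  using of_real_powr_powr[of y "-1" z] by (simp add: powr_minus divide_inverse)

lemma I_beta_rep:
  assumes "c \<in> cosets_beta" "h \<in> Sp4R"
  shows "I_beta (rep_beta c ** h) \<nu> = of_real ((norm (rep_beta c $ 3 v* h))\<^sup>2) powr (- ((\<nu> + 2) / 2))"
    and "norm (rep_beta c $ 3 v* h) > 0"
proof -
  have "rep_beta c ** h \<in> Sp4R" using rep_beta(2)[OF assms(1)] assms(2) by (simp add: Sp4Z_def Sp4R_mult)
  note y = iwasawa_y1_eq[OF this, unfolded row_mult]
  show pos: "norm (rep_beta c $ 3 v* h) > 0" using y(2) by simp
  show "I_beta (rep_beta c ** h) \<nu> = of_real ((norm (rep_beta c $ 3 v* h))\<^sup>2) powr (- ((\<nu> + 2) / 2))"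
    unfolding I_beta_def y(1) of_real_square_powr[OF pos] of_real_inverse_powr[OF pos] by (simp only: mult_minus_right times_divide_eq_right nonzero_mult_div_cancel_left zero_neq_numeral[symmetric] not_False_eq_True)
qed

text \<open>
  Both sides are the sum of \<open>\<bar>v h\<bar>^(-s)\<close> over nonzero integral vectors, \<open>s = \<nu> + 2\<close>, up to the factor
  \<open>\<pi>^(-s/2) \<Gamma>(s/2)\<close>. On the left it arises from integrating the theta function termwise; on the right, every vector
  is a nonzero multiple of a coset vector, and the sum over the multipliers splits off as \<open>2 \<zeta>(s)\<close>.
\<close>
lemma mellin_lattice_theta:
  assumes y: "y1 > 0" "y2 > 0" and k: "k \<in> K4" and h: "h = eta n ** diag4 y1 y2 ** k" "h \<in> Sp4R"
    and \<nu>: "Re \<nu> > 2"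
  shows "mellin 2 (lattice_theta y1 y2 n) ((\<nu> + 2) / 2) = 2 * Lambda (\<nu> + 2) * E_beta_series h \<nu>"
proof -
  define w where "w = (\<nu> + 2) / 2"
  have w: "Re w > 2" using \<nu> by (simp add: w_def)
  have w2: "2 * w = \<nu> + 2" by (simp add: w_def)
  obtain C where B: "theta_bounds 2 C (lattice_theta y1 y2 n)" using lattice_theta_uniform(1)[OF y] by blast
  let ?V = "UNIV - {(0, 0, 0, 0)} :: int4 set"
  have q0: "row_form y1 y2 n (0, 0, 0, 0) = 0" by (cases n) simp
  have qpos: "row_form y1 y2 n v > 0" if "v \<in> ?V" for v
  proof -
    have "0 < min (min (y1\<^sup>2) (y2\<^sup>2)) (min ((1 / y1)\<^sup>2) ((1 / y2)\<^sup>2))" using y by simp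
    also have "\<dots> \<le> row_form y1 y2 n v" by (rule row_form_gap[OF y]) (use that in auto)
    finally show ?thesis .
  qed
  have nn: "(\<integral>\<^sup>+v. ennreal (exp (- pi * t * row_form y1 y2 n v)) \<partial>count_space ?V) = ennreal (lattice_theta y1 y2 n t - 1)"
    "lattice_theta y1 y2 n t - 1 \<ge> 0" if "t > 0" for t
  proof -
    define z where "z = (\<integral>\<^sup>+v. ennreal (exp (- pi * t * row_form y1 y2 n v)) \<partial>count_space ?V)"
    have s: "gauss_theta (row_form y1 y2 n) t = 1 + z" unfolding z_def by (rule gauss_theta_split) (rule q0)
    then have "z < \<infinity>" using lattice_theta_uniform(2)[OF y that, of n] by (simp add: less_top)
    then obtain x where x: "z = ennreal x" "x \<ge> 0" by (cases z) auto
    have "lattice_theta y1 y2 n t = 1 + x" unfolding lattice_theta_def s x(1)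
      using x(2) by (simp add: ennreal_1[symmetric] ennreal_plus[symmetric] del: ennreal_1 ennreal_plus)
    then show "(\<integral>\<^sup>+v. ennreal (exp (- pi * t * row_form y1 y2 n v)) \<partial>count_space ?V) = ennreal (lattice_theta y1 y2 n t - 1)"
      "lattice_theta y1 y2 n t - 1 \<ge> 0" using x unfolding z_def by auto
  qed
  have i: "set_integrable lborel {0<..} (\<lambda>t. of_real t powr (w - 1) * of_real (lattice_theta y1 y2 n t - 1) :: complex)"
    by (rule mellin_eq_integral(1)[OF B]) (use w in auto)
  have m: "mellin 2 (lattice_theta y1 y2 n) w = (LINT t:{0<..}|lborel. of_real t powr (w - 1) * of_real (lattice_theta y1 y2 n t - 1))"
    by (rule mellin_eq_integral(2)[OF B]) (use w in auto)
  have w0: "Re w > 0" using w by simp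
  note G = mellin_gaussian_sum[of ?V "row_form y1 y2 n" w "\<lambda>t. lattice_theta y1 y2 n t - 1", OF _ qpos w0 nn i]
  let ?r = "\<lambda>c. norm (rep_beta c $ 3 v* h)"
  have term_eq: "of_real (row_form y1 y2 n (coset_vec (c, j))) powr (- w) = of_real ((real_of_int j)\<^sup>2) powr (- w) * (of_real ((?r c)\<^sup>2) powr (- w) :: complex)"
    if "c \<in> cosets_beta" for c j
  proof -
    have "rvec (coset_vec (c, j)) v* h = of_int j *\<^sub>R (rep_beta c $ 3 v* h)"
      by (simp add: rvec_coset_vec[OF that] vec_eq_iff vector_matrix_mult_def sum_distrib_left mult_ac)
    then have "row_form y1 y2 n (coset_vec (c, j)) = (real_of_int j)\<^sup>2 * (?r c)\<^sup>2"
      unfolding norm_row_eq_row_form[OF k, symmetric] h(1)[symmetric] by (simp add: power_mult_distrib)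
    then show ?thesis by (simp add: powr_times_real)
  qed
  have sm: "(\<lambda>(c, j). of_real ((real_of_int j)\<^sup>2) powr (- w) * (of_real ((?r c)\<^sup>2) powr (- w) :: complex)) summable_on (cosets_beta \<times> (UNIV - {0}))"
    (is "?f summable_on _")
  proof -
    have "(\<lambda>z. of_real (row_form y1 y2 n (coset_vec z)) powr (- w) :: complex) summable_on (cosets_beta \<times> (UNIV - {0}))"
      using G(1) by (subst summable_on_reindex_bij_betw[OF bij_betw_coset_vec]) auto
    then show ?thesis by (rule summable_on_cong[THEN iffD1, rotated]) (auto simp: term_eq)
  qed
  have "(\<Sum>\<^sub>\<infinity>v\<in>?V. of_real (row_form y1 y2 n v) powr (- w)) = (\<Sum>\<^sub>\<infinity>z\<in>cosets_beta \<times> (UNIV - {0}). of_real (row_form y1 y2 n (coset_vec z)) powr (- w) :: complex)"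
    by (rule infsum_reindex_bij_betw[OF bij_betw_coset_vec, symmetric])
  also have "\<dots> = (\<Sum>\<^sub>\<infinity>(c, j)\<in>cosets_beta \<times> (UNIV - {0}). of_real ((real_of_int j)\<^sup>2) powr (- w) * of_real ((?r c)\<^sup>2) powr (- w))"
    by (intro infsum_cong) (auto simp: term_eq)
  also have "\<dots> = (\<Sum>\<^sub>\<infinity>c\<in>cosets_beta. \<Sum>\<^sub>\<infinity>j\<in>UNIV - {0}. of_real ((real_of_int j)\<^sup>2) powr (- w) * of_real ((?r c)\<^sup>2) powr (- w))"
    by (rule infsum_Sigma'_banach[symmetric]) (use sm in simp)
  also have "\<dots> = 2 * zeta_series (\<nu> + 2) * (\<Sum>\<^sub>\<infinity>c\<in>cosets_beta. of_real ((?r c)\<^sup>2) powr (- w))"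
    using mellin_jacobi_theta(4)[of w] w unfolding w2 by (simp add: infsum_cmult_left' infsum_cmult_right')
  also have "(\<Sum>\<^sub>\<infinity>c\<in>cosets_beta. of_real ((?r c)\<^sup>2) powr (- w)) = E_beta_series h \<nu>"
    unfolding E_beta_series_def rep_beta_def[symmetric] w_def
    by (intro infsum_cong) (simp only: I_beta_rep(1)[OF _ h(2)])
  finally have S: "(\<Sum>\<^sub>\<infinity>v\<in>?V. of_real (row_form y1 y2 n v) powr (- w)) = 2 * zeta_series (\<nu> + 2) * E_beta_series h \<nu>" .
  have "2 * Lambda (\<nu> + 2) = 2 * (of_real pi powr (- w) * Gamma w * zeta_series (\<nu> + 2))"
    using mellin_jacobi_theta(3)[of w] Lambda_eq_mellin[of "\<nu> + 2"] w \<nu> unfolding w2 w_def[symmetric] by simp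
  then show ?thesis using G(2) unfolding S m[symmetric] w_def[symmetric] by simp
qed

text \<open>
  The excluded points are the poles of the Mellin transform, and the poles and zeros of \<open>\<Lambda>(\<nu> + 2)\<close>. They
  do not depend on \<open>h\<close>, so for all other \<open>\<nu>\<close> the formula holds on the whole domain of integration at once.
\<close>
lemma E_beta_eq_mellin:
  assumes y: "y1 > 0" "y2 > 0" and k: "k \<in> K4" and h: "h = eta n ** diag4 y1 y2 ** k" "h \<in> Sp4R"
    and \<nu>: "\<nu> \<noteq> -2" "\<nu> \<noteq> 2" "(\<lambda>\<nu>. Lambda (\<nu> + 2)) analytic_on {\<nu>}" "Lambda (\<nu> + 2) \<noteq> 0"
  shows "E_beta h \<nu> = mellin 2 (lattice_theta y1 y2 n) ((\<nu> + 2) / 2) / (2 * Lambda (\<nu> + 2))"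
proof -
  let ?F = "\<lambda>\<nu>. mellin 2 (lattice_theta y1 y2 n) ((\<nu> + 2) / 2) / (2 * Lambda (\<nu> + 2))"
  obtain C where B: "theta_bounds 2 C (lattice_theta y1 y2 n)" using lattice_theta_uniform(1)[OF y] by blast
  have F: "?F analytic_on {\<nu>}" if "\<nu> \<noteq> -2" "\<nu> \<noteq> 2" "(\<lambda>\<nu>. Lambda (\<nu> + 2)) analytic_on {\<nu>}" "Lambda (\<nu> + 2) \<noteq> 0" for \<nu>
  proof -
    have "(\<nu> + 2) / 2 \<noteq> 0" using that(1) by (simp add: add_eq_0_iff2)
    moreover have "(\<nu> + 2) / 2 \<noteq> of_real 2" using that(2) by (auto simp: field_simps)
    ultimately have "mellin 2 (lattice_theta y1 y2 n) analytic_on {1 / 2 * \<nu> + 1}"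
      using mellin_analytic[OF B, of "(\<nu> + 2) / 2"] by (simp add: field_simps)
    from analytic_on_affine[OF this] have "(\<lambda>\<nu>. mellin 2 (lattice_theta y1 y2 n) ((\<nu> + 2) / 2)) analytic_on {\<nu>}"
      by (simp add: add_divide_distrib)
    then show ?thesis using that by (intro analytic_intros) auto
  qed
  have "(\<lambda>\<nu>. mellin 2 (lattice_theta y1 y2 n) (1 / 2 * \<nu> + 1)) meromorphic_on UNIV"
    by (intro meromorphic_on_affine mellin_meromorphic[OF B]) measurable
  moreover have "(\<lambda>\<nu>. Lambda (1 * \<nu> + 2)) meromorphic_on UNIV"
    by (rule meromorphic_on_affine[OF Lambda_meromorphic])
  ultimately have "(\<lambda>\<nu>. mellin 2 (lattice_theta y1 y2 n) (1 / 2 * \<nu> + 1) / (2 * Lambda (1 * \<nu> + 2))) meromorphic_on UNIV"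
    by (intro meromorphic_on_divide meromorphic_on_mult meromorphic_on_const)
  then have mero: "?F meromorphic_on UNIV" by (simp add: add_divide_distrib)
  have E: "E_beta h = remove_sings ?F"
    unfolding E_beta_def
  proof (rule mero_cont_eqI[OF mero], intro conjI)
    fix \<nu> :: complex assume \<nu>: "2 < Re \<nu>"
    have nz: "Lambda (\<nu> + 2) \<noteq> 0" using \<nu> by (intro Lambda_nonzero) simp
    have "Lambda analytic_on {1 * \<nu> + 2}" using \<nu> by (intro Lambda_analytic) simp
    from analytic_on_affine[OF this] have "(\<lambda>\<nu>. Lambda (\<nu> + 2)) analytic_on {\<nu>}" by simp
    moreover have "\<nu> \<noteq> -2" "\<nu> \<noteq> 2" using \<nu> by auto
    ultimately show "?F analytic_on {\<nu>}" using F nz by blast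
    show "?F \<nu> = E_beta_series h \<nu>"
      using mellin_lattice_theta[OF y k h \<nu>] nz by simp
  qed
  show ?thesis
    unfolding E using remove_sings_at_analytic[OF F[OF \<nu>]] .
qed

section \<open>Averaging over the unit box\<close>

definition box_measure :: "(real \<times> real \<times> real \<times> real) measure" where
  "box_measure = restrict_space lborel unit_box"

definition pos_measure :: "real measure" where
  "pos_measure = restrict_space lborel {0<..}"

lemma unit_box_sets [measurable]: "unit_box \<in> sets borel"
  unfolding unit_box_def by (simp add: borel_prod[symmetric])

lemma set_integral_box: "(LINT x:unit_box|lborel. f x) = (LINT x|box_measure. f x)"
  for f :: "_ \<Rightarrow> complex"
  unfolding box_measure_def by (subst integral_restrict_space) (auto simp: set_lebesgue_integral_def)

lemma set_integral_pos: "(LINT x:{0<..}|lborel. f x) = (LINT x|pos_measure. f x)"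
  for f :: "_ \<Rightarrow> complex"
  unfolding pos_measure_def by (subst integral_restrict_space) (auto simp: set_lebesgue_integral_def)

lemma nn_integral_box_measure:
  assumes "f \<in> borel_measurable borel"
  shows "(\<integral>\<^sup>+x. f x \<partial>box_measure) = box_mean f"
  unfolding box_measure_def using nn_integral_unit_box[OF assms]
  by (subst nn_integral_restrict_space) auto

lemma prob_space_box: "prob_space box_measure"
proof (rule prob_spaceI)
  have "emeasure box_measure (space box_measure) = (\<integral>\<^sup>+x. 1 \<partial>box_measure)" by simp
  also have "\<dots> = 1" by (subst nn_integral_box_measure) auto
  finally show "emeasure box_measure (space box_measure) = 1" .
qed

lemma measurable_box_measure: "f \<in> borel_measurable borel \<Longrightarrow> f \<in> borel_measurable box_measure"
  unfolding box_measure_def by (rule measurable_restrict_space1) simp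

lemma measurable_pos_measure: "f \<in> borel_measurable borel \<Longrightarrow> f \<in> borel_measurable pos_measure"
  unfolding pos_measure_def by (rule measurable_restrict_space1) simp

lemma sigma_finite_pos: "sigma_finite_measure pos_measure"
  unfolding pos_measure_def by (rule sigma_finite_measure_restrict_space) (auto intro: sigma_finite_lborel)

lemma row_form_measurable: "(\<lambda>n. row_form y1 y2 n v) \<in> borel_measurable borel"
proof -
  obtain a b c d where v: "v = (a, b, c, d)" by (cases v)
  have "(\<lambda>n. row_form y1 y2 n v) = (\<lambda>n. (y1 * of_int a)\<^sup>2 + (y2 * (of_int a * fst n + of_int b))\<^sup>2
     + (1 / y2 * (of_int a * (fst n * snd (snd (snd n)) + fst (snd (snd n))) + of_int b * snd (snd (snd n)) + of_int d))\<^sup>2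
     + (1 / y1 * (of_int a * fst (snd n) + of_int b * fst (snd (snd n)) - of_int d * fst n + of_int c))\<^sup>2)"
    by (auto simp: v fun_eq_iff)
  also have "\<dots> \<in> borel_measurable borel"
    by (intro borel_measurable_continuous_onI continuous_intros)
  finally show ?thesis .
qed

lemma lattice_theta_jointly_measurable [measurable]:
  "(\<lambda>(x, t). lattice_theta y1 y2 (eta_prod x n) t) \<in> borel_measurable (borel \<Otimes>\<^sub>M borel)"
proof -
  have [measurable]: "(\<lambda>x. row_form y1 y2 (eta_prod x n) v) \<in> borel_measurable borel" for v
    by (rule measurable_compose[OF eta_prod_measurable row_form_measurable])
  show ?thesis unfolding lattice_theta_def gauss_theta_def case_prod_beta by measurable
qed

definition theta_avg :: "real \<Rightarrow> real \<Rightarrow> real \<times> real \<times> real \<times> real \<Rightarrow> real \<Rightarrow> real" where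
  "theta_avg y1 y2 n t = (LINT x|box_measure. lattice_theta y1 y2 (eta_prod x n) t)"

context
  fixes y1 y2 :: real and n :: "real \<times> real \<times> real \<times> real"
  assumes y: "y1 > 0" "y2 > 0"
begin

interpretation box: prob_space box_measure by (rule prob_space_box)
interpretation pos: sigma_finite_measure pos_measure by (rule sigma_finite_pos)
interpretation bp: pair_sigma_finite box_measure pos_measure ..

abbreviation "shifted_theta x t \<equiv> lattice_theta y1 y2 (eta_prod x n) t"

lemma th_measurable_x: "(\<lambda>x. shifted_theta x t) \<in> borel_measurable box_measure"
  by (rule measurable_box_measure) measurable

lemma theta_avg_measurable: "theta_avg y1 y2 n \<in> borel_measurable borel"
proof -
  have "(\<lambda>(t, x). shifted_theta x t) \<in> borel_measurable (borel \<Otimes>\<^sub>M box_measure)"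
  proof -
    have [measurable]: "(\<lambda>x. x) \<in> measurable box_measure borel"
      unfolding box_measure_def by (rule measurable_restrict_space1) simp
    have "(\<lambda>p. (\<lambda>(x, t). shifted_theta x t) (snd p, fst p)) \<in> borel_measurable (borel \<Otimes>\<^sub>M box_measure)"
      by (rule measurable_compose[OF _ lattice_theta_jointly_measurable]) measurable
    then show ?thesis by (simp add: case_prod_beta)
  qed
  from box.borel_measurable_lebesgue_integral[OF this] show ?thesis
    by (simp add: theta_avg_def[abs_def])
qed

text \<open>
  A mean over a probability space is as close to a constant as all the values are; the theta functions
  of the family therefore pass their bounds on to the average.
\<close>
lemma theta_avg_deviation:
  assumes "\<And>x. \<bar>shifted_theta x t - c\<bar> \<le> B"
  shows "integrable box_measure (\<lambda>x. shifted_theta x t)" "\<bar>theta_avg y1 y2 n t - c\<bar> \<le> B"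
proof -
  have i: "integrable box_measure (\<lambda>x. shifted_theta x t - c)"
    by (rule box.integrable_const_bound[of _ B]) (use assms th_measurable_x in auto)
  then have "integrable box_measure (\<lambda>x. (shifted_theta x t - c) + c)" by (intro Bochner_Integration.integrable_add) auto
  then show i2: "integrable box_measure (\<lambda>x. shifted_theta x t)" by simp
  have "theta_avg y1 y2 n t - c = (LINT x|box_measure. shifted_theta x t - c)"
    unfolding theta_avg_def using i2 by (simp add: box.prob_space)
  also have "\<bar>\<dots>\<bar> \<le> (LINT x|box_measure. \<bar>shifted_theta x t - c\<bar>)" by (rule integral_abs_bound)
  also have "\<dots> \<le> (LINT x|box_measure. B)"
    by (rule integral_mono) (use i assms in auto)
  finally show "\<bar>theta_avg y1 y2 n t - c\<bar> \<le> B" by (simp add: box.prob_space)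
qed

lemma theta_avg_eq_box_mean:
  assumes t: "t > 0"
  shows "theta_avg y1 y2 n t = enn2real (box_mean (\<lambda>x. gauss_theta (row_form y1 y2 (eta_prod x n)) t))"
proof -
  have [measurable]: "(\<lambda>x. row_form y1 y2 (eta_prod x n) v) \<in> borel_measurable borel" for v
    by (rule measurable_compose[OF eta_prod_measurable row_form_measurable])
  have m: "(\<lambda>x. gauss_theta (row_form y1 y2 (eta_prod x n)) t) \<in> borel_measurable borel"
    unfolding gauss_theta_def by measurable
  have "theta_avg y1 y2 n t = enn2real (\<integral>\<^sup>+x. ennreal (shifted_theta x t) \<partial>box_measure)"
    unfolding theta_avg_def by (rule integral_eq_nn_integral) (use th_measurable_x in \<open>auto simp: lattice_theta_def\<close>)
  also have "(\<integral>\<^sup>+x. ennreal (shifted_theta x t) \<partial>box_measure) = (\<integral>\<^sup>+x. gauss_theta (row_form y1 y2 (eta_prod x n)) t \<partial>box_measure)"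
    unfolding lattice_theta_def using lattice_theta_uniform(2)[OF y t] by (intro nn_integral_cong) (simp add: less_top)
  also have "\<dots> = box_mean (\<lambda>x. gauss_theta (row_form y1 y2 (eta_prod x n)) t)"
    by (rule nn_integral_box_measure[OF m])
  finally show ?thesis .
qed

lemma theta_avg_bounds:
  "\<exists>C. theta_bounds 2 C (theta_avg y1 y2 n) \<and> (\<forall>x. theta_bounds 2 C (shifted_theta x))"
proof -
  obtain C where C: "\<And>n. theta_bounds 2 C (lattice_theta y1 y2 n)" using lattice_theta_uniform(1)[OF y] by blast
  have "theta_bounds 2 C (theta_avg y1 y2 n)"
    unfolding theta_bounds_def
    by (intro conjI allI impI theta_avg_deviation(2)) (use C in \<open>auto simp: theta_bounds_def\<close>)
  then show ?thesis using C by blast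
qed

text \<open>
  Fubini for the regular part, with the majorant \<open>mellin_dom\<close> that serves all points of the box; the polar
  part is constant on the box, which has volume 1.
\<close>
lemma mellin_theta_avg:
  "(LINT x:unit_box|lborel. mellin 2 (lattice_theta y1 y2 (eta_prod x n)) w) = mellin 2 (theta_avg y1 y2 n) w"
proof -
  obtain C where C: "theta_bounds 2 C (theta_avg y1 y2 n)" "\<And>x. theta_bounds 2 C (shifted_theta x)"
    using theta_avg_bounds by blast
  \<comment> \<open>This order makes the bounds dominate \<open>t^(w-1)\<close> at both ends.\<close>
  obtain N :: nat where N: "real N \<ge> \<bar>Re (w - 1)\<bar> + 2" using real_arch_simple by blast
  define G where "G x t = (of_real t powr (w - 1) * of_real (shifted_theta x t - theta_main 2 t) :: complex)" for x t
  have meas: "(\<lambda>(x, t). G x t) \<in> borel_measurable (box_measure \<Otimes>\<^sub>M pos_measure)"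
  proof -
    have [measurable]: "(\<lambda>x. x) \<in> measurable box_measure borel"
      unfolding box_measure_def by (rule measurable_restrict_space1) simp
    have [measurable]: "(\<lambda>x. x) \<in> measurable pos_measure borel"
      unfolding pos_measure_def by (rule measurable_restrict_space1) simp
    have "(\<lambda>(x, t). G x t) \<in> borel_measurable (borel \<Otimes>\<^sub>M borel)" unfolding G_def by measurable
    from measurable_compose[OF _ this, of "\<lambda>p. (fst p, snd p)"]
    have "(\<lambda>p. (\<lambda>(x, t). G x t) (fst p, snd p)) \<in> borel_measurable (box_measure \<Otimes>\<^sub>M pos_measure)" by measurable
    then show ?thesis by (simp add: case_prod_beta)
  qed
  have dom: "integrable pos_measure (\<lambda>t. C N * mellin_dom t)"
  proof (rule integrable_mult_right)
    show "integrable pos_measure mellin_dom"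
      using set_integrable_mellin_dom unfolding pos_measure_def set_integrable_def
      by (subst integrable_restrict_space) auto
  qed
  have "integrable (box_measure \<Otimes>\<^sub>M pos_measure) (\<lambda>(x, t). C N * mellin_dom t)"
  proof (rule bp.Fubini_integrable)
    show "(\<lambda>(x, t). C N * mellin_dom t) \<in> borel_measurable (box_measure \<Otimes>\<^sub>M pos_measure)"
    proof -
      have "mellin_dom \<in> borel_measurable pos_measure" by (rule measurable_pos_measure) (rule mellin_dom_measurable)
      from measurable_compose[OF measurable_snd this]
      have "(\<lambda>p. C N * mellin_dom (snd p)) \<in> borel_measurable (box_measure \<Otimes>\<^sub>M pos_measure)"
        by (intro borel_measurable_times borel_measurable_const)
      then show ?thesis by (simp add: case_prod_beta)
    qed
    show "integrable box_measure (\<lambda>x. LINT t|pos_measure. norm (case (x, t) of (x, t) \<Rightarrow> C N * mellin_dom t))" by simp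
    show "AE x in box_measure. integrable pos_measure (\<lambda>t. case (x, t) of (x, t) \<Rightarrow> C N * mellin_dom t)"
      using dom by simp
  qed
  then have fub: "integrable (box_measure \<Otimes>\<^sub>M pos_measure) (\<lambda>(x, t). G x t)"
  proof (rule Bochner_Integration.integrable_bound[OF _ meas])
    show "AE p in box_measure \<Otimes>\<^sub>M pos_measure. norm (case p of (x, t) \<Rightarrow> G x t) \<le> norm (case p of (x, t) \<Rightarrow> C N * mellin_dom t)"
    proof (rule AE_I2)
      fix p assume "p \<in> space (box_measure \<Otimes>\<^sub>M pos_measure)"
      then obtain x t where p: "p = (x, t)" "t > 0"
        by (auto simp: space_pair_measure pos_measure_def space_restrict_space)
      have "norm (G x t) \<le> C N * mellin_dom t"
        using theta_bounds_dom[OF C(2) N p(2), of x] p(2)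
        by (simp add: G_def norm_mult norm_powr_real_powr flip: of_real_diff)
      then show "norm (case p of (x, t) \<Rightarrow> G x t) \<le> norm (case p of (x, t) \<Rightarrow> C N * mellin_dom t)"
        by (simp add: p)
    qed
  qed
  have inner: "(LINT x|box_measure. G x t) = of_real t powr (w - 1) * of_real (theta_avg y1 y2 n t - theta_main 2 t)" if "t > 0" for t
  proof -
    have "\<bar>shifted_theta x t - theta_main 2 t\<bar> \<le> C 0" for x
      using C(2)[of x] that power_one_right unfolding theta_bounds_def theta_main_def
      by (auto dest!: spec[of _ "0::nat"])
    then have i: "integrable box_measure (\<lambda>x. shifted_theta x t)" by (rule theta_avg_deviation)
    have "(LINT x|box_measure. G x t) = of_real t powr (w - 1) * (LINT x|box_measure. of_real (shifted_theta x t - theta_main 2 t))"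
      unfolding G_def by simp
    also have "(LINT x|box_measure. of_real (shifted_theta x t - theta_main 2 t)) = (of_real (theta_avg y1 y2 n t - theta_main 2 t) :: complex)"
      unfolding integral_complex_of_real theta_avg_def using i by (simp add: box.prob_space)
    finally show ?thesis .
  qed
  have "(LINT x:unit_box|lborel. mellin 2 (lattice_theta y1 y2 (eta_prod x n)) w) =
    (LINT x|box_measure. (LINT t|pos_measure. G x t) + (1 / (w - of_real 2) - 1 / w))"
    unfolding set_integral_box mellin_def set_integral_pos G_def by (simp add: algebra_simps)
  also have "\<dots> = (LINT x|box_measure. (LINT t|pos_measure. G x t)) + (1 / (w - of_real 2) - 1 / w)"
    by (subst Bochner_Integration.integral_add) (use bp.integrable_fst[OF fub] in \<open>auto simp: box.prob_space\<close>)
  also have "(LINT x|box_measure. (LINT t|pos_measure. G x t)) = (LINT t|pos_measure. (LINT x|box_measure. G x t))"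
    by (rule bp.Fubini_integral[OF fub, symmetric])
  also have "\<dots> = (LINT t|pos_measure. of_real t powr (w - 1) * of_real (theta_avg y1 y2 n t - theta_main 2 t))"
    by (rule Bochner_Integration.integral_cong[OF refl], rule inner) (simp add: pos_measure_def space_restrict_space)
  finally show ?thesis unfolding mellin_def set_integral_pos by (simp add: algebra_simps)
qed

end

section \<open>The constant term\<close>

lemma mellin_scale:
  fixes z :: "real \<Rightarrow> real" and u :: complex
  assumes a: "a > 0" and i: "set_integrable lborel {0<..} (\<lambda>t. of_real t powr (u - 1) * of_real (z t) :: complex)"
  shows "set_integrable lborel {0<..} (\<lambda>t. of_real t powr (u - 1) * of_real (z (a * t)) :: complex)"
    and "(LINT t:{0<..}|lborel. of_real t powr (u - 1) * of_real (z (a * t))) =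
      of_real a powr (- u) * (LINT t:{0<..}|lborel. of_real t powr (u - 1) * of_real (z t))"
proof -
  define F where "F t = indicat_real {0<..} t *\<^sub>R (of_real t powr (u - 1) * of_real (z t) :: complex)" for t
  define H where "H t = indicat_real {0<..} t *\<^sub>R (of_real t powr (u - 1) * of_real (z (a * t)) :: complex)" for t
  have HF: "H t = of_real a powr (1 - u) * F (0 + a * t)" for t
  proof (cases "t > 0")
    case True
    have "of_real (a * t) powr (u - 1) = of_real a powr (u - 1) * (of_real t powr (u - 1) :: complex)"
      using a True powr_times_real[of a t "u - 1"] by simp
    moreover have "of_real a powr (1 - u) * of_real a powr (u - 1) = (1 :: complex)"
      using a by (simp flip: powr_add)
    ultimately show ?thesis using a True by (simp add: H_def F_def)
  next
    case False
    then show ?thesis using a by (simp add: H_def F_def zero_less_mult_iff)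
  qed
  have iF: "integrable lborel F" using i by (simp add: set_integrable_def F_def[abs_def])
  have iF2: "integrable lborel (\<lambda>t. F (0 + a * t))"
    using lborel_integrable_real_affine[OF iF, of a 0] a by simp
  then have "integrable lborel (\<lambda>t. of_real a powr (1 - u) * F (0 + a * t))" by (intro integrable_mult_right)
  then show "set_integrable lborel {0<..} (\<lambda>t. of_real t powr (u - 1) * of_real (z (a * t)) :: complex)"
    unfolding set_integrable_def H_def[symmetric] HF .
  have "integral\<^sup>L lborel F = a *\<^sub>R (LINT t|lborel. F (0 + a * t))"
    using lborel_integral_real_affine[of a F 0] a by simp
  then have "of_real a powr (- u) * integral\<^sup>L lborel F = (of_real a powr (- u) * of_real a) * (LINT t|lborel. F (0 + a * t))"
    by (simp add: scaleR_conv_of_real)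
  also have "of_real a powr (- u) * of_real a = (of_real a powr (1 - u) :: complex)"
    using a by (simp add: powr_diff powr_minus divide_inverse)
  also have "of_real a powr (1 - u) * (LINT t|lborel. F (0 + a * t)) = (LINT t|lborel. H t)"
    unfolding HF by simp
  finally show "(LINT t:{0<..}|lborel. of_real t powr (u - 1) * of_real (z (a * t))) =
      of_real a powr (- u) * (LINT t:{0<..}|lborel. of_real t powr (u - 1) * of_real (z t))"
    unfolding set_lebesgue_integral_def F_def[symmetric] H_def[symmetric] by simp
qed

lemma gauss_sum_nz_scale: "gauss_sum_nz l t = gauss_sum_nz 1 (l\<^sup>2 * t)"
  unfolding gauss_sum_nz_def gauss_def by (simp add: power_mult_distrib mult_ac)

lemma theta_avg_eq:
  assumes y: "y1 > 0" "y2 > 0" and t: "t > 0"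
  shows "theta_avg y1 y2 n t - 1 = (jacobi_theta (1 / y1\<^sup>2 * t) - 1)
     + y1 * t powr (- (1 / 2)) * (jacobi_theta (1 / y2\<^sup>2 * t) - 1)
     + y1 * y2 * t powr (- 1) * (jacobi_theta (y2\<^sup>2 * t) - 1)
     + y1 * t powr (- (3 / 2)) * (jacobi_theta (y1\<^sup>2 * t) - 1)"
proof -
  have h: "t powr (- (1 / 2)) = 1 / sqrt t" using t by (simp only: powr_minus_divide powr_half_sqrt[OF less_imp_le[OF t]])
  have h1: "t powr (- 1) = 1 / sqrt t * (1 / sqrt t)" using t by (simp add: powr_minus divide_inverse flip: inverse_mult_distrib)
  have h3: "t powr (- (3 / 2)) = 1 / sqrt t * (1 / sqrt t * (1 / sqrt t))"
    using powr_add[of t "- 1" "- (1 / 2)"] unfolding h h1 by simp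
  have g1: "gauss_mass (1 / y1) t = ennreal (y1 * t powr (- (1 / 2)))" using y by (simp add: gauss_mass_def h)
  have g2: "gauss_mass (1 / y2) t * gauss_mass (1 / y1) t = ennreal (y1 * y2 * t powr (- 1))"
    unfolding gauss_mass_def h1 using y t by (simp add: ennreal_mult[symmetric] field_simps)
  have g3: "gauss_mass y2 t * (gauss_mass (1 / y2) t * gauss_mass (1 / y1) t) = ennreal (y1 * t powr (- (3 / 2)))"
    unfolding gauss_mass_def h3 using y t by (simp add: ennreal_mult[symmetric] field_simps)
  have z: "gauss_sum_nz l t = ennreal (jacobi_theta (l\<^sup>2 * t) - 1)" "0 \<le> jacobi_theta (l\<^sup>2 * t) - 1" if "l > 0" for l
    unfolding gauss_sum_nz_scale[of l t] using gauss_sum_nz_eq_jacobi_theta[of "l\<^sup>2 * t"] that t by auto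
  let ?a = "jacobi_theta (1 / y1\<^sup>2 * t) - 1"
  let ?b = "jacobi_theta (1 / y2\<^sup>2 * t) - 1"
  let ?c = "jacobi_theta (y2\<^sup>2 * t) - 1"
  let ?d = "jacobi_theta (y1\<^sup>2 * t) - 1"
  have za: "gauss_sum_nz (1 / y1) t = ennreal ?a" "0 \<le> ?a" using z[of "1 / y1"] y by (simp_all add: power_divide)
  have zb: "gauss_sum_nz (1 / y2) t = ennreal ?b" "0 \<le> ?b" using z[of "1 / y2"] y by (simp_all add: power_divide)
  have zc: "gauss_sum_nz y2 t = ennreal ?c" "0 \<le> ?c" using z[of y2] y by auto
  have zd: "gauss_sum_nz y1 t = ennreal ?d" "0 \<le> ?d" using z[of y1] y by auto
  have "box_mean (\<lambda>x. gauss_theta (row_form y1 y2 (eta_prod x n)) t) =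
     ennreal 1 + ennreal ?a + ennreal ?b * ennreal (y1 * t powr (- (1 / 2))) + ennreal ?c * ennreal (y1 * y2 * t powr (- 1))
     + ennreal ?d * ennreal (y1 * t powr (- (3 / 2)))"
    unfolding mean_theta[OF y t] g3 unfolding g2 unfolding g1 za zb zc zd by (simp only: ennreal_1)
  also have "\<dots> = ennreal (1 + ?a + ?b * (y1 * t powr (- (1 / 2))) + ?c * (y1 * y2 * t powr (- 1)) + ?d * (y1 * t powr (- (3 / 2))))"
    using y za(2) zb(2) zc(2) zd(2)
    by (simp only: ennreal_mult[symmetric] ennreal_plus[symmetric] mult_nonneg_nonneg add_nonneg_nonneg powr_ge_zero less_imp_le zero_le_one)
  finally have "theta_avg y1 y2 n t = 1 + ?a + ?b * (y1 * t powr (- (1 / 2))) + ?c * (y1 * y2 * t powr (- 1)) + ?d * (y1 * t powr (- (3 / 2)))"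
    unfolding theta_avg_eq_box_mean[OF y t] using y za(2) zb(2) zc(2) zd(2)
    by (simp only: enn2real_ennreal mult_nonneg_nonneg add_nonneg_nonneg powr_ge_zero less_imp_le zero_le_one)
  then show ?thesis by (simp add: mult_ac)
qed

lemma mellin_jacobi_theta_scaled:
  assumes a: "a > 0" and u: "Re u > 1 / 2"
  shows "set_integrable lborel {0<..} (\<lambda>t. of_real t powr (u - 1) * of_real (jacobi_theta (a * t) - 1) :: complex)"
    and "(LINT t:{0<..}|lborel. of_real t powr (u - 1) * of_real (jacobi_theta (a * t) - 1)) = of_real a powr (- u) * (2 * Lambda (2 * u))"
proof -
  note s = mellin_scale[OF a mellin_jacobi_theta(1)[OF u]]
  show "set_integrable lborel {0<..} (\<lambda>t. of_real t powr (u - 1) * of_real (jacobi_theta (a * t) - 1) :: complex)"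
    by (rule s(1))
  have "2 * Lambda (2 * u) = mellin (1 / 2) jacobi_theta u" using Lambda_eq_mellin[of "2 * u"] u by simp
  then show "(LINT t:{0<..}|lborel. of_real t powr (u - 1) * of_real (jacobi_theta (a * t) - 1)) = of_real a powr (- u) * (2 * Lambda (2 * u))"
    using s(2) mellin_jacobi_theta(2)[OF u] by simp
qed

text \<open>
  Each rescaled Jacobi theta function contributes one value of \<open>\<Lambda>\<close>: a factor \<open>t^(-j/2)\<close> moves the argument from
  \<open>2 w\<close> to \<open>2 w - j\<close>, and the scaling produces the power of \<open>y1\<close> or \<open>y2\<close>. The hypothesis on \<open>w\<close> puts all four
  arguments into the half-plane of convergence.
\<close>
lemma mellin_theta_avg_eq:
  assumes y: "y1 > 0" "y2 > 0" and w: "Re w > 2"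
  shows "mellin 2 (theta_avg y1 y2 n) w =
     2 * (of_real y1 powr (2 * w) * Lambda (2 * w)
      + of_real y1 * of_real y2 powr (2 * w - 1) * Lambda (2 * w - 1)
      + of_real y1 * of_real y2 powr (3 - 2 * w) * Lambda (2 * w - 2)
      + of_real y1 powr (4 - 2 * w) * Lambda (2 * w - 3))"
proof -
  obtain C where C: "theta_bounds 2 C (theta_avg y1 y2 n)" using theta_avg_bounds[OF y] by blast
  define f where "f a u t = indicat_real {0<..} t *\<^sub>R (of_real t powr (u - 1) * of_real (jacobi_theta (a * t) - 1) :: complex)" for a u t
  have f: "integrable lborel (f a u)" "integral\<^sup>L lborel (f a u) = of_real a powr (- u) * (2 * Lambda (2 * u))"
    if "a > 0" "Re u > 1 / 2" for a u
    using mellin_jacobi_theta_scaled[OF that] unfolding set_integrable_def set_lebesgue_integral_def f_def[symmetric] by auto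
  have eq: "indicat_real {0<..} t *\<^sub>R (of_real t powr (w - 1) * of_real (theta_avg y1 y2 n t - 1) :: complex) =
     f (1 / y1\<^sup>2) w t + of_real y1 * f (1 / y2\<^sup>2) (w - 1 / 2) t + of_real (y1 * y2) * f (y2\<^sup>2) (w - 1) t + of_real y1 * f (y1\<^sup>2) (w - 3 / 2) t" for t
  proof (cases "t > 0")
    case True
    have p: "of_real (t powr (- r)) * of_real t powr (w - 1) = (of_real t powr (w - of_real r - 1) :: complex)" for r
    proof -
      have "of_real (t powr (- r)) = (of_real t powr (of_real (- r)) :: complex)"
        using True by (subst powr_of_real) auto
      then show ?thesis using powr_add[of "of_real t :: complex" "of_real (- r)" "w - 1"] by (simp add: algebra_simps)
    qed
    have p1: "of_real (t powr (- (1 / 2))) * of_real t powr (w - 1) = (of_real t powr (w - 1 / 2 - 1) :: complex)"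
      and p2: "of_real (t powr (- 1)) * of_real t powr (w - 1) = (of_real t powr (w - 1 - 1) :: complex)"
      and p3: "of_real (t powr (- (3 / 2))) * of_real t powr (w - 1) = (of_real t powr (w - 3 / 2 - 1) :: complex)"
      using p[of "1 / 2"] p[of 1] p[of "3 / 2"] by simp_all
    show ?thesis using True
      unfolding f_def theta_avg_eq[OF y True] p1[symmetric] p2[symmetric] p3[symmetric]
      by (simp add: algebra_simps)
  next
    case False
    then show ?thesis by (simp add: f_def)
  qed
  have c: "1 / y1\<^sup>2 > 0" "1 / y2\<^sup>2 > 0" "y2\<^sup>2 > 0" "y1\<^sup>2 > 0" using y by auto
  have r: "Re w > 1 / 2" "Re (w - 1 / 2) > 1 / 2" "Re (w - 1) > 1 / 2" "Re (w - 3 / 2) > 1 / 2" using w by auto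
  note f1 = f[OF c(1) r(1)] and f2 = f[OF c(2) r(2)] and f3 = f[OF c(3) r(3)] and f4 = f[OF c(4) r(4)]
  have "mellin 2 (theta_avg y1 y2 n) w = (LINT t:{0<..}|lborel. of_real t powr (w - 1) * of_real (theta_avg y1 y2 n t - 1))"
    by (rule mellin_eq_integral(2)[OF C theta_avg_measurable[OF y]]) (use w in auto)
  also have "\<dots> = integral\<^sup>L lborel (f (1 / y1\<^sup>2) w) + of_real y1 * integral\<^sup>L lborel (f (1 / y2\<^sup>2) (w - 1 / 2))
     + of_real (y1 * y2) * integral\<^sup>L lborel (f (y2\<^sup>2) (w - 1)) + of_real y1 * integral\<^sup>L lborel (f (y1\<^sup>2) (w - 3 / 2))"
    unfolding set_lebesgue_integral_def eq
  proof -
    note I1 = f1(1) and I2 = integrable_mult_right[OF f2(1), of "of_real y1"]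
      and I3 = integrable_mult_right[OF f3(1), of "of_real (y1 * y2)"] and I4 = integrable_mult_right[OF f4(1), of "of_real y1"]
    note A2 = Bochner_Integration.integrable_add[OF I1 I2]
    note A3 = Bochner_Integration.integrable_add[OF A2 I3]
    show "(LINT t|lborel. f (1 / y1\<^sup>2) w t + of_real y1 * f (1 / y2\<^sup>2) (w - 1 / 2) t + of_real (y1 * y2) * f (y2\<^sup>2) (w - 1) t + of_real y1 * f (y1\<^sup>2) (w - 3 / 2) t)
      = integral\<^sup>L lborel (f (1 / y1\<^sup>2) w) + of_real y1 * integral\<^sup>L lborel (f (1 / y2\<^sup>2) (w - 1 / 2))
     + of_real (y1 * y2) * integral\<^sup>L lborel (f (y2\<^sup>2) (w - 1)) + of_real y1 * integral\<^sup>L lborel (f (y1\<^sup>2) (w - 3 / 2))"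
      unfolding Bochner_Integration.integral_add[OF A3 I4] Bochner_Integration.integral_add[OF A2 I3]
        Bochner_Integration.integral_add[OF I1 I2] integral_mult_right_zero ..
  qed
  also have "\<dots> = of_real y1 powr (2 * w) * (2 * Lambda (2 * w))
     + of_real y1 * (of_real y2 powr (2 * w - 1) * (2 * Lambda (2 * w - 1)))
     + of_real (y1 * y2) * (of_real y2 powr (2 - 2 * w) * (2 * Lambda (2 * w - 2)))
     + of_real y1 * (of_real y1 powr (3 - 2 * w) * (2 * Lambda (2 * w - 3)))"
  proof -
    have i: "of_real (1 / x\<^sup>2) powr (- u) = of_real x powr (2 * u :: complex)" if "x > 0" for x u
      using of_real_inverse_powr[of "x\<^sup>2" "- u"] of_real_square_powr[of x u] that by simp
    have e: "2 * (w - 1 / 2) = 2 * w - 1" "2 * (w - 1) = 2 * w - 2" "2 * (w - 3 / 2) = 2 * w - 3"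
      "2 * - (w - 1) = 2 - 2 * w" "2 * - (w - 3 / 2) = 3 - 2 * w" by (simp_all add: algebra_simps)
    show ?thesis
      unfolding f1(2) f2(2) f3(2) f4(2) i[OF y(1)] i[OF y(2)] of_real_square_powr[OF y(1)] of_real_square_powr[OF y(2)] e ..
  qed
  also have "of_real (y1 * y2) * (of_real y2 powr (2 - 2 * w) * (2 * Lambda (2 * w - 2))) =
     of_real y1 * of_real y2 powr (3 - 2 * w) * (2 * Lambda (2 * w - 2))"
  proof -
    have "of_real y2 * of_real y2 powr (2 - 2 * w) = (of_real y2 powr (3 - 2 * w) :: complex)"
      using powr_add[of "of_real y2 :: complex" 1 "2 - 2 * w"] y by simp
    then show ?thesis by (simp add: mult_ac)
  qed
  also have "of_real y1 * (of_real y1 powr (3 - 2 * w) * (2 * Lambda (2 * w - 3))) = of_real y1 powr (4 - 2 * w) * (2 * Lambda (2 * w - 3))"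
  proof -
    have "of_real y1 * of_real y1 powr (3 - 2 * w) = (of_real y1 powr (4 - 2 * w) :: complex)"
      using powr_add[of "of_real y1 :: complex" 1 "3 - 2 * w"] y by simp
    then show ?thesis by (simp add: mult.assoc[symmetric])
  qed
  finally show ?thesis by (simp add: algebra_simps)
qed

text \<open>
  At these \<open>\<nu>\<close> the Eisenstein series is a quotient of a Mellin transform by \<open>2 \<Lambda>(\<nu> + 2)\<close> simultaneously at
  all points of the domain of integration.
\<close>
lemma Lambda_regular_cosparse:
  "\<forall>\<^sub>\<approx>\<nu>\<in>UNIV. \<nu> \<noteq> -2 \<and> \<nu> \<noteq> 2 \<and> (\<lambda>\<nu>. Lambda (\<nu> + 2)) analytic_on {\<nu>} \<and> Lambda (\<nu> + 2) \<noteq> 0"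
proof -
  have m: "(\<lambda>\<nu>. Lambda (\<nu> + 2)) meromorphic_on UNIV"
    using meromorphic_on_affine[OF Lambda_meromorphic, of 1 2] by simp
  have 1: "\<forall>\<^sub>\<approx>\<nu>\<in>UNIV. (\<lambda>\<nu>. Lambda (\<nu> + 2)) analytic_on {\<nu>}"
    by (rule meromorphic_on_imp_analytic_cosparse[OF m])
  have 2: "\<forall>\<^sub>\<approx>\<nu>\<in>UNIV. Lambda (\<nu> + 2) \<noteq> 0"
  proof -
    have "\<not> (\<forall>\<^sub>\<approx>\<nu>\<in>UNIV. Lambda (\<nu> + 2) = 0)"
    proof
      assume "\<forall>\<^sub>\<approx>\<nu>\<in>UNIV. Lambda (\<nu> + 2) = 0"
      then have "\<forall>\<^sub>F \<nu> in at 5. Lambda (\<nu> + 2) = 0" by (rule eventually_cosparse_imp_eventually_at) simp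
      moreover have "\<forall>\<^sub>F \<nu> in at 5. \<nu> \<in> {z. 4 < Re z}"
        by (rule eventually_at_in_open') (auto simp: open_halfspace_Re_gt)
      ultimately have "\<forall>\<^sub>F \<nu> in at (5 :: complex). False"
        by eventually_elim (use Lambda_nonzero in auto)
      then show False by simp
    qed
    then show ?thesis using meromorphic_imp_constant_or_avoid[OF m, of 0] by auto
  qed
  have 3: "\<forall>\<^sub>\<approx>\<nu>\<in>UNIV. \<nu> \<noteq> c" for c :: complex
    by (simp add: eventually_cosparse_open_eq eventually_neq_at_within)
  show ?thesis using 1 2 3[of "-2"] 3[of 2] by eventually_elim blast
qed

theorem corollary7p6:
  fixes g :: "real^4^4"
  assumes "g \<in> Sp4R"
  shows "C0_beta g meromorphic_on UNIV \<and>
    (\<forall>\<^sub>\<approx>\<nu>\<in>UNIV. C0_beta g \<nu> =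
        of_real (iwasawa_y1 g) powr (\<nu> + 2)
      + Lambda (\<nu> + 1) / Lambda (\<nu> + 2)
          * of_real (iwasawa_y1 g) * of_real (iwasawa_y2 g) powr (\<nu> + 1)
      + Lambda \<nu> / Lambda (\<nu> + 1) * (Lambda (\<nu> + 1) / Lambda (\<nu> + 2))
          * of_real (iwasawa_y1 g) * of_real (iwasawa_y2 g) powr (- \<nu> + 1)
      + Lambda (\<nu> - 1) / Lambda \<nu> * (Lambda \<nu> / Lambda (\<nu> + 1)) * (Lambda (\<nu> + 1) / Lambda (\<nu> + 2))
          * of_real (iwasawa_y1 g) powr (- \<nu> + 2))"
proof -
  obtain n y1 y2 k where y: "y1 > 0" "y2 > 0" and k: "k \<in> K4" and g: "g = eta n ** diag4 y1 y2 ** k"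
    using iwasawa_exists[OF assms] .
  have Y: "iwasawa_y1 g = y1" "iwasawa_y2 g = y2"
    using iwasawa_y_eq[OF y k, of n] by (simp_all add: g iwasawa_y1_def iwasawa_y2_def)
  define F where "F = (\<lambda>\<nu>. mellin 2 (theta_avg y1 y2 n) ((\<nu> + 2) / 2) / (2 * Lambda (\<nu> + 2)))"
  define R where "R = (\<lambda>\<nu>. of_real y1 powr (\<nu> + 2)
      + Lambda (\<nu> + 1) / Lambda (\<nu> + 2) * of_real y1 * of_real y2 powr (\<nu> + 1)
      + Lambda \<nu> / Lambda (\<nu> + 1) * (Lambda (\<nu> + 1) / Lambda (\<nu> + 2)) * of_real y1 * of_real y2 powr (- \<nu> + 1)
      + Lambda (\<nu> - 1) / Lambda \<nu> * (Lambda \<nu> / Lambda (\<nu> + 1)) * (Lambda (\<nu> + 1) / Lambda (\<nu> + 2))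
          * of_real y1 powr (- \<nu> + 2))"
  have C0: "C0_beta g \<nu> = F \<nu>"
    if \<nu>: "\<nu> \<noteq> -2 \<and> \<nu> \<noteq> 2 \<and> (\<lambda>\<nu>. Lambda (\<nu> + 2)) analytic_on {\<nu>} \<and> Lambda (\<nu> + 2) \<noteq> 0" for \<nu>
  proof -
    have E: "E_beta (eta x ** g) \<nu> = mellin 2 (lattice_theta y1 y2 (eta_prod x n)) ((\<nu> + 2) / 2) / (2 * Lambda (\<nu> + 2))" for x
    proof (rule E_beta_eq_mellin[OF y k])
      show "eta x ** g = eta (eta_prod x n) ** diag4 y1 y2 ** k"
        unfolding g eta_eta_prod[symmetric] by (simp only: matrix_mul_assoc)
      show "eta x ** g \<in> Sp4R" using eta_Sp4R assms by (rule Sp4R_mult)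
    qed (use \<nu> in auto)
    have "C0_beta g \<nu> = (LINT x:unit_box|lborel. mellin 2 (lattice_theta y1 y2 (eta_prod x n)) ((\<nu> + 2) / 2)) / (2 * Lambda (\<nu> + 2))"
      unfolding C0_beta_def E by (simp add: set_integral_box)
    then show ?thesis unfolding mellin_theta_avg[OF y] F_def .
  qed
  have ev: "\<forall>\<^sub>\<approx>\<nu>\<in>UNIV. C0_beta g \<nu> = F \<nu>"
    using Lambda_regular_cosparse by eventually_elim (rule C0)
  have L: "(\<lambda>\<nu>. Lambda (\<nu> + c)) meromorphic_on UNIV" for c
    using meromorphic_on_affine[OF Lambda_meromorphic, of 1 c] by simp
  have L': "(\<lambda>\<nu>. Lambda (\<nu> - 1)) meromorphic_on UNIV" using L[of "-1"] by simp
  have P: "(\<lambda>\<nu>. of_real x powr (a * \<nu> + c)) meromorphic_on UNIV" if "x > 0" for x :: real and a c :: complex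
    by (intro analytic_on_imp_meromorphic_on analytic_intros)
      (use that in \<open>auto simp: complex_nonpos_Reals_iff\<close>)
  have P': "(\<lambda>\<nu>. of_real x powr (\<nu> + c)) meromorphic_on UNIV" "(\<lambda>\<nu>. of_real x powr (- \<nu> + c)) meromorphic_on UNIV"
    if "x > 0" for x :: real and c :: complex
    using P[OF that, of 1 c] P[OF that, of "-1" c] by simp_all
  have F: "F meromorphic_on UNIV"
  proof -
    obtain C where C: "theta_bounds 2 C (theta_avg y1 y2 n)" using theta_avg_bounds[OF y] by blast
    have "(\<lambda>\<nu>. mellin 2 (theta_avg y1 y2 n) (1 / 2 * \<nu> + 1)) meromorphic_on UNIV"
      by (intro meromorphic_on_affine mellin_meromorphic[OF C theta_avg_measurable[OF y]])
    then have "(\<lambda>\<nu>. mellin 2 (theta_avg y1 y2 n) (1 / 2 * \<nu> + 1) / (2 * Lambda (\<nu> + 2))) meromorphic_on UNIV"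
      by (intro meromorphic_on_divide meromorphic_on_mult meromorphic_on_const L)
    then show ?thesis by (simp add: F_def add_divide_distrib)
  qed
  have R: "R meromorphic_on UNIV"
    unfolding R_def
    by (intro meromorphic_on_add meromorphic_on_mult meromorphic_on_divide meromorphic_on_const L L' Lambda_meromorphic P' y)
  have FR: "\<forall>\<^sub>\<approx>\<nu>\<in>UNIV. F \<nu> = R \<nu>"
  \<comment> \<open>For \<open>Re \<nu> > 4\<close> the arguments of \<open>\<Lambda>\<close> in the denominators have real part at least 3, so no denominator vanishes.\<close>
  proof (rule meromorphic_identity[OF F R, of 4])
    fix \<nu> :: complex assume \<nu>: "Re \<nu> > 4"
    have nz: "Lambda (\<nu> + 2) \<noteq> 0" "Lambda (\<nu> + 1) \<noteq> 0" "Lambda \<nu> \<noteq> 0"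
      using \<nu> by (auto intro!: Lambda_nonzero)
    have e: "2 * ((\<nu> + 2) / 2) = \<nu> + 2" "\<nu> + 2 - 1 = \<nu> + 1" "3 - (\<nu> + 2) = - \<nu> + 1" "\<nu> + 2 - 2 = \<nu>"
      "4 - (\<nu> + 2) = - \<nu> + 2" "\<nu> + 2 - 3 = \<nu> - 1" by simp_all
    have "Re ((\<nu> + 2) / 2) > 2" using \<nu> by simp
    from mellin_theta_avg_eq[OF y this, of n] show "F \<nu> = R \<nu>"
      unfolding F_def R_def e using nz by (simp add: field_simps)
  qed
  have "\<forall>\<^sub>\<approx>\<nu>\<in>UNIV. C0_beta g \<nu> = R \<nu>" using ev FR by eventually_elim simp
  moreover have "C0_beta g meromorphic_on UNIV"
    using meromorphic_on_cong'[OF ev refl] F by simp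
  ultimately show ?thesis unfolding Y R_def by blast
qed

end
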